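(* Let $H$ be a Hopf algebra, $\chi:H\otimes H\to k$ a unital 2-cocycle, $\Omega^1$ a first order bicovariant differential calculus on $H$, and $\pi:\ker\epsilon\to V$ the projection corresponding to $\Omega^1$. Then the twisted calculus $\Omega^{1\chi}$ on $H^\chi$ corresponds to the projection $\pi^\chi=\pi\circ\alpha^{-1}$, where $$\alpha:\mathcal{F}^\chi(H)\to H^\chi,\qquad\alpha(h)=\chi^{-1}(h_{(1)}\otimes Sh_{(5)})\,\chi(h_{(3)}\otimes Sh_{(4)})\,h_{(2)}$$ is an isomorphism in ${}^{H^\chi}_{H^\chi}\dot{\mathcal M}$ with inverse $$\alpha^{-1}(h)=\chi^{-1}(h_{(1)}Sh_{(3)}\otimes h_{(4)})\,h_{(2)},$$ and $\alpha$ restricts to an isomorphism $\mathcal{F}^\chi(\ker\epsilon)\cong\ker\epsilon$.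
   Context: $k$ is a field; Hopf algebras have invertible antipode; Sweedler notation $\Delta h=h_{(1)}\otimes h_{(2)}$. A unital 2-cocycle on $H$ is a convolution-invertible linear map $\chi:H\otimes H\to k$ with $\chi(g_{(1)}\otimes f_{(1)})\chi(h\otimes g_{(2)}f_{(2)})=\chi(h_{(1)}\otimes g_{(1)})\chi(h_{(2)}g_{(2)}\otimes f)$ and $\chi(1\otimes h)=\epsilon(h)$. $H^\chi$ is the Hopf algebra with the same coalgebra and unit as $H$ and with product $h\bullet g=\chi(h_{(1)}\otimes g_{(1)})h_{(2)}g_{(2)}\chi^{-1}(h_{(3)}\otimes g_{(3)})$ and antipode $S^\chi h=U(h_{(1)})\,Sh_{(2)}\,U^{-1}(h_{(3)})$, $U(h)=\chi(h_{(1)}\otimes Sh_{(2)})$. A crossed module over $H$ (object of ${}^H_H\dot{\mathcal M}$) is a left $H$-module and left $H$-comodule $V$, coaction $v\mapsto v_{(1)}\otimes v_{(\infty)}$, with $h_{(1)}v_{(1)}\otimes h_{(2)}\triangleright v_{(\infty)}=(h_{(1)}\triangleright v)_{(1)}h_{(2)}\otimes(h_{(1)}\triangleright v)_{(\infty)}$; morphisms commute with action and coaction. Any Hopf algebra $H$ is a crossed module over itself by left multiplication and the adjoint coaction $h\mapsto h_{(1)}Sh_{(3)}\otimes h_{(2)}$, with sub-crossed module $\ker\epsilon$; likewise $H^\chi\in{}^{H^\chi}_{H^\chi}\dot{\mathcal M}$ using the product and antipode of $H^\chi$. The functor $\mathcal{F}^\chi:{}^H_H\dot{\mathcal M}\to{}^{H^\chi}_{H^\chi}\dot{\mathcal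 M}$ is the identity on vector spaces and coactions and changes the action to $h\triangleright^\chi v=\chi(h_{(1)}\otimes v_{(1)})(h_{(2)}\triangleright v_{(\infty)})_{(\infty)}\chi^{-1}((h_{(2)}\triangleright v_{(\infty)})_{(1)}\otimes h_{(3)})$. A first order bicovariant differential calculus on $H$ is an $H$-bimodule and bicomodule $\Omega^1$ with coactions bimodule maps, and a bicomodule map $\mathrm d:H\to\Omega^1$ with $\mathrm d(hg)=(\mathrm dh)g+h\,\mathrm dg$ and $\Omega^1=\mathrm{span}\{h\,\mathrm dg\}$. Such a calculus has the form $\Omega^1=V\otimes H$ with $V$ (the space of right-invariant 1-forms) a crossed module quotient $\pi:\ker\epsilon\to V$, with $h\cdot(v\otimes g)=h_{(1)}\triangleright v\otimes h_{(2)}g$, $(v\otimes g)\cdot h=v\otimes gh$ and $\mathrm dh=(\pi\otimes\mathrm{id})(h_{(1)}\otimes h_{(2)}-1\otimes h)$; this is what "corresponds to the projection" means; one has $\pi(a)=\mathrm da_{(1)}\cdot Sa_{(2)}$. The twisted calculus $\Omega^{1\chi}$ has the same vector space, coactions and $\mathrm d$ as $\Omega^1$, with actions $h\bullet\omega=\chi(h_{(1)}\otimes\omega_{(1)})h_{(2)}\omega_{(\underline2)}\chi^{-1}(h_{(3)}\otimes\omega_{(3)})$, $\omega\bullet h=\chi(\omega_{(1)}\otimes h_{(1)})\omega_{(\underline2)}h_{(2)}\chi^{-1}(\omega_{(3)}\otimes h_{(3)})$, where $\omega\mapsto\omega_{(1)}\otimes\omega_{(\underline2)}\otimes\omega_{(3)}\in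 H\otimes\Omega^1\otimes H$ denotes both coactions applied; its space of right-invariant forms is the same subspace $V$. *)

theory Defs
  imports "HOL.Vector_Spaces" "HOL-Library.Poly_Mapping"
begin

section \<open>Tensor products\<close>

text \<open>
  A vector space is a type \<open>'v::ab_group_add\<close> with a scalar multiplication
  \<open>s :: 'k \<Rightarrow> 'v \<Rightarrow> 'v\<close> satisfying the library's \<^locale>\<open>vector_space\<close>.
  The tensor product of \<open>A\<close> and \<open>B\<close> is the free vector space on the pairs modulo the span of the
  bilinearity relations.  An element of it is always given by a representative, a
  finite sum \<open>a\<^sub>1 \<otimes> b\<^sub>1 + \<dots> + a\<^sub>n \<otimes> b\<^sub>n\<close> written as the list \<open>[(a\<^sub>1,b\<^sub>1), \<dots>, (a\<^sub>n,b\<^sub>n)]\<close>;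
  equality in the tensor product is the relation \<open>tensor_eq\<close> on representatives.  So a
  coproduct is a function choosing a representative for every \<open>\<Delta> h\<close>, and Sweedler notation
  is a list comprehension or a list sum.  The sums \<open>\<Sum>(a,b)\<leftarrow>xs. \<beta> a b\<close> formed below are over
  bilinear \<open>\<beta>\<close> (multilinear for longer tuples) and so do not depend on the representative.
\<close>

definition formal_scale :: "'k::field \<Rightarrow> ('p \<Rightarrow>\<^sub>0 'k) \<Rightarrow> ('p \<Rightarrow>\<^sub>0 'k)" where
  "formal_scale c = Poly_Mapping.map ((*) c)"

definition formal_sum :: "'p list \<Rightarrow> ('p \<Rightarrow>\<^sub>0 'k::field)" where
  "formal_sum xs = (\<Sum>p\<leftarrow>xs. Poly_Mapping.single p 1)"

definition tensor_relations ::
  "('k::field \<Rightarrow> 'a::ab_group_add \<Rightarrow> 'a) \<Rightarrow> ('k \<Rightarrow> 'b::ab_group_add \<Rightarrow> 'b) \<Rightarrow> (('a \<times> 'b) \<Rightarrow>\<^sub>0 'k) set"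
where
  "tensor_relations sA sB =
     (\<Union>a a' b. {formal_sum [(a + a', b)] - formal_sum [(a, b), (a', b)]}) \<union>
     (\<Union>a b b'. {formal_sum [(a, b + b')] - formal_sum [(a, b), (a, b')]}) \<union>
     (\<Union>c a b. {formal_sum [(sA c a, b)] - formal_scale c (formal_sum [(a, b)])}) \<union>
     (\<Union>c a b. {formal_sum [(a, sB c b)] - formal_scale c (formal_sum [(a, b)])})"

definition tensor_eq ::
  "('k::field \<Rightarrow> 'a::ab_group_add \<Rightarrow> 'a) \<Rightarrow> ('k \<Rightarrow> 'b::ab_group_add \<Rightarrow> 'b)
    \<Rightarrow> ('a \<times> 'b) list \<Rightarrow> ('a \<times> 'b) list \<Rightarrow> bool"
where
  "tensor_eq sA sB xs ys \<longleftrightarrow>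
     formal_sum xs - formal_sum ys \<in> module.span formal_scale (tensor_relations sA sB)"

definition tensor3_relations ::
  "('k::field \<Rightarrow> 'a::ab_group_add \<Rightarrow> 'a) \<Rightarrow> ('k \<Rightarrow> 'b::ab_group_add \<Rightarrow> 'b)
    \<Rightarrow> ('k \<Rightarrow> 'c::ab_group_add \<Rightarrow> 'c) \<Rightarrow> (('a \<times> 'b \<times> 'c) \<Rightarrow>\<^sub>0 'k) set"
where
  "tensor3_relations sA sB sC =
     (\<Union>a a' b c. {formal_sum [(a + a', b, c)] - formal_sum [(a, b, c), (a', b, c)]}) \<union>
     (\<Union>a b b' c. {formal_sum [(a, b + b', c)] - formal_sum [(a, b, c), (a, b', c)]}) \<union>
     (\<Union>a b c c'. {formal_sum [(a, b, c + c')] - formal_sum [(a, b, c), (a, b, c')]}) \<union>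
     (\<Union>r a b c. {formal_sum [(sA r a, b, c)] - formal_scale r (formal_sum [(a, b, c)])}) \<union>
     (\<Union>r a b c. {formal_sum [(a, sB r b, c)] - formal_scale r (formal_sum [(a, b, c)])}) \<union>
     (\<Union>r a b c. {formal_sum [(a, b, sC r c)] - formal_scale r (formal_sum [(a, b, c)])})"

definition tensor3_eq ::
  "('k::field \<Rightarrow> 'a::ab_group_add \<Rightarrow> 'a) \<Rightarrow> ('k \<Rightarrow> 'b::ab_group_add \<Rightarrow> 'b)
    \<Rightarrow> ('k \<Rightarrow> 'c::ab_group_add \<Rightarrow> 'c) \<Rightarrow> ('a \<times> 'b \<times> 'c) list \<Rightarrow> ('a \<times> 'b \<times> 'c) list \<Rightarrow> bool"
where
  "tensor3_eq sA sB sC xs ys \<longleftrightarrow>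
     formal_sum xs - formal_sum ys \<in> module.span formal_scale (tensor3_relations sA sB sC)"

definition linear_on ::
  "'a set \<Rightarrow> ('k \<Rightarrow> 'a::ab_group_add \<Rightarrow> 'a) \<Rightarrow> ('k \<Rightarrow> 'b::ab_group_add \<Rightarrow> 'b) \<Rightarrow> ('a \<Rightarrow> 'b) \<Rightarrow> bool"
where
  "linear_on A sA sB f \<longleftrightarrow>
     (\<forall>x\<in>A. \<forall>y\<in>A. f (x + y) = f x + f y) \<and> (\<forall>c. \<forall>x\<in>A. f (sA c x) = sB c (f x))"

definition bilinear_on ::
  "'a set \<Rightarrow> 'b set \<Rightarrow> ('k \<Rightarrow> 'a::ab_group_add \<Rightarrow> 'a) \<Rightarrow> ('k \<Rightarrow> 'b::ab_group_add \<Rightarrow> 'b)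
    \<Rightarrow> ('k \<Rightarrow> 'c::ab_group_add \<Rightarrow> 'c) \<Rightarrow> ('a \<Rightarrow> 'b \<Rightarrow> 'c) \<Rightarrow> bool"
where
  "bilinear_on A B sA sB sC f \<longleftrightarrow>
     (\<forall>a\<in>A. linear_on B sB sC (f a)) \<and> (\<forall>b\<in>B. linear_on A sA sC (\<lambda>a. f a b))"

definition tensor_linear_on ::
  "'v set \<Rightarrow> ('k::field \<Rightarrow> 'v::ab_group_add \<Rightarrow> 'v) \<Rightarrow> ('k \<Rightarrow> 'a::ab_group_add \<Rightarrow> 'a)
    \<Rightarrow> ('k \<Rightarrow> 'b::ab_group_add \<Rightarrow> 'b) \<Rightarrow> ('v \<Rightarrow> ('a \<times> 'b) list) \<Rightarrow> bool"
where
  "tensor_linear_on V sV sA sB t \<longleftrightarrow>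
     (\<forall>x\<in>V. \<forall>y\<in>V. tensor_eq sA sB (t (x + y)) (t x @ t y)) \<and>
     (\<forall>c. \<forall>x\<in>V. tensor_eq sA sB (t (sV c x)) [(sA c a, b). (a, b) \<leftarrow> t x])"


section \<open>Hopf algebras\<close>

record ('k, 'h) hopf =
  scale :: "'k \<Rightarrow> 'h \<Rightarrow> 'h"
  mult :: "'h \<Rightarrow> 'h \<Rightarrow> 'h" (infixl \<open>\<cdot>\<index>\<close> 70)
  unit :: 'h (\<open>\<one>\<index>\<close>)
  comult :: "'h \<Rightarrow> ('h \<times> 'h) list"
  counit :: "'h \<Rightarrow> 'k"
  antipode :: "'h \<Rightarrow> 'h"

locale hopf_algebra =
  fixes H :: "('k::field, 'h::ab_group_add) hopf" (structure)
  assumes vector_space_H: "vector_space (scale H)"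
    and mult_bilinear: "bilinear_on UNIV UNIV (scale H) (scale H) (scale H) (mult H)"
    and mult_assoc: "(x \<cdot> y) \<cdot> z = x \<cdot> (y \<cdot> z)"
    and unit_left: "\<one> \<cdot> x = x"
    and unit_right: "x \<cdot> \<one> = x"
    and comult_linear: "tensor_linear_on UNIV (scale H) (scale H) (scale H) (comult H)"
    and coassoc: "tensor3_eq (scale H) (scale H) (scale H)
          [(a, b, c). (x, c) \<leftarrow> comult H h, (a, b) \<leftarrow> comult H x]
          [(a, b, c). (a, x) \<leftarrow> comult H h, (b, c) \<leftarrow> comult H x]"
    and counit_linear: "linear_on UNIV (scale H) (*) (counit H)"
    and counit_left: "(\<Sum>(a, b)\<leftarrow>comult H h. scale H (counit H a) b) = h"
    and counit_right: "(\<Sum>(a, b)\<leftarrow>comult H h. scale H (counit H b) a) = h"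
    and comult_mult: "tensor_eq (scale H) (scale H) (comult H (x \<cdot> y))
          [(a \<cdot> c, b \<cdot> d). (a, b) \<leftarrow> comult H x, (c, d) \<leftarrow> comult H y]"
    and comult_unit: "tensor_eq (scale H) (scale H) (comult H \<one>) [(\<one>, \<one>)]"
    and counit_mult: "counit H (x \<cdot> y) = counit H x * counit H y"
    and counit_unit: "counit H \<one> = 1"
    and antipode_linear: "linear_on UNIV (scale H) (scale H) (antipode H)"
    and antipode_left: "(\<Sum>(a, b)\<leftarrow>comult H h. antipode H a \<cdot> b) = scale H (counit H h) \<one>"
    and antipode_right: "(\<Sum>(a, b)\<leftarrow>comult H h. a \<cdot> antipode H b) = scale H (counit H h) \<one>"
    and antipode_bij: "bij (antipode H)"

text \<open>Iterated coproducts: \<open>h\<^bsub>(1)\<^esub> \<otimes> \<dots> \<otimes> h\<^bsub>(n)\<^esub>\<close> for \<open>n = 3, 4, 5\<close>.\<close>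

definition comult3 :: "('k, 'h) hopf \<Rightarrow> 'h \<Rightarrow> ('h \<times> 'h \<times> 'h) list" where
  "comult3 H h = [(a, b, c). (a, x) \<leftarrow> comult H h, (b, c) \<leftarrow> comult H x]"

definition comult4 :: "('k, 'h) hopf \<Rightarrow> 'h \<Rightarrow> ('h \<times> 'h \<times> 'h \<times> 'h) list" where
  "comult4 H h = [(a, b, c, d). (a, x) \<leftarrow> comult H h, (b, c, d) \<leftarrow> comult3 H x]"

definition comult5 :: "('k, 'h) hopf \<Rightarrow> 'h \<Rightarrow> ('h \<times> 'h \<times> 'h \<times> 'h \<times> 'h) list" where
  "comult5 H h = [(a, b, c, d, e). (a, x) \<leftarrow> comult H h, (b, c, d, e) \<leftarrow> comult4 H x]"


section \<open>Cocycles and the twisted Hopf algebra\<close>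

text \<open>Linear maps \<open>H \<otimes> H \<rightarrow> k\<close> are given as bilinear maps \<open>\<chi> :: 'h \<Rightarrow> 'h \<Rightarrow> 'k\<close>.  A convolution
  inverse is unique when it exists, so \<open>THE\<close> below picks out the inverse.\<close>

definition is_conv_inverse1 ::
  "('k::field, 'h::ab_group_add) hopf \<Rightarrow> ('h \<Rightarrow> 'k) \<Rightarrow> ('h \<Rightarrow> 'k) \<Rightarrow> bool"
where
  "is_conv_inverse1 H f f' \<longleftrightarrow>
     linear_on UNIV (scale H) (*) f' \<and>
     (\<forall>h. (\<Sum>(h1, h2)\<leftarrow>comult H h. f h1 * f' h2) = counit H h) \<and>
     (\<forall>h. (\<Sum>(h1, h2)\<leftarrow>comult H h. f' h1 * f h2) = counit H h)"

definition conv_inverse1 :: "('k::field, 'h::ab_group_add) hopf \<Rightarrow> ('h \<Rightarrow> 'k) \<Rightarrow> ('h \<Rightarrow> 'k)" where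
  "conv_inverse1 H f = (THE f'. is_conv_inverse1 H f f')"

definition is_conv_inverse2 ::
  "('k::field, 'h::ab_group_add) hopf \<Rightarrow> ('h \<Rightarrow> 'h \<Rightarrow> 'k) \<Rightarrow> ('h \<Rightarrow> 'h \<Rightarrow> 'k) \<Rightarrow> bool"
where
  "is_conv_inverse2 H \<chi> \<chi>' \<longleftrightarrow>
     bilinear_on UNIV UNIV (scale H) (scale H) (*) \<chi>' \<and>
     (\<forall>h g. (\<Sum>(h1, h2)\<leftarrow>comult H h. \<Sum>(g1, g2)\<leftarrow>comult H g. \<chi> h1 g1 * \<chi>' h2 g2)
              = counit H h * counit H g) \<and>
     (\<forall>h g. (\<Sum>(h1, h2)\<leftarrow>comult H h. \<Sum>(g1, g2)\<leftarrow>comult H g. \<chi>' h1 g1 * \<chi> h2 g2)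
              = counit H h * counit H g)"

definition conv_inverse2 ::
  "('k::field, 'h::ab_group_add) hopf \<Rightarrow> ('h \<Rightarrow> 'h \<Rightarrow> 'k) \<Rightarrow> ('h \<Rightarrow> 'h \<Rightarrow> 'k)"
where
  "conv_inverse2 H \<chi> = (THE \<chi>'. is_conv_inverse2 H \<chi> \<chi>')"

definition unital_2_cocycle ::
  "('k::field, 'h::ab_group_add) hopf \<Rightarrow> ('h \<Rightarrow> 'h \<Rightarrow> 'k) \<Rightarrow> bool"
where
  "unital_2_cocycle H \<chi> \<longleftrightarrow>
     bilinear_on UNIV UNIV (scale H) (scale H) (*) \<chi> \<and>
     (\<exists>\<chi>'. is_conv_inverse2 H \<chi> \<chi>') \<and>
     (\<forall>h g f. (\<Sum>(g1, g2)\<leftarrow>comult H g. \<Sum>(f1, f2)\<leftarrow>comult H f. \<chi> g1 f1 * \<chi> h (g2 \<cdot>\<^bsub>H\<^esub> f2))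
            = (\<Sum>(h1, h2)\<leftarrow>comult H h. \<Sum>(g1, g2)\<leftarrow>comult H g. \<chi> h1 g1 * \<chi> (h2 \<cdot>\<^bsub>H\<^esub> g2) f)) \<and>
     (\<forall>h. \<chi> \<one>\<^bsub>H\<^esub> h = counit H h)"

definition twist_U ::
  "('k::field, 'h::ab_group_add) hopf \<Rightarrow> ('h \<Rightarrow> 'h \<Rightarrow> 'k) \<Rightarrow> 'h \<Rightarrow> 'k"
where
  "twist_U H \<chi> h = (\<Sum>(h1, h2)\<leftarrow>comult H h. \<chi> h1 (antipode H h2))"

definition twist_hopf ::
  "('k::field, 'h::ab_group_add) hopf \<Rightarrow> ('h \<Rightarrow> 'h \<Rightarrow> 'k) \<Rightarrow> ('k, 'h) hopf"
where
  "twist_hopf H \<chi> = H\<lparr>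
     mult := (\<lambda>h g. \<Sum>(h1, h2, h3)\<leftarrow>comult3 H h. \<Sum>(g1, g2, g3)\<leftarrow>comult3 H g.
        scale H (\<chi> h1 g1 * conv_inverse2 H \<chi> h3 g3) (h2 \<cdot>\<^bsub>H\<^esub> g2)),
     antipode := (\<lambda>h. \<Sum>(h1, h2, h3)\<leftarrow>comult3 H h.
        scale H (twist_U H \<chi> h1 * conv_inverse1 H (twist_U H \<chi>) h3) (antipode H h2))\<rparr>"


section \<open>Crossed modules\<close>

text \<open>The underlying space is a subspace \<open>vcarrier\<close> of a vector space \<open>'v\<close>, so that \<open>ker \<epsilon>\<close> and
  the space of right-invariant forms are covered.  The coaction \<open>coact v\<close> of an element of the carrier
  \<open>V\<close> is a representative in \<open>H \<otimes> V\<close>; equality in \<open>H \<otimes> V\<close> is equality in \<open>H \<otimes> 'v\<close>, which contains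
  it because scalars form a field.\<close>

record ('k, 'h, 'v) crossed =
  vcarrier :: "'v set"
  vscale :: "'k \<Rightarrow> 'v \<Rightarrow> 'v"
  act :: "'h \<Rightarrow> 'v \<Rightarrow> 'v"
  coact :: "'v \<Rightarrow> ('h \<times> 'v) list"

locale crossed_module = hopf_algebra H
  for H :: "('k::field, 'h::ab_group_add) hopf" (structure) +
  fixes V :: "('k, 'h, 'v::ab_group_add) crossed"
  assumes vector_space_V: "vector_space (vscale V)"
    and subspace_V: "module.subspace (vscale V) (vcarrier V)"
    and act_closed: "v \<in> vcarrier V \<Longrightarrow> act V h v \<in> vcarrier V"
    and act_bilinear: "bilinear_on UNIV (vcarrier V) (scale H) (vscale V) (vscale V) (act V)"
    and act_unit: "v \<in> vcarrier V \<Longrightarrow> act V \<one> v = v"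
    and act_mult: "v \<in> vcarrier V \<Longrightarrow> act V (h \<cdot> g) v = act V h (act V g v)"
    and coact_closed: "v \<in> vcarrier V \<Longrightarrow> set (coact V v) \<subseteq> UNIV \<times> vcarrier V"
    and coact_linear: "tensor_linear_on (vcarrier V) (vscale V) (scale H) (vscale V) (coact V)"
    and coact_coassoc: "v \<in> vcarrier V \<Longrightarrow> tensor3_eq (scale H) (scale H) (vscale V)
          [(a, b, w). (x, w) \<leftarrow> coact V v, (a, b) \<leftarrow> comult H x]
          [(a, b, w). (a, x) \<leftarrow> coact V v, (b, w) \<leftarrow> coact V x]"
    and coact_counit: "v \<in> vcarrier V \<Longrightarrow> (\<Sum>(a, w)\<leftarrow>coact V v. vscale V (counit H a) w) = v"
    and act_coact: "v \<in> vcarrier V \<Longrightarrow> tensor_eq (scale H) (vscale V)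
          [(h1 \<cdot> v1, act V h2 w). (h1, h2) \<leftarrow> comult H h, (v1, w) \<leftarrow> coact V v]
          [(u1 \<cdot> h2, w). (h1, h2) \<leftarrow> comult H h, (u1, w) \<leftarrow> coact V (act V h1 v)]"

definition crossed_morphism ::
  "('k::field, 'h::ab_group_add) hopf \<Rightarrow> ('k, 'h, 'v::ab_group_add) crossed
    \<Rightarrow> ('k, 'h, 'w::ab_group_add) crossed \<Rightarrow> ('v \<Rightarrow> 'w) \<Rightarrow> bool"
where
  "crossed_morphism H V W f \<longleftrightarrow>
     crossed_module H V \<and> crossed_module H W \<and>
     f ` vcarrier V \<subseteq> vcarrier W \<and>
     linear_on (vcarrier V) (vscale V) (vscale W) f \<and>
     (\<forall>h. \<forall>v\<in>vcarrier V. f (act V h v) = act W h (f v)) \<and>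
     (\<forall>v\<in>vcarrier V. tensor_eq (scale H) (vscale W)
        (coact W (f v)) [(a, f w). (a, w) \<leftarrow> coact V v])"

definition crossed_isomorphism ::
  "('k::field, 'h::ab_group_add) hopf \<Rightarrow> ('k, 'h, 'v::ab_group_add) crossed
    \<Rightarrow> ('k, 'h, 'w::ab_group_add) crossed \<Rightarrow> ('v \<Rightarrow> 'w) \<Rightarrow> ('w \<Rightarrow> 'v) \<Rightarrow> bool"
where
  "crossed_isomorphism H V W f f' \<longleftrightarrow>
     crossed_morphism H V W f \<and> crossed_morphism H W V f' \<and>
     (\<forall>v\<in>vcarrier V. f' (f v) = v) \<and> (\<forall>w\<in>vcarrier W. f (f' w) = w)"

definition regular_crossed ::
  "('k, 'h) hopf \<Rightarrow> ('k, 'h, 'h) crossed"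
where
  "regular_crossed H = \<lparr>
     vcarrier = UNIV, vscale = scale H, act = mult H,
     coact = (\<lambda>h. [(h1 \<cdot>\<^bsub>H\<^esub> antipode H h3, h2). (h1, h2, h3) \<leftarrow> comult3 H h])\<rparr>"

text \<open>Restriction to a subspace \<open>C\<close> keeps the coaction but needs a representative of it
  whose second legs lie in \<open>C\<close>.\<close>

definition restrict_crossed ::
  "('k::field, 'h::ab_group_add) hopf \<Rightarrow> ('k, 'h, 'v::ab_group_add) crossed \<Rightarrow> 'v set
    \<Rightarrow> ('k, 'h, 'v) crossed"
where
  "restrict_crossed H V C = V\<lparr>
     vcarrier := C,
     coact := (\<lambda>v. SOME xs. set xs \<subseteq> UNIV \<times> C \<and> tensor_eq (scale H) (vscale V) xs (coact V v))\<rparr>"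

definition ker_counit_crossed ::
  "('k::field, 'h::ab_group_add) hopf \<Rightarrow> ('k, 'h, 'h) crossed"
where
  "ker_counit_crossed H = restrict_crossed H (regular_crossed H) {h. counit H h = 0}"

text \<open>The object part of the functor \<open>\<F>\<^sup>\<chi>\<close>; it is the identity on maps.\<close>

definition twist_crossed ::
  "('k::field, 'h::ab_group_add) hopf \<Rightarrow> ('h \<Rightarrow> 'h \<Rightarrow> 'k) \<Rightarrow> ('k, 'h, 'v::ab_group_add) crossed
    \<Rightarrow> ('k, 'h, 'v) crossed"
where
  "twist_crossed H \<chi> V = V\<lparr>
     act := (\<lambda>h v. \<Sum>(h1, h2, h3)\<leftarrow>comult3 H h. \<Sum>(v1, w)\<leftarrow>coact V v.
        \<Sum>(u1, u)\<leftarrow>coact V (act V h2 w).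
          vscale V (\<chi> h1 v1 * conv_inverse2 H \<chi> u1 h3) u)\<rparr>"


section \<open>Bicovariant differential calculi\<close>

record ('k, 'h, 'w) calculus =
  form_scale :: "'k \<Rightarrow> 'w \<Rightarrow> 'w"
  lact :: "'h \<Rightarrow> 'w \<Rightarrow> 'w"
  ract :: "'w \<Rightarrow> 'h \<Rightarrow> 'w"
  lcoact :: "'w \<Rightarrow> ('h \<times> 'w) list"
  rcoact :: "'w \<Rightarrow> ('w \<times> 'h) list"
  diff :: "'h \<Rightarrow> 'w"

locale bicovariant_calculus = hopf_algebra H
  for H :: "('k::field, 'h::ab_group_add) hopf" (structure) +
  fixes \<Omega> :: "('k, 'h, 'w::ab_group_add) calculus"
  assumes vector_space_\<Omega>: "vector_space (form_scale \<Omega>)"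
    and lact_bilinear:
      "bilinear_on UNIV UNIV (scale H) (form_scale \<Omega>) (form_scale \<Omega>) (lact \<Omega>)"
    and lact_unit: "lact \<Omega> \<one> \<omega> = \<omega>"
    and lact_mult: "lact \<Omega> (h \<cdot> g) \<omega> = lact \<Omega> h (lact \<Omega> g \<omega>)"
    and ract_bilinear:
      "bilinear_on UNIV UNIV (form_scale \<Omega>) (scale H) (form_scale \<Omega>) (ract \<Omega>)"
    and ract_unit: "ract \<Omega> \<omega> \<one> = \<omega>"
    and ract_mult: "ract \<Omega> \<omega> (h \<cdot> g) = ract \<Omega> (ract \<Omega> \<omega> h) g"
    and lact_ract: "ract \<Omega> (lact \<Omega> h \<omega>) g = lact \<Omega> h (ract \<Omega> \<omega> g)"
    and lcoact_linear:
      "tensor_linear_on UNIV (form_scale \<Omega>) (scale H) (form_scale \<Omega>) (lcoact \<Omega>)"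
    and lcoact_coassoc: "tensor3_eq (scale H) (scale H) (form_scale \<Omega>)
          [(a, b, \<eta>). (x, \<eta>) \<leftarrow> lcoact \<Omega> \<omega>, (a, b) \<leftarrow> comult H x]
          [(a, b, \<eta>). (a, \<xi>) \<leftarrow> lcoact \<Omega> \<omega>, (b, \<eta>) \<leftarrow> lcoact \<Omega> \<xi>]"
    and lcoact_counit: "(\<Sum>(a, \<eta>)\<leftarrow>lcoact \<Omega> \<omega>. form_scale \<Omega> (counit H a) \<eta>) = \<omega>"
    and rcoact_linear:
      "tensor_linear_on UNIV (form_scale \<Omega>) (form_scale \<Omega>) (scale H) (rcoact \<Omega>)"
    and rcoact_coassoc: "tensor3_eq (form_scale \<Omega>) (scale H) (scale H)
          [(\<eta>, a, b). (\<xi>, b) \<leftarrow> rcoact \<Omega> \<omega>, (\<eta>, a) \<leftarrow> rcoact \<Omega> \<xi>]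
          [(\<eta>, a, b). (\<eta>, x) \<leftarrow> rcoact \<Omega> \<omega>, (a, b) \<leftarrow> comult H x]"
    and rcoact_counit: "(\<Sum>(\<eta>, a)\<leftarrow>rcoact \<Omega> \<omega>. form_scale \<Omega> (counit H a) \<eta>) = \<omega>"
    and lcoact_rcoact: "tensor3_eq (scale H) (form_scale \<Omega>) (scale H)
          [(a, \<eta>, b). (a, \<xi>) \<leftarrow> lcoact \<Omega> \<omega>, (\<eta>, b) \<leftarrow> rcoact \<Omega> \<xi>]
          [(a, \<eta>, b). (\<xi>, b) \<leftarrow> rcoact \<Omega> \<omega>, (a, \<eta>) \<leftarrow> lcoact \<Omega> \<xi>]"
    and lcoact_lact: "tensor_eq (scale H) (form_scale \<Omega>) (lcoact \<Omega> (lact \<Omega> h \<omega>))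
          [(h1 \<cdot> a, lact \<Omega> h2 \<eta>). (h1, h2) \<leftarrow> comult H h, (a, \<eta>) \<leftarrow> lcoact \<Omega> \<omega>]"
    and lcoact_ract: "tensor_eq (scale H) (form_scale \<Omega>) (lcoact \<Omega> (ract \<Omega> \<omega> h))
          [(a \<cdot> h1, ract \<Omega> \<eta> h2). (a, \<eta>) \<leftarrow> lcoact \<Omega> \<omega>, (h1, h2) \<leftarrow> comult H h]"
    and rcoact_lact: "tensor_eq (form_scale \<Omega>) (scale H) (rcoact \<Omega> (lact \<Omega> h \<omega>))
          [(lact \<Omega> h1 \<eta>, h2 \<cdot> a). (h1, h2) \<leftarrow> comult H h, (\<eta>, a) \<leftarrow> rcoact \<Omega> \<omega>]"
    and rcoact_ract: "tensor_eq (form_scale \<Omega>) (scale H) (rcoact \<Omega> (ract \<Omega> \<omega> h))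
          [(ract \<Omega> \<eta> h1, a \<cdot> h2). (\<eta>, a) \<leftarrow> rcoact \<Omega> \<omega>, (h1, h2) \<leftarrow> comult H h]"
    and diff_linear: "linear_on UNIV (scale H) (form_scale \<Omega>) (diff \<Omega>)"
    and diff_mult: "diff \<Omega> (h \<cdot> g) = ract \<Omega> (diff \<Omega> h) g + lact \<Omega> h (diff \<Omega> g)"
    and lcoact_diff: "tensor_eq (scale H) (form_scale \<Omega>) (lcoact \<Omega> (diff \<Omega> h))
          [(h1, diff \<Omega> h2). (h1, h2) \<leftarrow> comult H h]"
    and rcoact_diff: "tensor_eq (form_scale \<Omega>) (scale H) (rcoact \<Omega> (diff \<Omega> h))
          [(diff \<Omega> h1, h2). (h1, h2) \<leftarrow> comult H h]"
    and diff_span: "module.span (form_scale \<Omega>) {lact \<Omega> h (diff \<Omega> g) | h g. True} = UNIV"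

definition bicoact :: "('k, 'h, 'w) calculus \<Rightarrow> 'w \<Rightarrow> ('h \<times> 'w \<times> 'h) list" where
  "bicoact \<Omega> \<omega> = [(a, \<eta>, b). (a, \<xi>) \<leftarrow> lcoact \<Omega> \<omega>, (\<eta>, b) \<leftarrow> rcoact \<Omega> \<xi>]"

definition twist_calculus ::
  "('k::field, 'h::ab_group_add) hopf \<Rightarrow> ('h \<Rightarrow> 'h \<Rightarrow> 'k) \<Rightarrow> ('k, 'h, 'w::ab_group_add) calculus
    \<Rightarrow> ('k, 'h, 'w) calculus"
where
  "twist_calculus H \<chi> \<Omega> = \<Omega>\<lparr>
     lact := (\<lambda>h \<omega>. \<Sum>(h1, h2, h3)\<leftarrow>comult3 H h. \<Sum>(a, \<eta>, b)\<leftarrow>bicoact \<Omega> \<omega>.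
        form_scale \<Omega> (\<chi> h1 a * conv_inverse2 H \<chi> h3 b) (lact \<Omega> h2 \<eta>)),
     ract := (\<lambda>\<omega> h. \<Sum>(a, \<eta>, b)\<leftarrow>bicoact \<Omega> \<omega>. \<Sum>(h1, h2, h3)\<leftarrow>comult3 H h.
        form_scale \<Omega> (\<chi> a h1 * conv_inverse2 H \<chi> b h3) (ract \<Omega> \<eta> h2))\<rparr>"

definition right_invariant ::
  "('k::field, 'h::ab_group_add) hopf \<Rightarrow> ('k, 'h, 'w::ab_group_add) calculus \<Rightarrow> 'w set"
where
  "right_invariant H \<Omega> =
     {\<omega>. tensor_eq (form_scale \<Omega>) (scale H) (rcoact \<Omega> \<omega>) [(\<omega>, \<one>\<^bsub>H\<^esub>)]}"

text \<open>
  \<open>corresponds_to H \<Omega> V \<pi>\<close>: the calculus \<open>\<Omega>\<close> on \<open>H\<close> corresponds to the crossed module quotient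
  \<open>\<pi> : ker \<epsilon> \<rightarrow> V\<close>.  Here \<open>V\<close> is the space of right-invariant forms, with the coaction
  inherited from the left coaction of \<open>\<Omega>\<close>, and \<open>V \<otimes> H\<close> is identified with \<open>\<Omega>\<close> by
  \<open>v \<otimes> g \<mapsto> v \<cdot> g\<close>; the formula \<open>(v \<otimes> g) \<cdot> h = v \<otimes> g h\<close> is then part of the bimodule axioms.
  As \<open>h\<^bsub>(1)\<^esub> \<otimes> h\<^bsub>(2)\<^esub> - 1 \<otimes> h = (h\<^bsub>(1)\<^esub> - \<epsilon>(h\<^bsub>(1)\<^esub>) 1) \<otimes> h\<^bsub>(2)\<^esub>\<close>, with first legs in \<open>ker \<epsilon>\<close>, the last
  clause is \<open>d h = (\<pi> \<otimes> id)(h\<^bsub>(1)\<^esub> \<otimes> h\<^bsub>(2)\<^esub> - 1 \<otimes> h)\<close>.  Values of \<open>\<pi>\<close> outside \<open>ker \<epsilon>\<close> are irrelevant.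
\<close>

definition corresponds_to ::
  "('k::field, 'h::ab_group_add) hopf \<Rightarrow> ('k, 'h, 'w::ab_group_add) calculus
    \<Rightarrow> ('k, 'h, 'w) crossed \<Rightarrow> ('h \<Rightarrow> 'w) \<Rightarrow> bool"
where
  "corresponds_to H \<Omega> V \<pi> \<longleftrightarrow>
     bicovariant_calculus H \<Omega> \<and>
     vcarrier V = right_invariant H \<Omega> \<and> vscale V = form_scale \<Omega> \<and>
     (\<forall>v\<in>vcarrier V. tensor_eq (scale H) (form_scale \<Omega>) (coact V v) (lcoact \<Omega> v)) \<and>
     crossed_morphism H (ker_counit_crossed H) V \<pi> \<and>
     \<pi> ` {h. counit H h = 0} = vcarrier V \<and>
     (\<forall>\<omega>. \<exists>xs. set xs \<subseteq> vcarrier V \<times> UNIV \<and> \<omega> = (\<Sum>(v, g)\<leftarrow>xs. ract \<Omega> v g)) \<and>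
     (\<forall>xs ys. set xs \<subseteq> vcarrier V \<times> UNIV \<and> set ys \<subseteq> vcarrier V \<times> UNIV \<and>
        (\<Sum>(v, g)\<leftarrow>xs. ract \<Omega> v g) = (\<Sum>(v, g)\<leftarrow>ys. ract \<Omega> v g)
        \<longrightarrow> tensor_eq (form_scale \<Omega>) (scale H) xs ys) \<and>
     (\<forall>h g. \<forall>v\<in>vcarrier V. lact \<Omega> h (ract \<Omega> v g)
        = (\<Sum>(h1, h2)\<leftarrow>comult H h. ract \<Omega> (act V h1 v) (h2 \<cdot>\<^bsub>H\<^esub> g))) \<and>
     (\<forall>h. diff \<Omega> h
        = (\<Sum>(h1, h2)\<leftarrow>comult H h. ract \<Omega> (\<pi> (h1 - scale H (counit H h1) \<one>\<^bsub>H\<^esub>)) h2))"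


section \<open>The comparison map\<close>

definition twist_alpha ::
  "('k::field, 'h::ab_group_add) hopf \<Rightarrow> ('h \<Rightarrow> 'h \<Rightarrow> 'k) \<Rightarrow> 'h \<Rightarrow> 'h"
where
  "twist_alpha H \<chi> h = (\<Sum>(h1, h2, h3, h4, h5)\<leftarrow>comult5 H h.
     scale H (conv_inverse2 H \<chi> h1 (antipode H h5) * \<chi> h3 (antipode H h4)) h2)"

definition twist_alpha_inv ::
  "('k::field, 'h::ab_group_add) hopf \<Rightarrow> ('h \<Rightarrow> 'h \<Rightarrow> 'k) \<Rightarrow> 'h \<Rightarrow> 'h"
where
  "twist_alpha_inv H \<chi> h = (\<Sum>(h1, h2, h3, h4)\<leftarrow>comult4 H h.
     scale H (conv_inverse2 H \<chi> (h1 \<cdot>\<^bsub>H\<^esub> antipode H h3) h4) h2)"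

end

theory Submission
  imports Defs
begin

text \<open>
  All identities are tested by linear functionals.  Scalars form a field, so functionals separate
  the points of a vector space and products \<open>\<phi> \<otimes> \<psi>\<close> of functionals separate the points of a tensor
  product (\<open>tensor_eq_by_functionals\<close>); every computation becomes one between scalars.  The
  functionals on \<open>H\<close>, \<open>H \<otimes> H\<close> and \<open>H \<otimes> H \<otimes> H\<close> are algebras under convolution, and a coaction on \<open>X\<close>
  makes the functionals on \<open>X\<close> a module over them.  The cocycle condition is the equation
  \<open>\<chi>\<^sub>1\<^sub>2 * \<chi>(m \<otimes> id) = \<chi>\<^sub>2\<^sub>3 * \<chi>(id \<otimes> m)\<close> between invertible elements of the third of these
  algebras (\<open>cocycle3\<close>), so it may be inverted and its factors moved from one side to the other
  (\<open>cocycle3_inverse\<close>, \<open>cocycle3_mixed\<close>).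

  The product of \<open>H\<close> and its two actions on \<open>\<Omega>\<^sup>1\<close> are bilinear maps \<open>m\<close> that respect the coactions
  on both sides, and twisting replaces \<open>\<phi> \<circ> m\<close> by \<open>\<chi> \<cdot> (\<phi> \<circ> m) \<cdot> \<chi>\<inverse>\<close> for every functional \<open>\<phi>\<close>.  The module
  laws alone show that the twisted map respects the coactions over the twisted Hopf algebra
  (\<open>twisted_colinear\<close>), and the cocycle equation shows that twisting preserves associative laws
  (\<open>twisted_assoc\<close>).  Hence \<open>H\<^sup>\<chi>\<close> is a bialgebra and the twisted calculus is bicovariant, the Leibniz
  rule being inherited because \<open>d\<close> is a map of bicomodules.  The functional \<open>U\<close> has the inverse
  \<open>U\<inverse>(h) = \<chi>\<inverse>(S h\<^bsub>(1)\<^esub> \<otimes> h\<^bsub>(2)\<^esub>)\<close>, and \<open>S\<^sup>\<chi>\<close> is \<open>S\<close> after a conjugation by \<open>U\<close>; this makes \<open>S\<^sup>\<chi>\<close>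
  bijective and gives the antipode laws (\<open>hopf_algebra_twist\<close>).

  The cocycle equation yields \<open>\<alpha>\<inverse>(h) = \<chi>(h\<^bsub>(1)\<^esub> \<otimes> S h\<^bsub>(3)\<^esub>) h\<^bsub>(2)\<^esub> U\<inverse>(h\<^bsub>(4)\<^esub>)\<close> (\<open>wrap3_join12\<close>), so on functionals
  \<open>\<alpha>\<close> and \<open>\<alpha>\<inverse>\<close> are compositions of two evidently invertible operations and are inverse to each
  other.  On the other hand \<open>\<alpha>\<inverse>(h) = h \<triangleright>\<^sup>\<chi> 1\<close>, which explains why \<open>\<alpha>\<inverse>\<close> intertwines the actions
  (\<open>alpha_inv_act\<close>) and the coactions (\<open>coact_alpha_inv\<close>).  That the twists of \<open>H\<close>, \<open>ker \<epsilon>\<close> and \<open>V\<close>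
  are crossed modules need not be proved by computation: the axioms hold for \<open>H\<^sup>\<chi>\<close> and for its augmentation
  ideal and are carried over by the surjections \<open>\<alpha>\<inverse>\<close> and \<open>\<pi>\<close> (\<open>crossed_transfer\<close>).

  For a right-invariant form \<open>v\<close> half of the twist is trivial, \<open>v \<bullet> g = \<chi>(v\<^bsub>(1)\<^esub> \<otimes> g\<^bsub>(1)\<^esub>) v\<^bsub>(\<infinity>)\<^esub> g\<^bsub>(2)\<^esub>\<close>.
  Since this can be undone with \<open>\<chi>\<inverse>\<close>, the twisted calculus is again \<open>V \<otimes> H\<close>; the left action
  comes from the twisted action on \<open>V\<close> (\<open>twist_lact_invariant\<close>).  With \<open>\<varpi>(h) = \<pi>(h - \<epsilon>(h) 1)\<close> the
  formula for \<open>d\<close> reads \<open>d h = \<varpi>(h\<^bsub>(1)\<^esub>) h\<^bsub>(2)\<^esub>\<close>, and the same cancellation turns it into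
  \<open>d h = \<varpi>(\<alpha>\<inverse> h\<^bsub>(1)\<^esub>) \<bullet> h\<^bsub>(2)\<^esub>\<close> (\<open>twist_diff_form\<close>).
\<close>

section \<open>Sweedler sums and multilinear maps\<close>

text \<open>The sum of \<open>f a b\<close> over a representative \<open>xs\<close> of an element of a tensor product.\<close>

definition sw :: "('a \<times> 'b) list \<Rightarrow> ('a \<Rightarrow> 'b \<Rightarrow> 'c::comm_monoid_add) \<Rightarrow> 'c" where
  "sw xs f = (\<Sum>(a, b)\<leftarrow>xs. f a b)"

lemma sw_Nil [simp]: "sw [] f = 0"
  and sw_Cons [simp]: "sw ((a, b) # xs) f = f a b + sw xs f"
  and sw_append: "sw (xs @ ys) f = sw xs f + sw ys f"
  by (simp_all add: sw_def)

lemma sw_cong: "(\<And>a b. (a, b) \<in> set xs \<Longrightarrow> f a b = g a b) \<Longrightarrow> sw xs f = sw xs g"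
  unfolding sw_def by (rule arg_cong[where f = sum_list], rule map_cong) auto

text \<open>Congruence without the membership premise, used to rewrite below a given number of sums.\<close>

lemma sw_eqI: "(\<And>a b. f a b = g a b) \<Longrightarrow> sw xs f = sw xs g"
  by (rule sw_cong)

lemma sw_zero [simp]: "sw xs (\<lambda>a b. 0) = 0"
  by (induction xs) auto

lemma sw_add: "sw xs (\<lambda>a b. f a b + g a b) = sw xs f + sw xs g"
  by (induction xs) (auto simp: ac_simps)

lemma sw_mult_left: "c * sw xs f = sw xs (\<lambda>a b. (c::'k::comm_ring_1) * f a b)"
  by (induction xs) (auto simp: algebra_simps)

lemma sw_mult_right: "sw xs f * c = sw xs (\<lambda>a b. f a b * (c::'k::comm_ring_1))"
  by (induction xs) (auto simp: algebra_simps)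

lemma sw_swap: "sw xs (\<lambda>a b. sw ys (\<lambda>c d. F a b c d)) = sw ys (\<lambda>c d. sw xs (\<lambda>a b. F a b c d))"
  by (induction xs) (auto simp: sw_add)

lemma sw_swap2:
  "sw xs (\<lambda>a b. sw (ys a b) (\<lambda>c d. sw zs (\<lambda>e f. F a b c d e f)))
    = sw zs (\<lambda>e f. sw xs (\<lambda>a b. sw (ys a b) (\<lambda>c d. F a b c d e f)))"
  by (rule trans[OF sw_eqI[OF sw_swap] sw_swap])

lemma sw_swap3:
  "sw xs (\<lambda>a b. sw (ys a b) (\<lambda>c d. sw (us a b c d) (\<lambda>e f. sw zs (\<lambda>g h. F a b c d e f g h))))
    = sw zs (\<lambda>g h. sw xs (\<lambda>a b. sw (ys a b) (\<lambda>c d. sw (us a b c d) (\<lambda>e f. F a b c d e f g h))))"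
  by (rule trans[OF sw_eqI[OF sw_swap2] sw_swap])

lemma sw_swap4:
  "sw xs (\<lambda>a b. sw (ys a b) (\<lambda>c d. sw (us a b c d) (\<lambda>e f. sw (vs a b c d e f) (\<lambda>i j. sw zs (\<lambda>g h. F a b c d e f i j g h)))))
    = sw zs (\<lambda>g h. sw xs (\<lambda>a b. sw (ys a b) (\<lambda>c d. sw (us a b c d) (\<lambda>e f. sw (vs a b c d e f) (\<lambda>i j. F a b c d e f i j g h)))))"
  by (rule trans[OF sw_eqI[OF sw_swap3] sw_swap])

lemma sw_map_prod: "sw (map (\<lambda>(a, b). (f a b, g a b)) xs) F = sw xs (\<lambda>a b. F (f a b) (g a b))"
  by (induction xs) auto

lemma sw_concat: "sw (concat (map (\<lambda>(a, b). ys a b) xs)) F = sw xs (\<lambda>a b. sw (ys a b) F)"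
  by (induction xs) (auto simp: sw_append)

text \<open>Sums over list comprehensions are nested Sweedler sums.\<close>

lemma sum_compr_left:
  "(\<Sum>(a, b, c)\<leftarrow>[(a, b, c). (x, c) \<leftarrow> xs, (a, b) \<leftarrow> f x]. F a b c) = sw xs (\<lambda>x c. sw (f x) (\<lambda>a b. F a b c))"
  by (induction xs) (auto simp: sw_def o_def case_prod_unfold)

lemma sum_compr_right:
  "(\<Sum>(a, b, c)\<leftarrow>[(a, b, c). (a, x) \<leftarrow> xs, (b, c) \<leftarrow> f x]. F a b c) = sw xs (\<lambda>a x. sw (f x) (\<lambda>b c. F a b c))"
  by (induction xs) (auto simp: sw_def o_def case_prod_unfold)

lemma sw_compr:
  "sw [(f a b c d, g a b c d). (a, b) \<leftarrow> xs, (c, d) \<leftarrow> ys a b] F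
    = sw xs (\<lambda>a b. sw (ys a b) (\<lambda>c d. F (f a b c d) (g a b c d)))"
  by (simp add: sw_concat sw_map_prod)

lemma comult3_sum: "(\<Sum>(a, b, c)\<leftarrow>comult3 H h. f a b c)
    = sw (comult H h) (\<lambda>a x. sw (comult H x) (\<lambda>b c. f a b c))"
  unfolding comult3_def by (rule sum_compr_right)

lemma comult4_sum: "(\<Sum>(a, b, c, d)\<leftarrow>comult4 H h. f a b c d)
    = sw (comult H h) (\<lambda>a x. sw (comult H x) (\<lambda>b y. sw (comult H y) (\<lambda>c d. f a b c d)))"
proof -
  have "(\<Sum>(a, b, c, d)\<leftarrow>[(a, b, c, d). (a, x) \<leftarrow> xs, (b, c, d) \<leftarrow> comult3 H x]. f a b c d)
    = sw xs (\<lambda>a x. \<Sum>(b, c, d)\<leftarrow>comult3 H x. f a b c d)" for xs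
    by (induction xs) (auto simp: o_def case_prod_unfold)
  then show ?thesis by (simp add: comult4_def comult3_sum)
qed

lemma comult5_sum: "(\<Sum>(a, b, c, d, e)\<leftarrow>comult5 H h. f a b c d e)
    = sw (comult H h) (\<lambda>a x. sw (comult H x) (\<lambda>b y. sw (comult H y) (\<lambda>c z. sw (comult H z) (\<lambda>d e. f a b c d e))))"
proof -
  have "(\<Sum>(a, b, c, d, e)\<leftarrow>[(a, b, c, d, e). (a, x) \<leftarrow> xs, (b, c, d, e) \<leftarrow> comult4 H x]. f a b c d e)
    = sw xs (\<lambda>a x. \<Sum>(b, c, d, e)\<leftarrow>comult4 H x. f a b c d e)" for xs
    by (induction xs) (auto simp: o_def case_prod_unfold)
  then show ?thesis by (simp add: comult5_def comult4_sum)
qed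

text \<open>Linear, bilinear and trilinear maps on whole spaces, with explicit scalar multiplications.\<close>

abbreviation lin :: "('k \<Rightarrow> 'a::ab_group_add \<Rightarrow> 'a) \<Rightarrow> ('k \<Rightarrow> 'b::ab_group_add \<Rightarrow> 'b) \<Rightarrow> ('a \<Rightarrow> 'b) \<Rightarrow> bool"
  where "lin \<equiv> linear_on UNIV"

abbreviation bil :: "('k \<Rightarrow> 'a::ab_group_add \<Rightarrow> 'a) \<Rightarrow> ('k \<Rightarrow> 'b::ab_group_add \<Rightarrow> 'b)
    \<Rightarrow> ('k \<Rightarrow> 'c::ab_group_add \<Rightarrow> 'c) \<Rightarrow> ('a \<Rightarrow> 'b \<Rightarrow> 'c) \<Rightarrow> bool"
  where "bil \<equiv> bilinear_on UNIV UNIV"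

definition tril :: "('k \<Rightarrow> 'a::ab_group_add \<Rightarrow> 'a) \<Rightarrow> ('k \<Rightarrow> 'b::ab_group_add \<Rightarrow> 'b)
    \<Rightarrow> ('k \<Rightarrow> 'c::ab_group_add \<Rightarrow> 'c) \<Rightarrow> ('k \<Rightarrow> 'd::ab_group_add \<Rightarrow> 'd) \<Rightarrow> ('a \<Rightarrow> 'b \<Rightarrow> 'c \<Rightarrow> 'd) \<Rightarrow> bool"
  where "tril sA sB sC sD f \<longleftrightarrow>
    (\<forall>b c. lin sA sD (\<lambda>a. f a b c)) \<and> (\<forall>a c. lin sB sD (\<lambda>b. f a b c)) \<and> (\<forall>a b. lin sC sD (f a b))"

text \<open>Introduction rules which decide linearity in one variable by the shape of the term.\<close>

named_theorems lin

lemma linI: "(\<And>x y. f (x + y) = f x + f y) \<Longrightarrow> (\<And>c x. f (sA c x) = sB c (f x)) \<Longrightarrow> lin sA sB f"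
  by (simp add: linear_on_def)

lemma lin_add: "lin sA sB f \<Longrightarrow> f (x + y) = f x + f y"
  and lin_scale: "lin sA sB f \<Longrightarrow> f (sA c x) = sB c (f x)"
  by (auto simp: linear_on_def)

lemma bilI: "(\<And>b. lin sA sC (\<lambda>a. f a b)) \<Longrightarrow> (\<And>a. lin sB sC (f a)) \<Longrightarrow> bil sA sB sC f"
  by (simp add: bilinear_on_def)

lemma bilD1: "bil sA sB sC f \<Longrightarrow> lin sA sC (\<lambda>a. f a b)"
  and bilD2: "bil sA sB sC f \<Longrightarrow> lin sB sC (f a)"
  by (auto simp: bilinear_on_def)

lemma trilI: "(\<And>b c. lin sA sD (\<lambda>a. f a b c)) \<Longrightarrow> (\<And>a c. lin sB sD (\<lambda>b. f a b c))
    \<Longrightarrow> (\<And>a b. lin sC sD (f a b)) \<Longrightarrow> tril sA sB sC sD f"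
  by (simp add: tril_def)

lemma lin_zero: assumes "lin sA sB f" shows "f 0 = 0"
  using lin_add[OF assms, of 0 0] by simp

lemma lin_minus: assumes "lin sA sB f" shows "f (- x) = - f x"
  using lin_add[OF assms, of x "- x"] lin_zero[OF assms] by (simp add: add_eq_0_iff2 minus_unique)

lemma lin_diff: assumes "lin sA sB f" shows "f (x - y) = f x - f y"
  using lin_add[OF assms, of x "- y"] lin_minus[OF assms, of y] by simp

lemma lin_sw: assumes "lin sA sB f" shows "f (sw xs F) = sw xs (\<lambda>a b. f (F a b))"
  by (induction xs) (auto simp: lin_zero[OF assms] lin_add[OF assms])

lemma lin_sum_list: assumes "lin sA sB f" shows "f (\<Sum>x\<leftarrow>xs. F x) = (\<Sum>x\<leftarrow>xs. f (F x))"
  by (induction xs) (auto simp: lin_zero[OF assms] lin_add[OF assms])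

lemma lin_sum: assumes "lin sA sB f" shows "f (\<Sum>x\<in>I. F x) = (\<Sum>x\<in>I. f (F x))"
  by (induction I rule: infinite_finite_induct) (auto simp: lin_zero[OF assms] lin_add[OF assms])

lemma lin_id [lin]: "linear_on V s s (\<lambda>x. x)"
  by (simp add: linear_on_def)

lemma lin_compose: "lin s t g \<Longrightarrow> linear_on V r s f \<Longrightarrow> linear_on V r t (\<lambda>x. g (f x))"
  by (simp add: linear_on_def)

lemma lin_bil1: "bil sA sB sC g \<Longrightarrow> linear_on V r sA f \<Longrightarrow> linear_on V r sC (\<lambda>x. g (f x) b)"
  and lin_bil2: "bil sA sB sC g \<Longrightarrow> linear_on V r sB f' \<Longrightarrow> linear_on V r sC (\<lambda>x. g a (f' x))"
  by (auto simp: linear_on_def bilinear_on_def)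

lemma lin_tril1: "tril sA sB sC sD g \<Longrightarrow> linear_on V r sA f \<Longrightarrow> linear_on V r sD (\<lambda>x. g (f x) b c)"
  and lin_tril2: "tril sA sB sC sD g \<Longrightarrow> linear_on V r sB f' \<Longrightarrow> linear_on V r sD (\<lambda>x. g a (f' x) c)"
  and lin_tril3: "tril sA sB sC sD g \<Longrightarrow> linear_on V r sC f'' \<Longrightarrow> linear_on V r sD (\<lambda>x. g a b (f'' x))"
  by (auto simp: linear_on_def tril_def)

lemmas bil_lin = lin_bil1 lin_bil2
lemmas tril_lin = lin_tril1 lin_tril2 lin_tril3

lemma lin_mult_left [lin]: "linear_on V s (*) f \<Longrightarrow> linear_on V s (*) (\<lambda>x. (c::'k::comm_ring_1) * f x)"
  and lin_mult_right [lin]: "linear_on V s (*) f \<Longrightarrow> linear_on V s (*) (\<lambda>x. f x * c)"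
  by (auto simp: linear_on_def algebra_simps)

lemma lin_const_sw [lin]: "(\<And>a b. linear_on V s (*) (F a b)) \<Longrightarrow> linear_on V s (*) (\<lambda>x. sw xs (\<lambda>a b. (F a b x::'k::comm_ring_1)))"
  by (induction xs) (auto simp: linear_on_def algebra_simps)

section \<open>Separation by functionals\<close>

lemma field_vector_space: "vector_space ((*) :: 'k::field \<Rightarrow> 'k \<Rightarrow> 'k)"
  by unfold_locales (auto simp: algebra_simps)

lemma linear_lin: "Vector_Spaces.linear s t f \<Longrightarrow> lin s t f"
  by (simp add: Vector_Spaces.linear_iff linear_on_def)

text \<open>A functional that vanishes on \<open>R\<close> but not at a given point outside the span of \<open>R\<close>.\<close>

lemma functional_off_span:
  fixes s :: "'k::field \<Rightarrow> 'v::ab_group_add \<Rightarrow> 'v"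
  assumes "vector_space s" and "x \<notin> module.span s R"
  obtains \<phi> where "lin s (*) \<phi>" "\<phi> x \<noteq> 0" "\<And>y. y \<in> R \<Longrightarrow> \<phi> y = 0"
proof -
  interpret vector_space s by fact
  interpret p: vector_space_pair s "(*) :: 'k \<Rightarrow> 'k \<Rightarrow> 'k"
    using assms(1) field_vector_space by (simp add: vector_space_pair_def)
  obtain B where B: "B \<subseteq> R" "independent B" "R \<subseteq> span B"
    using maximal_independent_subset by blast
  then have "span B = span R"
    by (metis span_mono span_span subset_antisym)
  with B assms(2) have ind: "independent (insert x B)" and "x \<notin> B"
    by (auto simp: independent_insertI span_base)
  obtain \<phi> where \<phi>: "Vector_Spaces.linear s (*) \<phi>"
    and val: "\<And>y. y \<in> insert x B \<Longrightarrow> \<phi> y = (if y = x then 1 else 0)"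
    using p.linear_independent_extend[OF ind, of "\<lambda>y. if y = x then 1 else 0"] by blast
  have zero: "\<phi> y = 0" if "y \<in> span B" for y
  proof (rule p.linear_eq_on[OF \<phi> _ that, of "\<lambda>_. 0"])
    show "Vector_Spaces.linear s (*) (\<lambda>_. 0)" by (simp add: p.linear_zero)
  qed (use val \<open>x \<notin> B\<close> in auto)
  show ?thesis
    using that[OF linear_lin[OF \<phi>]] val zero B by (metis insertI1 subsetD zero_neq_one)
qed

lemma eq_by_functionals:
  fixes s :: "'k::field \<Rightarrow> 'v::ab_group_add \<Rightarrow> 'v"
  assumes "vector_space s" and "\<And>\<phi>. lin s (*) \<phi> \<Longrightarrow> \<phi> x = \<phi> y"
  shows "x = y"
proof (rule ccontr)
  interpret vector_space s by fact
  assume "x \<noteq> y"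
  then have "x - y \<notin> module.span s {}" by (simp add: span_empty)
  from functional_off_span[OF assms(1) this] obtain \<phi> where "lin s (*) \<phi>" "\<phi> (x - y) \<noteq> 0" by metis
  with assms(2) show False by (simp add: lin_diff)
qed

lemma subspace_projection:
  fixes s :: "'k::field \<Rightarrow> 'v::ab_group_add \<Rightarrow> 'v"
  assumes "vector_space s" and "module.subspace s C"
  obtains P where "lin s s P" "\<And>x. P x \<in> C" "\<And>x. x \<in> C \<Longrightarrow> P x = x"
proof -
  interpret vector_space s by fact
  interpret p: vector_space_pair s s
    using assms(1) by (simp add: vector_space_pair_def)
  obtain B where B: "B \<subseteq> C" "independent B" "C \<subseteq> span B"
    using maximal_independent_subset by blast
  have sp: "span B = C" using B assms(2) by (simp add: span_subspace)
  obtain P where P: "Vector_Spaces.linear s s P" "\<forall>x\<in>B. P x = x" "range P = span B"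
    using p.linear_independent_extend_subspace[OF B(2), of "\<lambda>x. x"] by auto
  have "P x = x" if "x \<in> span B" for x
    by (rule p.linear_eq_on[OF P(1) _ that, of "\<lambda>x. x"]) (use P(2) linear_id in \<open>auto simp: id_def\<close>)
  then show ?thesis using that[OF linear_lin[OF P(1)]] P(3) sp by blast
qed

section \<open>Tensor equality\<close>

lemma lookup_formal_scale: "Poly_Mapping.lookup (formal_scale c x) p = c * Poly_Mapping.lookup x p"
  by (simp add: formal_scale_def map.rep_eq when_def)

lemma formal_vector_space: "vector_space (formal_scale :: 'k::field \<Rightarrow> ('p \<Rightarrow>\<^sub>0 'k) \<Rightarrow> ('p \<Rightarrow>\<^sub>0 'k))"
  by unfold_locales (auto intro!: poly_mapping_eqI simp: lookup_formal_scale lookup_add algebra_simps)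

text \<open>The linear extension to formal sums of a function on the generators.\<close>

definition formal_eval :: "('p \<Rightarrow> 'k::field) \<Rightarrow> ('p \<Rightarrow>\<^sub>0 'k) \<Rightarrow> 'k" where
  "formal_eval f x = Sum_any (\<lambda>p. Poly_Mapping.lookup x p * f p)"

lemma formal_eval_fin: "finite {p. Poly_Mapping.lookup x p * f p \<noteq> (0::'k::field)}"
  by (rule finite_subset[OF _ finite_lookup[of x]]) auto

lemma formal_eval_add: "formal_eval f (x + y) = formal_eval f x + formal_eval f y"
  unfolding formal_eval_def
  by (simp add: lookup_add distrib_right Sum_any.distrib[OF formal_eval_fin formal_eval_fin])

lemma formal_eval_scale: "formal_eval f (formal_scale c x) = c * formal_eval f x"
  unfolding formal_eval_def
  by (simp add: lookup_formal_scale mult.assoc Sum_any_right_distrib[OF formal_eval_fin])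

lemma lin_formal_eval: "lin formal_scale (*) (formal_eval f)"
  by (simp add: linear_on_def formal_eval_add formal_eval_scale)

lemma formal_eval_single: "formal_eval f (Poly_Mapping.single p 1) = f p"
proof -
  have "formal_eval f (Poly_Mapping.single p 1) = Sum_any (\<lambda>q. f q when p = q)"
    unfolding formal_eval_def by (rule arg_cong[where f = Sum_any]) (auto simp: lookup_single when_def)
  then show ?thesis by simp
qed

lemma formal_eval_sum: "formal_eval f (formal_sum xs) = (\<Sum>p\<leftarrow>xs. f p)"
  unfolding formal_sum_def lin_sum_list[OF lin_formal_eval] by (simp add: formal_eval_single)

text \<open>Membership in the span of a set of relations is tested by the functions that respect the
  relations.\<close>

lemma formal_span_iff:
  fixes R :: "('p \<Rightarrow>\<^sub>0 'k::field) set"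
  shows "formal_sum xs - formal_sum ys \<in> module.span formal_scale R \<longleftrightarrow>
    (\<forall>f. (\<forall>r\<in>R. formal_eval f r = 0) \<longrightarrow> (\<Sum>p\<leftarrow>xs. f p) = (\<Sum>p\<leftarrow>ys. f p))"
proof safe
  interpret vector_space "formal_scale :: 'k \<Rightarrow> ('p \<Rightarrow>\<^sub>0 'k) \<Rightarrow> _" by (rule formal_vector_space)
  fix f assume R: "\<forall>r\<in>R. formal_eval f r = 0" and "formal_sum xs - formal_sum ys \<in> span R"
  from this(2) have "formal_eval f (formal_sum xs - formal_sum ys) = 0"
    by (induction rule: span_induct_alt)
      (auto simp: lin_zero[OF lin_formal_eval] formal_eval_add formal_eval_scale R)
  then show "(\<Sum>p\<leftarrow>xs. f p) = (\<Sum>p\<leftarrow>ys. f p)"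
    by (simp add: lin_diff[OF lin_formal_eval] formal_eval_sum)
next
  assume *: "\<forall>f. (\<forall>r\<in>R. formal_eval f r = 0) \<longrightarrow> (\<Sum>p\<leftarrow>xs. f p) = (\<Sum>p\<leftarrow>ys. f p)"
  show "formal_sum xs - formal_sum ys \<in> module.span formal_scale R"
  proof (rule ccontr)
    assume "\<not> ?thesis"
    from functional_off_span[OF formal_vector_space this]
    obtain \<phi> where \<phi>: "lin formal_scale (*) \<phi>" "\<phi> (formal_sum xs - formal_sum ys) \<noteq> 0"
      "\<And>r. r \<in> R \<Longrightarrow> \<phi> r = 0" by metis
    define f where "f p = \<phi> (Poly_Mapping.single p 1)" for p
    have "\<phi> r = formal_eval f r" for r
    proof (induction r rule: update_induct)
      case const
      show ?case by (simp add: lin_zero[OF \<phi>(1)] lin_zero[OF lin_formal_eval])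
    next
      case (update r p c)
      have "Poly_Mapping.update p c r = r + formal_scale c (Poly_Mapping.single p 1)"
        using update(1)
        by (intro poly_mapping_eqI) (auto simp: lookup_update lookup_add lookup_formal_scale lookup_single when_def in_keys_iff)
      with update(3) show ?case
        by (simp add: lin_add[OF \<phi>(1)] lin_scale[OF \<phi>(1)] formal_eval_add formal_eval_scale formal_eval_single f_def)
    qed
    with * \<phi>(2,3) show False by (simp add: lin_diff[OF lin_formal_eval] formal_eval_sum)
  qed
qed

theorem tensor_eq_iff:
  "tensor_eq sA sB xs ys \<longleftrightarrow> (\<forall>\<beta>. bil sA sB (*) \<beta> \<longrightarrow> sw xs \<beta> = sw ys \<beta>)"
proof -
  have "(\<forall>r\<in>tensor_relations sA sB. formal_eval f r = 0) \<longleftrightarrow> bil sA sB (*) (curry f)" for f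
    unfolding tensor_relations_def ball_Un ball_UN
    by (auto simp: lin_diff[OF lin_formal_eval] formal_eval_sum formal_eval_scale bilinear_on_def linear_on_def)
  moreover have "(\<Sum>p\<leftarrow>zs. f p) = sw zs (curry f)" for zs :: "('b \<times> 'c) list" and f :: "_ \<Rightarrow> 'a"
    by (simp add: sw_def case_prod_unfold)
  ultimately show ?thesis
    unfolding tensor_eq_def formal_span_iff by (metis curry_case_prod)
qed

theorem tensor3_eq_iff:
  "tensor3_eq sA sB sC xs ys \<longleftrightarrow>
    (\<forall>\<beta>. tril sA sB sC (*) \<beta> \<longrightarrow> (\<Sum>(a, b, c)\<leftarrow>xs. \<beta> a b c) = (\<Sum>(a, b, c)\<leftarrow>ys. \<beta> a b c))"
proof -
  have "(\<forall>r\<in>tensor3_relations sA sB sC. formal_eval f r = 0) \<longleftrightarrow> tril sA sB sC (*) (\<lambda>a b c. f (a, b, c))" for f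
    unfolding tensor3_relations_def ball_Un ball_UN
    by (auto simp: lin_diff[OF lin_formal_eval] formal_eval_sum formal_eval_scale tril_def linear_on_def)
  then show ?thesis
    by (auto simp: tensor3_eq_def formal_span_iff case_prod_unfold)
qed

lemma tensor_eqD: "tensor_eq sA sB xs ys \<Longrightarrow> bil sA sB (*) \<beta> \<Longrightarrow> sw xs \<beta> = sw ys \<beta>"
  by (simp add: tensor_eq_iff)

lemma tensor_eqI: "(\<And>\<beta>. bil sA sB (*) \<beta> \<Longrightarrow> sw xs \<beta> = sw ys \<beta>) \<Longrightarrow> tensor_eq sA sB xs ys"
  by (simp add: tensor_eq_iff)

text \<open>Functions that are bilinear only on a subspace \<open>C\<close> may be used for representatives with legs in
  \<open>C\<close>: compose them with a linear projection onto \<open>C\<close>.\<close>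

lemma tensor_eqD_on:
  fixes sA :: "'k::field \<Rightarrow> 'a::ab_group_add \<Rightarrow> 'a" and sB :: "'k \<Rightarrow> 'b::ab_group_add \<Rightarrow> 'b"
  assumes "tensor_eq sA sB xs ys" "vector_space sB" "module.subspace sB C"
    and "set xs \<subseteq> UNIV \<times> C" "set ys \<subseteq> UNIV \<times> C" "bilinear_on UNIV C sA sB (*) \<beta>"
  shows "sw xs \<beta> = sw ys \<beta>"
proof -
  obtain P where P: "lin sB sB P" "\<And>x. P x \<in> C" "\<And>x. x \<in> C \<Longrightarrow> P x = x"
    using subspace_projection[OF assms(2,3)] by blast
  have "sw xs (\<lambda>a b. \<beta> a (P b)) = sw ys (\<lambda>a b. \<beta> a (P b))"
  proof (rule tensor_eqD[OF assms(1)], intro bilI linI)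
  qed (use P assms(6) in \<open>auto simp: linear_on_def bilinear_on_def\<close>)
  moreover have "sw zs (\<lambda>a b. \<beta> a (P b)) = sw zs \<beta>" if "set zs \<subseteq> UNIV \<times> C" for zs
    using that by (intro sw_cong) (auto simp: P)
  ultimately show ?thesis using assms(4,5) by simp
qed

lemma tensor_linear_onI:
  assumes "\<And>\<beta>. bil sA sB (*) \<beta> \<Longrightarrow> linear_on V sV (*) (\<lambda>x. sw (t x) \<beta>)"
  shows "tensor_linear_on V sV sA sB t"
  unfolding tensor_linear_on_def tensor_eq_iff
proof (intro conjI ballI allI impI)
  fix x y \<beta> assume "x \<in> V" "y \<in> V" "bil sA sB (*) \<beta>"
  with assms show "sw (t (x + y)) \<beta> = sw (t x @ t y) \<beta>"
    by (simp add: linear_on_def sw_append)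
next
  fix c x \<beta> assume x: "x \<in> V" and \<beta>: "bil sA sB (*) \<beta>"
  have "sw [(sA c a, b). (a, b) \<leftarrow> t x] \<beta> = c * sw (t x) \<beta>"
    unfolding sw_map_prod sw_mult_left by (rule sw_eqI) (rule lin_scale[OF bilD1[OF \<beta>]])
  with assms[OF \<beta>] x show "sw (t (sV c x)) \<beta> = sw [(sA c a, b). (a, b) \<leftarrow> t x] \<beta>"
    by (simp add: linear_on_def)
qed

lemma tensor_linear_onD:
  assumes "tensor_linear_on V sV sA sB t" and "vector_space sB" "module.subspace sB C"
    and V: "module.subspace sV V" "vector_space sV" and "\<And>x. x \<in> V \<Longrightarrow> set (t x) \<subseteq> UNIV \<times> C"
    and \<beta>: "bilinear_on UNIV C sA sB (*) \<beta>"
  shows "linear_on V sV (*) (\<lambda>x. sw (t x) \<beta>)"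
  unfolding linear_on_def
proof (intro conjI ballI allI)
  interpret vector_space sV by fact
  note D = tensor_eqD_on[OF _ assms(2,3) _ _ \<beta>]
  fix x assume x: "x \<in> V"
  { fix y assume y: "y \<in> V"
    have "sw (t (x + y)) \<beta> = sw (t x @ t y) \<beta>"
      using assms(1) x y assms(6)[of x] assms(6)[of y] assms(6)[OF subspace_add[OF V(1) x y]]
      by (intro D) (auto simp: tensor_linear_on_def)
    then show "sw (t (x + y)) \<beta> = sw (t x) \<beta> + sw (t y) \<beta>" by (simp add: sw_append) }
  fix c
  have "sw (t (sV c x)) \<beta> = sw [(sA c a, b). (a, b) \<leftarrow> t x] \<beta>"
    using assms(1) x assms(6)[of x] assms(6)[OF subspace_scale[OF V(1) x]]
    by (intro D) (auto simp: tensor_linear_on_def)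
  also have "\<dots> = c * sw (t x) \<beta>"
    unfolding sw_map_prod sw_mult_left using assms(6)[OF x] \<beta>
    by (intro sw_cong) (auto simp: bilinear_on_def linear_on_def)
  finally show "sw (t (sV c x)) \<beta> = c * sw (t x) \<beta>" .
qed

text \<open>Products of functionals separate the points of a tensor product.  Expanding the first legs in a
  basis reduces a bilinear \<open>\<beta>\<close> to the elements \<open>\<Sum> \<phi>(a) b\<close> for coordinate functionals \<open>\<phi>\<close>, and
  these are determined by the functionals on the second space.\<close>

lemma tensor_eq_by_functionals:
  fixes sA :: "'k::field \<Rightarrow> 'a::ab_group_add \<Rightarrow> 'a" and sB :: "'k \<Rightarrow> 'b::ab_group_add \<Rightarrow> 'b"
  assumes A: "vector_space sA" and B: "vector_space sB"
    and eq: "\<And>\<phi> \<psi>. lin sA (*) \<phi> \<Longrightarrow> lin sB (*) \<psi>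
      \<Longrightarrow> sw xs (\<lambda>a b. \<phi> a * \<psi> b) = sw ys (\<lambda>a b. \<phi> a * \<psi> b)"
  shows "tensor_eq sA sB xs ys"
proof (rule tensor_eqI)
  fix \<beta> assume \<beta>: "bil sA sB (*) \<beta>"
  interpret A: vector_space sA by fact
  define E where "E = A.extend_basis {}"
  have E: "A.independent E" "A.span E = UNIV"
    unfolding E_def using A.independent_extend_basis[OF A.independent_empty] A.span_extend_basis[OF A.independent_empty] by auto
  define co where "co e a = A.representation E a e" for e a
  have co_lin: "lin sA (*) (co e)" for e
    unfolding co_def by (intro linI) (auto simp: A.representation_add[OF E(1)] A.representation_scale[OF E(1)] E(2))
  have supp: "finite {e. co e a \<noteq> 0}" "{e. co e a \<noteq> 0} \<subseteq> E" for a
    unfolding co_def using A.finite_representation A.representation_ne_zero by auto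
  have expand: "(\<Sum>e | co e a \<noteq> 0. sA (co e a) e) = a" for a
    unfolding co_def by (rule A.sum_nonzero_representation_eq[OF E(1)]) (simp add: E(2))
  define I where "I = (\<Union>a\<in>fst ` set (xs @ ys). {e. co e a \<noteq> 0})"
  have finI: "finite I" unfolding I_def using supp(1) by auto
  have expI: "(\<Sum>e\<in>I. sA (co e a) e) = a" if "a \<in> fst ` set (xs @ ys)" for a
  proof -
    have "(\<Sum>e\<in>I. sA (co e a) e) = (\<Sum>e | co e a \<noteq> 0. sA (co e a) e)"
      by (rule sum.mono_neutral_right[OF finI]) (use that in \<open>auto simp: I_def\<close>)
    then show ?thesis by (simp add: expand)
  qed
  have vec: "sw xs (\<lambda>a b. sB (co e a) b) = sw ys (\<lambda>a b. sB (co e a) b)" for e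
  proof (rule eq_by_functionals[OF B])
    fix \<psi> assume \<psi>: "lin sB (*) \<psi>"
    show "\<psi> (sw xs (\<lambda>a b. sB (co e a) b)) = \<psi> (sw ys (\<lambda>a b. sB (co e a) b))"
      using eq[OF co_lin \<psi>] by (simp add: lin_sw[OF \<psi>] lin_scale[OF \<psi>])
  qed
  have "sw zs \<beta> = (\<Sum>e\<in>I. \<beta> e (sw zs (\<lambda>a b. sB (co e a) b)))" if "set zs \<subseteq> set (xs @ ys)" for zs
  proof -
    have "sw zs \<beta> = sw zs (\<lambda>a b. \<Sum>e\<in>I. co e a * \<beta> e b)"
    proof (rule sw_cong)
      fix a b assume "(a, b) \<in> set zs"
      with that have "a \<in> fst ` set (xs @ ys)" by force
      from expI[OF this] have "\<beta> a b = \<beta> (\<Sum>e\<in>I. sA (co e a) e) b" by simp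
      also have "\<dots> = (\<Sum>e\<in>I. co e a * \<beta> e b)"
        by (simp add: lin_sum[OF bilD1[OF \<beta>]] lin_scale[OF bilD1[OF \<beta>]])
      finally show "\<beta> a b = \<dots>" .
    qed
    also have "\<dots> = (\<Sum>e\<in>I. sw zs (\<lambda>a b. co e a * \<beta> e b))"
      by (induction zs) (auto simp: sum.distrib)
    also have "\<dots> = (\<Sum>e\<in>I. \<beta> e (sw zs (\<lambda>a b. sB (co e a) b)))"
      by (simp add: lin_sw[OF bilD2[OF \<beta>]] lin_scale[OF bilD2[OF \<beta>]])
    finally show ?thesis .
  qed
  from this[of xs] this[of ys] vec show "sw xs \<beta> = sw ys \<beta>" by auto
qed

section \<open>Hopf algebras tested by functionals\<close>

context hopf_algebra
begin

text \<open>\<open>D h (\<lambda>a b. F a b)\<close> is \<open>F(h\<^bsub>(1)\<^esub>, h\<^bsub>(2)\<^esub>)\<close>.  A further coproduct is a nested \<open>D\<close>, and iterated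
  coproducts are nested to the right unless a step requires otherwise.\<close>

abbreviation "sH \<equiv> scale H"
abbreviation "S \<equiv> antipode H"
abbreviation "\<epsilon> \<equiv> counit H"
abbreviation "D h \<equiv> sw (comult H h)"

lemma mult_lin [lin]: "linear_on A s sH f \<Longrightarrow> linear_on A s sH (\<lambda>x. f x \<cdot> c)" "linear_on A s sH f \<Longrightarrow> linear_on A s sH (\<lambda>x. c \<cdot> f x)"
  by (rule bil_lin[OF mult_bilinear], assumption)+

lemma antipode_lin [lin]: "linear_on A s sH f \<Longrightarrow> linear_on A s sH (\<lambda>x. S (f x))"
  by (rule lin_compose[OF antipode_linear])

lemma counit_lin [lin]: "linear_on A s sH f \<Longrightarrow> linear_on A s (*) (\<lambda>x. \<epsilon> (f x))"
  by (rule lin_compose[OF counit_linear])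

lemma comult_lin [lin]:
  assumes "linear_on A s sH f" "\<And>b. lin sH (*) (\<lambda>a. F a b)" "\<And>a. lin sH (*) (F a)"
  shows "linear_on A s (*) (\<lambda>x. D (f x) F)"
proof (rule lin_compose[OF _ assms(1)], rule linI)
  have F: "bil sH sH (*) F" using assms by (intro bilI)
  show "D (x + y) F = D x F + D y F" for x y
    using tensor_eqD[OF _ F, of "comult H (x + y)" "comult H x @ comult H y"] comult_linear
    by (simp add: tensor_linear_on_def sw_append)
  fix c x
  have "D (sH c x) F = sw (map (\<lambda>(a, b). (sH c a, b)) (comult H x)) F"
    using comult_linear F unfolding tensor_linear_on_def by (intro tensor_eqD[OF _ F]) auto
  also have "\<dots> = c * D x F"
    unfolding sw_map_prod sw_mult_left by (rule sw_eqI) (rule lin_scale[OF assms(2)])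
  finally show "D (sH c x) F = c * D x F" .
qed

lemma comult_assoc:
  assumes "\<And>b c. lin sH (*) (\<lambda>a. F a b c)" "\<And>a c. lin sH (*) (\<lambda>b. F a b c)" "\<And>a b. lin sH (*) (F a b)"
  shows "D h (\<lambda>x c. D x (\<lambda>a b. F a b c)) = D h (\<lambda>a x. D x (\<lambda>b c. F a b c))"
proof -
  have "tril sH sH sH (*) F" using assms by (intro trilI)
  from coassoc[unfolded tensor3_eq_iff, rule_format, OF this, of h] show ?thesis
    unfolding sum_compr_left sum_compr_right .
qed

lemma comult_counit_left: "lin sH (*) \<phi> \<Longrightarrow> D h (\<lambda>a b. \<epsilon> a * \<phi> b) = \<phi> h"
  using arg_cong[OF counit_left[of h, folded sw_def], of \<phi>] by (simp add: lin_scale lin_sw)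

lemma comult_counit_right: "lin sH (*) \<phi> \<Longrightarrow> D h (\<lambda>a b. \<phi> a * \<epsilon> b) = \<phi> h"
  using arg_cong[OF counit_right[of h, folded sw_def], of \<phi>] by (simp add: lin_scale lin_sw mult.commute)

lemma comult_of_mult:
  assumes "\<And>b. lin sH (*) (\<lambda>a. F a b)" "\<And>a. lin sH (*) (F a)"
  shows "D (x \<cdot> y) F = D x (\<lambda>a b. D y (\<lambda>c d. F (a \<cdot> c) (b \<cdot> d)))"
proof -
  have "bil sH sH (*) F" using assms by (intro bilI)
  from tensor_eqD[OF comult_mult this] show ?thesis
    by (simp add: sw_concat sw_map_prod)
qed

lemma comult_of_unit:
  assumes "\<And>b. lin sH (*) (\<lambda>a. F a b)" "\<And>a. lin sH (*) (F a)"
  shows "D \<one> F = F \<one> \<one>"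
proof -
  have "bil sH sH (*) F" using assms by (intro bilI)
  from tensor_eqD[OF comult_unit this] show ?thesis by simp
qed

lemma comult_antipode_left: "lin sH (*) \<phi> \<Longrightarrow> D h (\<lambda>a b. \<phi> (S a \<cdot> b)) = \<epsilon> h * \<phi> \<one>"
  using arg_cong[OF antipode_left[of h, folded sw_def], of \<phi>] by (simp add: lin_scale lin_sw)

lemma comult_antipode_right: "lin sH (*) \<phi> \<Longrightarrow> D h (\<lambda>a b. \<phi> (a \<cdot> S b)) = \<epsilon> h * \<phi> \<one>"
  using arg_cong[OF antipode_right[of h, folded sw_def], of \<phi>] by (simp add: lin_scale lin_sw)

text \<open>The same contractions in front of a further leg.\<close>

lemma contract_antipode_left:
  assumes "\<And>c. lin sH (*) (\<lambda>a. F a c)" "\<And>a. lin sH (*) (F a)"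
  shows "D h (\<lambda>a x. D x (\<lambda>b c. F (S a \<cdot> b) c)) = F \<one> h"
proof -
  note [lin] = bil_lin[OF bilI[of _ _ F, OF assms]]
  have "D h (\<lambda>a x. D x (\<lambda>b c. F (S a \<cdot> b) c)) = D h (\<lambda>x c. D x (\<lambda>a b. F (S a \<cdot> b) c))"
    by (rule comult_assoc[symmetric]; intro lin)
  also have "\<dots> = D h (\<lambda>x c. \<epsilon> x * F \<one> c)"
    by (rule sw_eqI, rule comult_antipode_left; intro lin)
  finally show ?thesis by (simp add: comult_counit_left assms)
qed

lemma contract_antipode_right:
  assumes "\<And>c. lin sH (*) (\<lambda>a. F a c)" "\<And>a. lin sH (*) (F a)"
  shows "D h (\<lambda>a x. D x (\<lambda>b c. F (a \<cdot> S b) c)) = F \<one> h"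
proof -
  note [lin] = bil_lin[OF bilI[of _ _ F, OF assms]]
  have "D h (\<lambda>a x. D x (\<lambda>b c. F (a \<cdot> S b) c)) = D h (\<lambda>x c. D x (\<lambda>a b. F (a \<cdot> S b) c))"
    by (rule comult_assoc[symmetric]; intro lin)
  also have "\<dots> = D h (\<lambda>x c. \<epsilon> x * F \<one> c)"
    by (rule sw_eqI, rule comult_antipode_right; intro lin)
  finally show ?thesis by (simp add: comult_counit_left assms)
qed

lemma antipode_unit: "S \<one> = \<one>"
proof (rule eq_by_functionals[OF vector_space_H])
  fix \<phi> assume \<phi>: "lin sH (*) \<phi>"
  note [lin] = lin_compose[OF \<phi>]
  have "D \<one> (\<lambda>a b. \<phi> (S a \<cdot> b)) = \<phi> (S \<one>)"
    by (subst comult_of_unit) (intro lin | simp add: unit_right)+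
  with comult_antipode_left[OF \<phi>, of \<one>] show "\<phi> (S \<one>) = \<phi> \<one>" by (simp add: counit_unit)
qed

text \<open>Both sides of \<open>S(x y) = S y S x\<close> arise from \<open>S(x\<^bsub>(1)\<^esub> y\<^bsub>(1)\<^esub>) x\<^bsub>(2)\<^esub> y\<^bsub>(2)\<^esub> S y\<^bsub>(3)\<^esub> S x\<^bsub>(3)\<^esub>\<close> by
  contracting from the right and from the left.\<close>

lemma antipode_mult: "S (x \<cdot> y) = S y \<cdot> S x"
proof (rule eq_by_functionals[OF vector_space_H])
  fix \<phi> assume \<phi>: "lin sH (*) \<phi>"
  note [lin] = lin_compose[OF \<phi>]
  let ?G = "\<lambda>x1 x2 x3 y1 y2 y3. \<phi> (S (x1 \<cdot> y1) \<cdot> ((x2 \<cdot> y2) \<cdot> (S y3 \<cdot> S x3)))"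
  have "D x (\<lambda>x1 x'. D x' (\<lambda>x2 x3. D y (\<lambda>y1 y'. D y' (\<lambda>y2 y3. ?G x1 x2 x3 y1 y2 y3))))
      = D x (\<lambda>x1 x'. D x' (\<lambda>x2 x3. D y (\<lambda>y1 y'. D y' (\<lambda>y2 y3.
          \<phi> (S (x1 \<cdot> y1) \<cdot> (x2 \<cdot> ((y2 \<cdot> S y3) \<cdot> S x3)))))))"
    by (simp add: mult_assoc)
  also have "\<dots> = D x (\<lambda>x1 x'. D x' (\<lambda>x2 x3. D y (\<lambda>y1 y'. \<epsilon> y' * \<phi> (S (x1 \<cdot> y1) \<cdot> (x2 \<cdot> (\<one> \<cdot> S x3))))))"
    by (rule sw_eqI, rule sw_eqI, rule sw_eqI, rule comult_antipode_right; intro lin)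
  also have "\<dots> = D x (\<lambda>x1 x'. D x' (\<lambda>x2 x3. \<phi> (S (x1 \<cdot> y) \<cdot> (x2 \<cdot> S x3))))"
    unfolding unit_left mult.commute[of "\<epsilon> _"]
    by (rule sw_eqI, rule sw_eqI, rule comult_counit_right; intro lin)
  also have "\<dots> = D x (\<lambda>x1 x'. \<epsilon> x' * \<phi> (S (x1 \<cdot> y) \<cdot> \<one>))"
    by (rule sw_eqI, rule comult_antipode_right; intro lin)
  also have "\<dots> = \<phi> (S (x \<cdot> y))"
    unfolding unit_right mult.commute[of "\<epsilon> _"] by (rule comult_counit_right; intro lin)
  finally have 1: "D x (\<lambda>x1 x'. D x' (\<lambda>x2 x3. D y (\<lambda>y1 y'. D y' (\<lambda>y2 y3. ?G x1 x2 x3 y1 y2 y3))))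
      = \<phi> (S (x \<cdot> y))" .
  have "D x (\<lambda>x1 x'. D x' (\<lambda>x2 x3. D y (\<lambda>y1 y'. D y' (\<lambda>y2 y3. ?G x1 x2 x3 y1 y2 y3))))
      = D x (\<lambda>x' x3. D x' (\<lambda>x1 x2. D y (\<lambda>y1 y'. D y' (\<lambda>y2 y3. ?G x1 x2 x3 y1 y2 y3))))"
    by (rule comult_assoc[symmetric]; intro lin)
  also have "\<dots> = D x (\<lambda>x' x3. D x' (\<lambda>x1 x2. D y (\<lambda>y' y3. D y' (\<lambda>y1 y2. ?G x1 x2 x3 y1 y2 y3))))"
    by (rule sw_eqI, rule sw_eqI, rule comult_assoc[symmetric]; intro lin)
  also have "\<dots> = D x (\<lambda>x' x3. D y (\<lambda>y' y3. D x' (\<lambda>x1 x2. D y' (\<lambda>y1 y2. ?G x1 x2 x3 y1 y2 y3))))"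
    by (rule sw_eqI, rule sw_swap)
  also have "\<dots> = D x (\<lambda>x' x3. D y (\<lambda>y' y3. D (x' \<cdot> y') (\<lambda>a b. \<phi> (S a \<cdot> (b \<cdot> (S y3 \<cdot> S x3))))))"
    by (rule sw_eqI, rule sw_eqI, rule comult_of_mult[symmetric]; intro lin)
  also have "\<dots> = D x (\<lambda>x' x3. D y (\<lambda>y' y3. D (x' \<cdot> y') (\<lambda>a b. \<phi> ((S a \<cdot> b) \<cdot> (S y3 \<cdot> S x3)))))"
    by (simp add: mult_assoc)
  also have "\<dots> = D x (\<lambda>x' x3. D y (\<lambda>y' y3. \<epsilon> (x' \<cdot> y') * \<phi> (\<one> \<cdot> (S y3 \<cdot> S x3))))"
    by (rule sw_eqI, rule sw_eqI, rule comult_antipode_left; intro lin)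
  also have "\<dots> = D x (\<lambda>x' x3. \<epsilon> x' * D y (\<lambda>y' y3. \<epsilon> y' * \<phi> (S y3 \<cdot> S x3)))"
    by (simp add: counit_mult unit_left sw_mult_left mult.assoc)
  also have "\<dots> = D x (\<lambda>x' x3. \<epsilon> x' * \<phi> (S y \<cdot> S x3))"
    by (rule sw_eqI, rule arg_cong[where f = "(*) _"], rule comult_counit_left; intro lin)
  also have "\<dots> = \<phi> (S y \<cdot> S x)"
    by (rule comult_counit_left; intro lin)
  finally show "\<phi> (S (x \<cdot> y)) = \<phi> (S y \<cdot> S x)" using 1 by simp
qed

lemma counit_antipode: "\<epsilon> (S h) = \<epsilon> h"
proof -
  have "\<epsilon> (S h) = D h (\<lambda>a b. \<epsilon> (S a) * \<epsilon> b)"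
    by (rule comult_counit_right[symmetric]; intro lin)
  also have "\<dots> = D h (\<lambda>a b. \<epsilon> (S a \<cdot> b))" by (simp add: counit_mult)
  also have "\<dots> = \<epsilon> h" using comult_antipode_left[OF counit_linear] by (simp add: counit_unit)
  finally show ?thesis .
qed

text \<open>Likewise \<open>\<Delta>(S h) = S h\<^bsub>(2)\<^esub> \<otimes> S h\<^bsub>(1)\<^esub>\<close> from \<open>(S h\<^bsub>(1)\<^esub>)\<^bsub>(1)\<^esub> h\<^bsub>(2)\<^esub> S h\<^bsub>(5)\<^esub> \<otimes> (S h\<^bsub>(1)\<^esub>)\<^bsub>(2)\<^esub> h\<^bsub>(3)\<^esub> S h\<^bsub>(4)\<^esub>\<close>.\<close>

lemma comult_of_antipode:
  assumes "\<And>b. lin sH (*) (\<lambda>a. F a b)" "\<And>a. lin sH (*) (F a)"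
  shows "D (S h) F = D h (\<lambda>a b. F (S b) (S a))"
proof -
  note [lin] = bil_lin[OF bilI[of _ _ F, OF assms]]
  let ?G = "\<lambda>h1 h2 h3 h4 h5. D (S h1) (\<lambda>p q. F (p \<cdot> (h2 \<cdot> S h5)) (q \<cdot> (h3 \<cdot> S h4)))"
  have "D h (\<lambda>h1 y. D y (\<lambda>h2 z. D z (\<lambda>h3 w. D w (\<lambda>h4 h5. ?G h1 h2 h3 h4 h5))))
     = D h (\<lambda>h1 y. D y (\<lambda>h2 z. D (S h1) (\<lambda>p q. F (p \<cdot> (h2 \<cdot> S z)) (q \<cdot> \<one>))))"
    by (rule sw_eqI, rule sw_eqI, rule contract_antipode_right; intro lin)
  also have "\<dots> = D h (\<lambda>h1 y. \<epsilon> y * D (S h1) (\<lambda>p q. F (p \<cdot> \<one>) (q \<cdot> \<one>)))"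
    by (rule sw_eqI, rule comult_antipode_right; intro lin)
  also have "\<dots> = D (S h) F"
    unfolding unit_right mult.commute[of "\<epsilon> _"] by (rule comult_counit_right; intro lin)
  finally have 1: "D h (\<lambda>h1 y. D y (\<lambda>h2 z. D z (\<lambda>h3 w. D w (\<lambda>h4 h5. ?G h1 h2 h3 h4 h5)))) = D (S h) F" .
  have "D h (\<lambda>h1 y. D y (\<lambda>h2 z. D z (\<lambda>h3 w. D w (\<lambda>h4 h5. ?G h1 h2 h3 h4 h5))))
     = D h (\<lambda>h1 y. D y (\<lambda>v w. D v (\<lambda>h2 h3. D w (\<lambda>h4 h5. ?G h1 h2 h3 h4 h5))))"
    by (rule sw_eqI, rule comult_assoc[symmetric]; intro lin)
  also have "\<dots> = D h (\<lambda>u w. D u (\<lambda>h1 v. D v (\<lambda>h2 h3. D w (\<lambda>h4 h5. ?G h1 h2 h3 h4 h5))))"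
    by (rule comult_assoc[symmetric]; intro lin)
  also have "\<dots> = D h (\<lambda>u w. D w (\<lambda>h4 h5. D u (\<lambda>h1 v. D v (\<lambda>h2 h3. ?G h1 h2 h3 h4 h5))))"
    by (subst sw_swap[of "comult H _" "comult H (_::'h)"], rule sw_eqI) (rule sw_swap)
  also have "\<dots> = D h (\<lambda>u w. D w (\<lambda>h4 h5. \<epsilon> u * F (S h5) (S h4)))"
  proof (rule sw_eqI, rule sw_eqI)
    fix u w h4 h5
    have "D u (\<lambda>h1 v. D v (\<lambda>h2 h3. ?G h1 h2 h3 h4 h5))
        = D u (\<lambda>h1 v. D (S h1) (\<lambda>p q. D v (\<lambda>h2 h3. F ((p \<cdot> h2) \<cdot> S h5) ((q \<cdot> h3) \<cdot> S h4))))"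
      unfolding mult_assoc by (rule sw_eqI, rule sw_swap)
    also have "\<dots> = D u (\<lambda>h1 v. D (S h1 \<cdot> v) (\<lambda>p q. F (p \<cdot> S h5) (q \<cdot> S h4)))"
      by (rule sw_eqI, rule comult_of_mult[symmetric]; intro lin)
    also have "\<dots> = \<epsilon> u * D \<one> (\<lambda>p q. F (p \<cdot> S h5) (q \<cdot> S h4))"
      by (rule comult_antipode_left; intro lin)
    also have "D \<one> (\<lambda>p q. F (p \<cdot> S h5) (q \<cdot> S h4)) = F (\<one> \<cdot> S h5) (\<one> \<cdot> S h4)"
      by (rule comult_of_unit; intro lin)
    finally show "D u (\<lambda>h1 v. D v (\<lambda>h2 h3. ?G h1 h2 h3 h4 h5)) = \<epsilon> u * F (S h5) (S h4)"
      by (simp add: unit_left)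
  qed
  also have "\<dots> = D h (\<lambda>u w. \<epsilon> u * D w (\<lambda>a b. F (S b) (S a)))"
    by (simp add: sw_mult_left)
  also have "\<dots> = D h (\<lambda>a b. F (S b) (S a))"
    by (rule comult_counit_left; intro lin)
  finally show ?thesis using 1 by simp
qed

end

section \<open>Crossed modules\<close>

context hopf_algebra
begin

text \<open>\<open>ad h F\<close> is \<open>F(h\<^bsub>(1)\<^esub> S h\<^bsub>(3)\<^esub>, h\<^bsub>(2)\<^esub>)\<close>, the sum over the adjoint coaction.\<close>

abbreviation "ad h \<equiv> sw (coact (regular_crossed H) h)"

lemma ad_sum: "ad h F = D h (\<lambda>a x. D x (\<lambda>b c. F (a \<cdot> S c) b))"
proof -
  have "sw (map (\<lambda>(a, b, c). (a \<cdot> S c, b)) xs) F = (\<Sum>(a, b, c)\<leftarrow>xs. F (a \<cdot> S c) b)" for xs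
    by (induction xs) auto
  then show ?thesis by (simp add: regular_crossed_def comult3_sum)
qed

lemma ad_lin [lin]:
  assumes "linear_on A s sH f" "\<And>b. lin sH (*) (\<lambda>a. F a b)" "\<And>a. lin sH (*) (F a)"
  shows "linear_on A s (*) (\<lambda>x. ad (f x) F)"
proof -
  note [lin] = bil_lin[OF bilI[of _ _ F, OF assms(2,3)]] assms(1)
  show ?thesis unfolding ad_sum by (intro lin)
qed

lemma ad_coassoc:
  assumes "\<And>b c. lin sH (*) (\<lambda>a. F a b c)" "\<And>a c. lin sH (*) (\<lambda>b. F a b c)" "\<And>a b. lin sH (*) (F a b)"
  shows "ad y (\<lambda>x w. D x (\<lambda>a b. F a b w)) = ad y (\<lambda>a x. ad x (\<lambda>b w. F a b w))"
proof -
  note [lin] = tril_lin[OF trilI[of _ _ F, OF assms]]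
  have "ad y (\<lambda>x w. D x (\<lambda>a b. F a b w))
      = D y (\<lambda>y1 u. D u (\<lambda>m y3. D y1 (\<lambda>p q. D (S y3) (\<lambda>r s. F (p \<cdot> r) (q \<cdot> s) m))))"
    unfolding ad_sum by (rule sw_eqI, rule sw_eqI, rule comult_of_mult; intro lin)
  also have "\<dots> = D y (\<lambda>y1 u. D u (\<lambda>m y3. D y1 (\<lambda>p q. D y3 (\<lambda>r s. F (p \<cdot> S s) (q \<cdot> S r) m))))"
    by (rule sw_eqI, rule sw_eqI, rule sw_eqI, rule comult_of_antipode; intro lin)
  also have "\<dots> = D y (\<lambda>y1 u. D y1 (\<lambda>p q. D u (\<lambda>m y3. D y3 (\<lambda>r s. F (p \<cdot> S s) (q \<cdot> S r) m))))"
    by (rule sw_eqI, rule sw_swap)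
  also have "\<dots> = D y (\<lambda>p x. D x (\<lambda>q u. D u (\<lambda>m y3. D y3 (\<lambda>r s. F (p \<cdot> S s) (q \<cdot> S r) m))))"
    by (rule comult_assoc; intro lin)
  also have "\<dots> = D y (\<lambda>p x. D x (\<lambda>q u. D u (\<lambda>v s. D v (\<lambda>m r. F (p \<cdot> S s) (q \<cdot> S r) m))))"
    by (rule sw_eqI, rule sw_eqI, rule comult_assoc[symmetric]; intro lin)
  also have "\<dots> = D y (\<lambda>p x. D x (\<lambda>u s. D u (\<lambda>q v. D v (\<lambda>m r. F (p \<cdot> S s) (q \<cdot> S r) m))))"
    by (rule sw_eqI, rule comult_assoc[symmetric]; intro lin)
  finally show ?thesis unfolding ad_sum .
qed

lemma ad_counit: assumes "lin sH (*) \<phi>" shows "ad y (\<lambda>a w. \<epsilon> a * \<phi> w) = \<phi> y"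
proof -
  note [lin] = lin_compose[OF assms]
  have "ad y (\<lambda>a w. \<epsilon> a * \<phi> w) = D y (\<lambda>a x. \<epsilon> a * D x (\<lambda>b c. \<phi> b * \<epsilon> c))"
    unfolding ad_sum by (simp add: counit_mult counit_antipode sw_mult_left ac_simps)
  also have "\<dots> = D y (\<lambda>a x. \<epsilon> a * \<phi> x)" by (simp add: comult_counit_right assms)
  finally show ?thesis by (simp add: comult_counit_left assms)
qed

text \<open>The compatibility of left multiplication with the adjoint coaction: on the right-hand side
  \<open>S(h\<^bsub>(3)\<^esub> y\<^bsub>(3)\<^esub>) h\<^bsub>(4)\<^esub> = S y\<^bsub>(3)\<^esub> S h\<^bsub>(3)\<^esub> h\<^bsub>(4)\<^esub>\<close> contracts.\<close>

lemma ad_act: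
  assumes "\<And>b. lin sH (*) (\<lambda>a. F a b)" "\<And>a. lin sH (*) (F a)"
  shows "D h (\<lambda>h1 h2. ad y (\<lambda>v w. F (h1 \<cdot> v) (h2 \<cdot> w))) = D h (\<lambda>h1 h2. ad (h1 \<cdot> y) (\<lambda>u w. F (u \<cdot> h2) w))"
proof -
  note [lin] = bil_lin[OF bilI[of _ _ F, OF assms]]
  have "D h (\<lambda>h1 h2. ad (h1 \<cdot> y) (\<lambda>u w. F (u \<cdot> h2) w))
      = D h (\<lambda>h1 h2. D h1 (\<lambda>p q. D y (\<lambda>a x. D (q \<cdot> x) (\<lambda>b c. F (((p \<cdot> a) \<cdot> S c) \<cdot> h2) b))))"
    unfolding ad_sum by (rule sw_eqI, rule comult_of_mult; intro lin)
  also have "\<dots> = D h (\<lambda>p x'. D x' (\<lambda>q h2. D y (\<lambda>a x. D (q \<cdot> x) (\<lambda>b c. F (((p \<cdot> a) \<cdot> S c) \<cdot> h2) b))))"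
    by (rule comult_assoc; intro lin)
  also have "\<dots> = D h (\<lambda>p x'. D y (\<lambda>a x. D x' (\<lambda>q h2. D (q \<cdot> x) (\<lambda>b c. F (((p \<cdot> a) \<cdot> S c) \<cdot> h2) b))))"
    by (rule sw_eqI, rule sw_swap)
  also have "\<dots> = D h (\<lambda>p x'. D y (\<lambda>a x. D x (\<lambda>b c. F (p \<cdot> (a \<cdot> S c)) (x' \<cdot> b))))"
  proof (rule sw_eqI, rule sw_eqI)
    fix p x' a x
    have "D x' (\<lambda>q h2. D (q \<cdot> x) (\<lambda>b c. F (((p \<cdot> a) \<cdot> S c) \<cdot> h2) b))
        = D x' (\<lambda>q h2. D q (\<lambda>r s. D x (\<lambda>b c. F (((p \<cdot> a) \<cdot> S (s \<cdot> c)) \<cdot> h2) (r \<cdot> b))))"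
      by (rule sw_eqI, rule comult_of_mult; intro lin)
    also have "\<dots> = D x' (\<lambda>r z. D z (\<lambda>s h2. D x (\<lambda>b c. F (((p \<cdot> a) \<cdot> S (s \<cdot> c)) \<cdot> h2) (r \<cdot> b))))"
      by (rule comult_assoc; intro lin)
    also have "\<dots> = D x' (\<lambda>r z. D z (\<lambda>s h2. D x (\<lambda>b c. F (((p \<cdot> a) \<cdot> S c) \<cdot> (S s \<cdot> h2)) (r \<cdot> b))))"
      by (simp add: antipode_mult mult_assoc)
    also have "\<dots> = D x' (\<lambda>r z. \<epsilon> z * D x (\<lambda>b c. F (((p \<cdot> a) \<cdot> S c) \<cdot> \<one>) (r \<cdot> b)))"
      by (rule sw_eqI, rule comult_antipode_left; intro lin)
    also have "\<dots> = D x (\<lambda>b c. F (((p \<cdot> a) \<cdot> S c) \<cdot> \<one>) (x' \<cdot> b))"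
      unfolding mult.commute[of "\<epsilon> _"] by (rule comult_counit_right; intro lin)
    finally show "D x' (\<lambda>q h2. D (q \<cdot> x) (\<lambda>b c. F (((p \<cdot> a) \<cdot> S c) \<cdot> h2) b))
        = D x (\<lambda>b c. F (p \<cdot> (a \<cdot> S c)) (x' \<cdot> b))" by (simp add: unit_right mult_assoc)
  qed
  finally show ?thesis by (simp add: ad_sum)
qed

lemma ad_unit:
  assumes "\<And>b. lin sH (*) (\<lambda>a. F a b)" "\<And>a. lin sH (*) (F a)"
  shows "ad \<one> F = F \<one> \<one>"
proof -
  note [lin] = bil_lin[OF bilI[of _ _ F, OF assms]]
  have "ad \<one> F = D \<one> (\<lambda>b c. F (\<one> \<cdot> S c) b)"
    unfolding ad_sum by (rule comult_of_unit; intro lin)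
  also have "\<dots> = F (\<one> \<cdot> S \<one>) \<one>" by (rule comult_of_unit; intro lin)
  finally show ?thesis by (simp add: antipode_unit unit_left)
qed

theorem crossed_module_regular: "crossed_module H (regular_crossed H)"
proof -
  interpret vector_space sH by (rule vector_space_H)
  show ?thesis
  proof (intro crossed_module.intro crossed_module_axioms.intro hopf_algebra_axioms)
    show "vector_space (vscale (regular_crossed H))"
      "module.subspace (vscale (regular_crossed H)) (vcarrier (regular_crossed H))"
      "bilinear_on UNIV (vcarrier (regular_crossed H)) sH (vscale (regular_crossed H))
         (vscale (regular_crossed H)) (act (regular_crossed H))"
      by (simp_all add: regular_crossed_def vector_space_H mult_bilinear)
    show "tensor_linear_on (vcarrier (regular_crossed H)) (vscale (regular_crossed H)) sH
       (vscale (regular_crossed H)) (coact (regular_crossed H))"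
    proof (rule tensor_linear_onI)
      fix \<beta> assume "bil sH (vscale (regular_crossed H)) (*) \<beta>"
      then have \<beta>: "bil sH sH (*) \<beta>" by (simp add: regular_crossed_def)
      note [lin] = bil_lin[OF this]
      have "lin sH (*) (\<lambda>x. ad x \<beta>)" by (intro lin)
      then show "linear_on (vcarrier (regular_crossed H)) (vscale (regular_crossed H)) (*) (\<lambda>x. ad x \<beta>)"
        by (simp add: regular_crossed_def)
    qed
    fix v
    show "tensor3_eq sH sH (vscale (regular_crossed H))
          [(a, b, w). (x, w) \<leftarrow> coact (regular_crossed H) v, (a, b) \<leftarrow> comult H x]
          [(a, b, w). (a, x) \<leftarrow> coact (regular_crossed H) v, (b, w) \<leftarrow> coact (regular_crossed H) x]"
      unfolding tensor3_eq_iff sum_compr_left sum_compr_right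
    proof (intro allI impI)
      fix F assume "tril sH sH (vscale (regular_crossed H)) (*) F"
      then have "tril sH sH sH (*) F" by (simp add: regular_crossed_def)
      note [lin] = tril_lin[OF this]
      show "ad v (\<lambda>x w. D x (\<lambda>a b. F a b w)) = ad v (\<lambda>a x. ad x (\<lambda>b w. F a b w))"
        by (rule ad_coassoc; intro lin)
    qed
    show "(\<Sum>(a, w)\<leftarrow>coact (regular_crossed H) v. vscale (regular_crossed H) (\<epsilon> a) w) = v"
      unfolding sw_def[symmetric]
    proof (rule eq_by_functionals[OF vector_space_H])
      fix \<phi> assume \<phi>: "lin sH (*) \<phi>"
      then show "\<phi> (ad v (\<lambda>a w. vscale (regular_crossed H) (\<epsilon> a) w)) = \<phi> v"
        unfolding lin_sw[OF \<phi>] using ad_counit[OF \<phi>, of v] by (simp add: lin_scale[OF \<phi>] regular_crossed_def)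
    qed
    fix h
    show "tensor_eq sH (vscale (regular_crossed H))
          [(h1 \<cdot> v1, act (regular_crossed H) h2 w). (h1, h2) \<leftarrow> comult H h, (v1, w) \<leftarrow> coact (regular_crossed H) v]
          [(u1 \<cdot> h2, w). (h1, h2) \<leftarrow> comult H h, (u1, w) \<leftarrow> coact (regular_crossed H) (act (regular_crossed H) h1 v)]"
    proof (rule tensor_eqI)
      fix F assume "bil sH (vscale (regular_crossed H)) (*) F"
      then have "bil sH sH (*) F" by (simp add: regular_crossed_def)
      note [lin] = bil_lin[OF this]
      have act: "act (regular_crossed H) = (\<cdot>)" by (simp add: regular_crossed_def)
      show "sw [(h1 \<cdot> v1, act (regular_crossed H) h2 w). (h1, h2) \<leftarrow> comult H h, (v1, w) \<leftarrow> coact (regular_crossed H) v] F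
        = sw [(u1 \<cdot> h2, w). (h1, h2) \<leftarrow> comult H h, (u1, w) \<leftarrow> coact (regular_crossed H) (act (regular_crossed H) h1 v)] F"
        unfolding sw_compr act by (rule ad_act; intro lin)
    qed
  qed (auto simp: regular_crossed_def unit_left mult_assoc)
qed

end

context crossed_module
begin

abbreviation "sV \<equiv> vscale V"

lemma coact_lin_on:
  assumes "bilinear_on UNIV (vcarrier V) sH sV (*) F"
  shows "linear_on (vcarrier V) sV (*) (\<lambda>v. sw (coact V v) F)"
  by (rule tensor_linear_onD[OF coact_linear vector_space_V subspace_V subspace_V vector_space_V coact_closed assms])

lemma coact_coassoc_sum:
  assumes "v \<in> vcarrier V" "tril sH sH sV (*) F"
  shows "sw (coact V v) (\<lambda>x w. D x (\<lambda>a b. F a b w)) = sw (coact V v) (\<lambda>a x. sw (coact V x) (\<lambda>b w. F a b w))"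
  using coact_coassoc[OF assms(1)] assms(2) unfolding tensor3_eq_iff sum_compr_left sum_compr_right by blast

lemma act_coact_sum:
  assumes v: "v \<in> vcarrier V" and F: "bilinear_on UNIV (vcarrier V) sH sV (*) F"
  shows "D h (\<lambda>h1 h2. sw (coact V v) (\<lambda>v1 w. F (h1 \<cdot> v1) (act V h2 w)))
      = D h (\<lambda>h1 h2. sw (coact V (act V h1 v)) (\<lambda>u1 w. F (u1 \<cdot> h2) w))"
proof -
  let ?L = "[(h1 \<cdot> v1, act V h2 w). (h1, h2) \<leftarrow> comult H h, (v1, w) \<leftarrow> coact V v]"
  let ?R = "[(u1 \<cdot> h2, w). (h1, h2) \<leftarrow> comult H h, (u1, w) \<leftarrow> coact V (act V h1 v)]"
  have "set ?L \<subseteq> UNIV \<times> vcarrier V" using coact_closed[OF v] by (force simp: act_closed)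
  moreover have "set ?R \<subseteq> UNIV \<times> vcarrier V" using coact_closed[OF act_closed[OF v]] by force
  ultimately have "sw ?L F = sw ?R F"
    by (rule tensor_eqD_on[OF act_coact[OF v] vector_space_V subspace_V _ _ F])
  then show ?thesis unfolding sw_compr .
qed

lemma act_lin_on: "v \<in> vcarrier V \<Longrightarrow> lin sH sV (\<lambda>h. act V h v)" "linear_on (vcarrier V) sV sV (act V h)"
  using act_bilinear by (auto simp: bilinear_on_def)

text \<open>The coaction restricted to \<open>C\<close> is a choice of representatives, so besides the axioms the two
  properties of this choice are recorded.\<close>

theorem crossed_module_restrict:
  assumes C: "module.subspace sV C" "C \<subseteq> vcarrier V"
    and act_C: "\<And>h v. v \<in> C \<Longrightarrow> act V h v \<in> C"
    and coact_C: "\<And>v. v \<in> C \<Longrightarrow> \<exists>xs. set xs \<subseteq> UNIV \<times> C \<and> tensor_eq sH sV xs (coact V v)"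
  shows "crossed_module H (restrict_crossed H V C)"
    and "v \<in> C \<Longrightarrow> set (coact (restrict_crossed H V C) v) \<subseteq> UNIV \<times> C"
    and "v \<in> C \<Longrightarrow> tensor_eq sH sV (coact (restrict_crossed H V C) v) (coact V v)"
proof -
  let ?W = "restrict_crossed H V C"
  have W: "vscale ?W = sV" "vcarrier ?W = C" "act ?W = act V"
    by (simp_all add: restrict_crossed_def)
  have R: "set (coact ?W v) \<subseteq> UNIV \<times> C \<and> tensor_eq sH sV (coact ?W v) (coact V v)" if "v \<in> C" for v
    unfolding restrict_crossed_def using someI_ex[OF coact_C[OF that]] by simp
  then show "v \<in> C \<Longrightarrow> set (coact ?W v) \<subseteq> UNIV \<times> C"
    "v \<in> C \<Longrightarrow> tensor_eq sH sV (coact ?W v) (coact V v)" by auto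
  have sum: "sw (coact ?W v) F = sw (coact V v) F"
    if "v \<in> C" "bilinear_on UNIV (vcarrier V) sH sV (*) F" for v F
    using R[OF that(1)] C(2) that coact_closed
    by (intro tensor_eqD_on[OF _ vector_space_V subspace_V _ _ that(2)]) auto
  have bil_on: "bilinear_on UNIV (vcarrier V) sH sV (*) F" if "bil sH sV (*) F" for F
    using that by (auto simp: bilinear_on_def linear_on_def)
  interpret V: vector_space sV by (rule vector_space_V)
  show "crossed_module H ?W"
  proof (intro crossed_module.intro crossed_module_axioms.intro hopf_algebra_axioms; unfold W)
    show "bilinear_on UNIV C sH sV sV (act V)"
      using act_bilinear C(2) by (auto simp: bilinear_on_def linear_on_def subset_iff)
    show "tensor_linear_on C sV sH sV (coact ?W)"
    proof (rule tensor_linear_onI)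
      fix \<beta> assume "bil sH sV (*) \<beta>"
      note b = bil_on[OF this]
      show "linear_on C sV (*) (\<lambda>x. sw (coact ?W x) \<beta>)"
        using coact_lin_on[OF b] C(2) V.subspace_add[OF C(1)] V.subspace_scale[OF C(1)]
        by (auto simp: linear_on_def sum[OF _ b] subset_iff)
    qed
    fix v assume v: "v \<in> C"
    show "set (coact ?W v) \<subseteq> UNIV \<times> C" using R[OF v] by simp
    show "tensor3_eq sH sH sV
          [(a, b, w). (x, w) \<leftarrow> coact ?W v, (a, b) \<leftarrow> comult H x]
          [(a, b, w). (a, x) \<leftarrow> coact ?W v, (b, w) \<leftarrow> coact ?W x]"
      unfolding tensor3_eq_iff sum_compr_left sum_compr_right
    proof (intro allI impI)
      fix F assume F: "tril sH sH sV (*) F"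
      note [lin] = tril_lin[OF F]
      have b: "bilinear_on UNIV (vcarrier V) sH sV (*) (F a)" for a
        by (intro bil_on bilI lin)
      have "sw (coact ?W v) (\<lambda>x w. D x (\<lambda>a b. F a b w)) = sw (coact V v) (\<lambda>x w. D x (\<lambda>a b. F a b w))"
        by (intro sum[OF v] bil_on bilI lin)
      also have "\<dots> = sw (coact V v) (\<lambda>a x. sw (coact V x) (F a))"
        using coact_coassoc_sum[OF _ F] v C(2) by auto
      also have "\<dots> = sw (coact ?W v) (\<lambda>a x. sw (coact V x) (F a))"
      proof (rule sum[OF v, symmetric])
        show "bilinear_on UNIV (vcarrier V) sH sV (*) (\<lambda>a x. sw (coact V x) (F a))"
          unfolding bilinear_on_def by (intro conjI ballI coact_lin_on[OF b] lin)
      qed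
      also have "\<dots> = sw (coact ?W v) (\<lambda>a x. sw (coact ?W x) (F a))"
        using R[OF v] by (intro sw_cong) (auto simp: sum[OF _ b] subset_iff)
      finally show "sw (coact ?W v) (\<lambda>x w. D x (\<lambda>a b. F a b w)) = sw (coact ?W v) (\<lambda>a x. sw (coact ?W x) (\<lambda>b w. F a b w))" .
    qed
    show "(\<Sum>(a, w)\<leftarrow>coact ?W v. sV (\<epsilon> a) w) = v"
    proof (rule eq_by_functionals[OF vector_space_V])
      fix \<phi> assume \<phi>: "lin sV (*) \<phi>"
      note [lin] = lin_compose[OF \<phi>]
      have "sw (coact ?W v) (\<lambda>a w. \<epsilon> a * \<phi> w) = sw (coact V v) (\<lambda>a w. \<epsilon> a * \<phi> w)"
        by (intro sum[OF v] bil_on bilI lin)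
      also have "\<dots> = \<phi> (sw (coact V v) (\<lambda>a w. sV (\<epsilon> a) w))"
        by (simp add: lin_sw[OF \<phi>] lin_scale[OF \<phi>])
      also have "\<dots> = \<phi> v" using coact_counit[of v] v C(2) by (simp add: sw_def subset_iff)
      finally show "\<phi> (\<Sum>(a, w)\<leftarrow>coact ?W v. sV (\<epsilon> a) w) = \<phi> v"
        by (simp add: sw_def[symmetric] lin_sw[OF \<phi>] lin_scale[OF \<phi>])
    qed
    fix h
    show "tensor_eq sH sV
          [(h1 \<cdot> v1, act V h2 w). (h1, h2) \<leftarrow> comult H h, (v1, w) \<leftarrow> coact ?W v]
          [(u1 \<cdot> h2, w). (h1, h2) \<leftarrow> comult H h, (u1, w) \<leftarrow> coact ?W (act V h1 v)]"
    proof (rule tensor_eqI, unfold sw_compr)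
      fix F assume F: "bil sH sV (*) F"
      note [lin] = bil_lin[OF F]
      have "D h (\<lambda>h1 h2. sw (coact ?W v) (\<lambda>v1 w. F (h1 \<cdot> v1) (act V h2 w)))
          = D h (\<lambda>h1 h2. sw (coact V v) (\<lambda>v1 w. F (h1 \<cdot> v1) (act V h2 w)))"
      proof (rule sw_eqI, rule sum[OF v])
        fix h1 h2
        show "bilinear_on UNIV (vcarrier V) sH sV (*) (\<lambda>v1 w. F (h1 \<cdot> v1) (act V h2 w))"
          unfolding bilinear_on_def by (intro conjI ballI lin act_lin_on)
      qed
      also have "\<dots> = D h (\<lambda>h1 h2. sw (coact V (act V h1 v)) (\<lambda>u1 w. F (u1 \<cdot> h2) w))"
        using act_coact_sum[OF _ bil_on[OF F]] v C(2) by auto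
      also have "\<dots> = D h (\<lambda>h1 h2. sw (coact ?W (act V h1 v)) (\<lambda>u1 w. F (u1 \<cdot> h2) w))"
        by (intro sw_eqI sum[symmetric] act_C v bil_on bilI lin)
      finally show "D h (\<lambda>h1 h2. sw (coact ?W v) (\<lambda>v1 w. F (h1 \<cdot> v1) (act V h2 w)))
          = D h (\<lambda>h1 h2. sw (coact ?W (act V h1 v)) (\<lambda>u1 w. F (u1 \<cdot> h2) w))" .
    qed
  qed (use C act_C act_unit act_mult vector_space_V in \<open>auto simp: subset_iff\<close>)
qed

end

context hopf_algebra
begin

text \<open>The augmentation ideal.\<close>

abbreviation "K \<equiv> {h. \<epsilon> h = 0}"

lemma ker_counit_crossed_facts:
  shows crossed_module_ker: "crossed_module H (ker_counit_crossed H)"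
    and ker_coact_closed: "v \<in> K \<Longrightarrow> set (coact (ker_counit_crossed H) v) \<subseteq> UNIV \<times> K"
    and ker_coact_eq: "v \<in> K \<Longrightarrow> tensor_eq sH sH (coact (ker_counit_crossed H) v) (coact (regular_crossed H) v)"
proof -
  interpret R: crossed_module H "regular_crossed H" by (rule crossed_module_regular)
  interpret vector_space sH by (rule vector_space_H)
  have R: "vscale (regular_crossed H) = sH" "vcarrier (regular_crossed H) = UNIV" "act (regular_crossed H) = (\<cdot>)"
    by (simp_all add: regular_crossed_def)
  have C: "module.subspace (vscale (regular_crossed H)) K"
    by (auto simp: subspace_def R lin_zero[OF counit_linear] lin_add[OF counit_linear] lin_scale[OF counit_linear])
  have act: "act (regular_crossed H) h v \<in> K" if "v \<in> K" for h v
    using that by (simp add: R counit_mult)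
  have coact: "\<exists>xs. set xs \<subseteq> UNIV \<times> K \<and> tensor_eq sH (vscale (regular_crossed H)) xs (coact (regular_crossed H) v)"
    if v: "v \<in> K" for v
  proof (intro exI conjI)
    \<comment> \<open>Subtracting \<open>\<epsilon>(b) 1\<close> from the second legs changes the sum by \<open>v\<^bsub>(1)\<^esub> S v\<^bsub>(2)\<^esub> \<otimes> 1 = \<epsilon>(v) 1 \<otimes> 1 = 0\<close>.\<close>
    let ?xs = "map (\<lambda>(a, b). (a, b - sH (\<epsilon> b) \<one>)) (coact (regular_crossed H) v)"
    show "set ?xs \<subseteq> UNIV \<times> K"
      by (auto simp: lin_diff[OF counit_linear] lin_scale[OF counit_linear] counit_unit)
    show "tensor_eq sH (vscale (regular_crossed H)) ?xs (coact (regular_crossed H) v)"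
      unfolding R
    proof (rule tensor_eqI)
      fix F assume F: "bil sH sH (*) F"
      note [lin] = bil_lin[OF F]
      have sub: "sw xs (\<lambda>a b. f a b - g a b) = sw xs f - sw xs g" for xs :: "('h \<times> 'h) list" and f g :: "_ \<Rightarrow> _ \<Rightarrow> 'k"
        by (induction xs) auto
      have "ad v (\<lambda>a b. \<epsilon> b * F a \<one>) = D v (\<lambda>a x. D x (\<lambda>b c. \<epsilon> b * F (a \<cdot> S c) \<one>))"
        by (simp add: ad_sum)
      also have "\<dots> = D v (\<lambda>a c. F (a \<cdot> S c) \<one>)"
        by (rule sw_eqI, rule comult_counit_left; intro lin)
      also have "\<dots> = \<epsilon> v * F \<one> \<one>" by (rule comult_antipode_right; intro lin)
      also have "\<dots> = 0" using v by simp
      finally show "sw ?xs F = ad v F"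
        by (simp add: sw_map_prod lin_diff[OF bilD2[OF F]] lin_scale[OF bilD2[OF F]] sub)
    qed
  qed
  note * = R.crossed_module_restrict[of K, folded ker_counit_crossed_def, unfolded R, OF C[unfolded R] subset_UNIV act[unfolded R] coact[unfolded R]]
  show "crossed_module H (ker_counit_crossed H)"
    "v \<in> K \<Longrightarrow> set (coact (ker_counit_crossed H) v) \<subseteq> UNIV \<times> K"
    "v \<in> K \<Longrightarrow> tensor_eq sH sH (coact (ker_counit_crossed H) v) (coact (regular_crossed H) v)"
    using * by blast+
qed

end

section \<open>Convolution algebras and their modules\<close>

text \<open>A right coaction with its legs exchanged.  Together with the opposite coproduct this turns right
  comodules into left comodules, so that left and right actions need only one set of lemmas.\<close>

definition swapl :: "('x \<Rightarrow> ('x \<times> 'h) list) \<Rightarrow> 'x \<Rightarrow> ('h \<times> 'x) list" where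
  "swapl r x = map prod.swap (r x)"

lemma sw_swapl: "sw (swapl r x) F = sw (r x) (\<lambda>a b. F b a)"
  unfolding swapl_def by (induction "r x") (auto simp: sw_def case_prod_unfold o_def)

text \<open>A left comodule \<open>X\<close> over a coalgebra with coproduct \<open>\<Delta>\<close>, with linearity and coassociativity
  stated for test functions.  The counit is not part of the definition.\<close>

definition comodule where
  "comodule sC \<Delta> sX l \<longleftrightarrow>
    (\<forall>F. bil sC sX (*) F \<longrightarrow> lin sX (*) (\<lambda>x. sw (l x) F)) \<and>
    (\<forall>F x. tril sC sC sX (*) F \<longrightarrow>
      sw (l x) (\<lambda>p \<xi>. sw (\<Delta> p) (\<lambda>a b. F a b \<xi>)) = sw (l x) (\<lambda>a y. sw (l y) (\<lambda>b \<xi>. F a b \<xi>)))"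

lemma comodule_lin:
  assumes "comodule sC \<Delta> sX l" "linear_on A r sX g" "\<And>\<xi>. lin sC (*) (\<lambda>a. F a \<xi>)" "\<And>a. lin sX (*) (F a)"
  shows "linear_on A r (*) (\<lambda>x. sw (l (g x)) F)"
proof (rule lin_compose[OF _ assms(2)])
  have "bil sC sX (*) F" using assms(3,4) by (intro bilI)
  with assms(1) show "lin sX (*) (\<lambda>x. sw (l x) F)" by (simp add: comodule_def)
qed

lemma comodule_assoc:
  assumes "comodule sC \<Delta> sX l" "\<And>b c. lin sC (*) (\<lambda>a. F a b c)" "\<And>a c. lin sC (*) (\<lambda>b. F a b c)"
    "\<And>a b. lin sX (*) (F a b)"
  shows "sw (l x) (\<lambda>p \<xi>. sw (\<Delta> p) (\<lambda>a b. F a b \<xi>)) = sw (l x) (\<lambda>a y. sw (l y) (\<lambda>b \<xi>. F a b \<xi>))"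
proof -
  have "tril sC sC sX (*) F" using assms(2-) by (intro trilI)
  with assms(1) show ?thesis by (simp add: comodule_def)
qed

text \<open>The action of functionals \<open>f\<close> on the coalgebra on functionals \<open>\<phi>\<close> on a comodule,
  \<open>(f \<cdot> \<phi>)(x) = f(x\<^bsub>(1)\<^esub>) \<phi>(x\<^bsub>(\<infinity>)\<^esub>)\<close>.  For the coalgebra as a comodule over itself this is the
  convolution product.  The versions with two and three arguments are the same for functionals on
  tensor products with the diagonal coaction, written as multilinear maps.\<close>

definition cact1 :: "('x \<Rightarrow> ('h \<times> 'x) list) \<Rightarrow> ('h \<Rightarrow> 'k::comm_ring_1) \<Rightarrow> ('x \<Rightarrow> 'k) \<Rightarrow> 'x \<Rightarrow> 'k" where
  "cact1 l f \<phi> x = sw (l x) (\<lambda>a \<xi>. f a * \<phi> \<xi>)"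

definition cact2 where
  "cact2 lX lY f \<beta> x y = sw (lX x) (\<lambda>a \<xi>. cact1 lY (f a) (\<beta> \<xi>) y)"

definition cact3 where
  "cact3 lX lY lZ f \<gamma> x y z = sw (lX x) (\<lambda>a \<xi>. cact2 lY lZ (f a) (\<gamma> \<xi>) y z)"

lemma cact1_sw: "cact1 l f (\<lambda>y. sw xs (\<lambda>a b. G a b y)) y = sw xs (\<lambda>a b. cact1 l f (G a b) y)"
  unfolding cact1_def sw_mult_left by (rule sw_swap)

lemma cact1_sw_left: "cact1 l (\<lambda>c. sw xs (\<lambda>a b. f a b c)) \<phi> y = sw xs (\<lambda>a b. cact1 l (f a b) \<phi> y)"
  unfolding cact1_def sw_mult_right by (rule sw_swap)

lemma cact2_sw: "cact2 lX lY f (\<lambda>x y. sw xs (\<lambda>a b. G a b x y)) x y = sw xs (\<lambda>a b. cact2 lX lY f (G a b) x y)"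
  unfolding cact2_def cact1_sw by (rule sw_swap)

lemma cact2_sw_left: "cact2 lX lY (\<lambda>c e. sw xs (\<lambda>a b. f a b c e)) \<beta> x y = sw xs (\<lambda>a b. cact2 lX lY (f a b) \<beta> x y)"
  unfolding cact2_def cact1_sw_left by (rule sw_swap)

lemma cact2_mult_right: "cact2 lX lY f (\<lambda>x y. \<beta> x y * c) x y = cact2 lX lY f \<beta> x y * c"
  unfolding cact2_def cact1_def by (simp add: sw_mult_right mult.assoc)

lemma cact2_mult_left: "cact2 lX lY f (\<lambda>x y. c * \<beta> x y) x y = c * cact2 lX lY f \<beta> x y"
  using cact2_mult_right[of lX lY f \<beta> c] by (simp add: mult.commute)

lemma cact1_lin:
  assumes "comodule sC \<Delta> sX l" "lin sC (*) f" "lin sX (*) \<phi>"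
  shows "lin sX (*) (cact1 l f \<phi>)"
proof -
  note [lin] = comodule_lin[OF assms(1)] lin_compose[OF assms(2)] lin_compose[OF assms(3)]
  show ?thesis unfolding cact1_def[abs_def] by (intro lin)
qed

lemma cact2_bil:
  assumes "comodule sC \<Delta> sX lX" "comodule sC \<Delta>' sY lY" "bil sC sC (*) f" "bil sX sY (*) \<beta>"
  shows "bil sX sY (*) (cact2 lX lY f \<beta>)"
proof -
  note [lin] = comodule_lin[OF assms(1)] comodule_lin[OF assms(2)] bil_lin[OF assms(3)] bil_lin[OF assms(4)]
  show ?thesis unfolding cact2_def[abs_def] cact1_def by (intro bilI lin)
qed

lemma cact3_tril:
  assumes "comodule sC \<Delta> sX lX" "comodule sC \<Delta>' sY lY" "comodule sC \<Delta>'' sZ lZ"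
    "tril sC sC sC (*) f" "tril sX sY sZ (*) \<gamma>"
  shows "tril sX sY sZ (*) (cact3 lX lY lZ f \<gamma>)"
proof -
  note [lin] = comodule_lin[OF assms(1)] comodule_lin[OF assms(2)] comodule_lin[OF assms(3)]
    tril_lin[OF assms(4)] tril_lin[OF assms(5)]
  show ?thesis unfolding cact3_def[abs_def] cact2_def cact1_def by (intro trilI lin)
qed

text \<open>The module laws.  Each is reduced to the one with a factor fewer by coassociativity in the first
  argument.\<close>

lemma cact1_assoc:
  assumes "comodule sC \<Delta> sX l" "lin sC (*) f" "lin sC (*) g" "lin sX (*) \<phi>"
  shows "cact1 l f (cact1 l g \<phi>) = cact1 l (cact1 \<Delta> f g) \<phi>"
proof
  fix x
  note [lin] = lin_compose[OF assms(2)] lin_compose[OF assms(3)] lin_compose[OF assms(4)]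
  have "cact1 l f (cact1 l g \<phi>) x = sw (l x) (\<lambda>a y. sw (l y) (\<lambda>b \<xi>. f a * g b * \<phi> \<xi>))"
    by (simp add: cact1_def sw_mult_left mult.assoc)
  also have "\<dots> = sw (l x) (\<lambda>p \<xi>. sw (\<Delta> p) (\<lambda>a b. f a * g b * \<phi> \<xi>))"
    by (rule comodule_assoc[OF assms(1), symmetric]; intro lin)
  finally show "cact1 l f (cact1 l g \<phi>) x = cact1 l (cact1 \<Delta> f g) \<phi> x"
    by (simp add: cact1_def sw_mult_right)
qed

lemma cact2_assoc:
  assumes "comodule sC \<Delta> sX lX" "comodule sC \<Delta> sY lY" "bil sC sC (*) f" "bil sC sC (*) g" "bil sX sY (*) \<beta>"
  shows "cact2 lX lY f (cact2 lX lY g \<beta>) = cact2 lX lY (cact2 \<Delta> \<Delta> f g) \<beta>"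
proof (intro ext)
  fix x y
  note [lin] = bil_lin[OF assms(3)] bil_lin[OF assms(4)] bil_lin[OF assms(5)]
  have "cact2 lX lY f (cact2 lX lY g \<beta>) x y
      = sw (lX x) (\<lambda>a \<xi>. sw (lX \<xi>) (\<lambda>b \<eta>. cact1 lY (f a) (cact1 lY (g b) (\<beta> \<eta>)) y))"
    by (simp add: cact2_def[abs_def] cact1_sw)
  also have "\<dots> = sw (lX x) (\<lambda>a \<xi>. sw (lX \<xi>) (\<lambda>b \<eta>. cact1 lY (cact1 \<Delta> (f a) (g b)) (\<beta> \<eta>) y))"
    by (simp add: cact1_assoc[OF assms(2) bilD2[OF assms(3)] bilD2[OF assms(4)] bilD2[OF assms(5)]])
  also have "\<dots> = sw (lX x) (\<lambda>p \<eta>. sw (\<Delta> p) (\<lambda>a b. cact1 lY (cact1 \<Delta> (f a) (g b)) (\<beta> \<eta>) y))"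
    by (rule comodule_assoc[OF assms(1), symmetric]; unfold cact1_def; intro lin)
  finally show "cact2 lX lY f (cact2 lX lY g \<beta>) x y = cact2 lX lY (cact2 \<Delta> \<Delta> f g) \<beta> x y"
    by (simp add: cact2_def[abs_def] cact1_sw_left)
qed

lemma cact3_assoc:
  assumes "comodule sC \<Delta> sX lX" "comodule sC \<Delta> sY lY" "comodule sC \<Delta> sZ lZ"
    "tril sC sC sC (*) f" "tril sC sC sC (*) g" "tril sX sY sZ (*) \<gamma>"
  shows "cact3 lX lY lZ f (cact3 lX lY lZ g \<gamma>) = cact3 lX lY lZ (cact3 \<Delta> \<Delta> \<Delta> f g) \<gamma>"
proof (intro ext)
  fix x y z
  note [lin] = tril_lin[OF assms(4)] tril_lin[OF assms(5)] tril_lin[OF assms(6)]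
  have bil: "bil sC sC (*) (f a)" "bil sC sC (*) (g a)" "bil sY sZ (*) (\<gamma> \<xi>)" for a \<xi>
    by (intro bilI lin)+
  have "cact3 lX lY lZ f (cact3 lX lY lZ g \<gamma>) x y z
      = sw (lX x) (\<lambda>a \<xi>. sw (lX \<xi>) (\<lambda>b \<eta>. cact2 lY lZ (f a) (cact2 lY lZ (g b) (\<gamma> \<eta>)) y z))"
    by (simp add: cact3_def[abs_def] cact2_sw)
  also have "\<dots> = sw (lX x) (\<lambda>a \<xi>. sw (lX \<xi>) (\<lambda>b \<eta>. cact2 lY lZ (cact2 \<Delta> \<Delta> (f a) (g b)) (\<gamma> \<eta>) y z))"
    by (simp add: cact2_assoc[OF assms(2,3)] bil)
  also have "\<dots> = sw (lX x) (\<lambda>p \<eta>. sw (\<Delta> p) (\<lambda>a b. cact2 lY lZ (cact2 \<Delta> \<Delta> (f a) (g b)) (\<gamma> \<eta>) y z))"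
    by (rule comodule_assoc[OF assms(1), symmetric]; unfold cact2_def cact1_def; intro lin)
  finally show "cact3 lX lY lZ f (cact3 lX lY lZ g \<gamma>) x y z = cact3 lX lY lZ (cact3 \<Delta> \<Delta> \<Delta> f g) \<gamma> x y z"
    by (simp add: cact3_def[abs_def] cact2_sw_left)
qed

text \<open>Two coactions on \<open>X\<close> that commute, as the two coactions of a bicomodule do.\<close>

definition commuting where
  "commuting sC sX l r \<longleftrightarrow> (\<forall>F x. tril sC sC sX (*) F \<longrightarrow>
      sw (l x) (\<lambda>a \<xi>. sw (r \<xi>) (\<lambda>b \<eta>. F a b \<eta>)) = sw (r x) (\<lambda>b \<xi>. sw (l \<xi>) (\<lambda>a \<eta>. F a b \<eta>)))"

lemma commutingD:
  assumes "commuting sC sX l r" "\<And>b c. lin sC (*) (\<lambda>a. F a b c)" "\<And>a c. lin sC (*) (\<lambda>b. F a b c)"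
    "\<And>a b. lin sX (*) (F a b)"
  shows "sw (l x) (\<lambda>a \<xi>. sw (r \<xi>) (\<lambda>b \<eta>. F a b \<eta>)) = sw (r x) (\<lambda>b \<xi>. sw (l \<xi>) (\<lambda>a \<eta>. F a b \<eta>))"
proof -
  have "tril sC sC sX (*) F" using assms(2-) by (intro trilI)
  with assms(1) show ?thesis by (simp add: commuting_def)
qed

lemma cact1_commute:
  assumes "commuting sC sX l r" "lin sC (*) f" "lin sC (*) g" "lin sX (*) \<phi>"
  shows "cact1 l f (cact1 r g \<phi>) = cact1 r g (cact1 l f \<phi>)"
proof
  fix x
  note [lin] = lin_compose[OF assms(2)] lin_compose[OF assms(3)] lin_compose[OF assms(4)]
  have "cact1 l f (cact1 r g \<phi>) x = sw (l x) (\<lambda>a y. sw (r y) (\<lambda>b \<xi>. f a * (g b * \<phi> \<xi>)))"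
    by (simp add: cact1_def sw_mult_left)
  also have "\<dots> = sw (r x) (\<lambda>b y. sw (l y) (\<lambda>a \<xi>. f a * (g b * \<phi> \<xi>)))"
    by (rule commutingD[OF assms(1)]; intro lin)
  finally show "cact1 l f (cact1 r g \<phi>) x = cact1 r g (cact1 l f \<phi>) x"
    by (simp add: cact1_def sw_mult_left mult.left_commute)
qed

lemma cact2_commute:
  assumes "commuting sC sX lX rX" "commuting sC sY lY rY" "bil sC sC (*) f" "bil sC sC (*) g" "bil sX sY (*) \<beta>"
  shows "cact2 lX lY f (cact2 rX rY g \<beta>) = cact2 rX rY g (cact2 lX lY f \<beta>)"
proof (intro ext)
  fix x y
  note [lin] = bil_lin[OF assms(3)] bil_lin[OF assms(4)] bil_lin[OF assms(5)]
  have "cact2 lX lY f (cact2 rX rY g \<beta>) x y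
      = sw (lX x) (\<lambda>a \<xi>. sw (rX \<xi>) (\<lambda>b \<eta>. cact1 lY (f a) (cact1 rY (g b) (\<beta> \<eta>)) y))"
    by (simp add: cact2_def[abs_def] cact1_sw)
  also have "\<dots> = sw (rX x) (\<lambda>b \<xi>. sw (lX \<xi>) (\<lambda>a \<eta>. cact1 lY (f a) (cact1 rY (g b) (\<beta> \<eta>)) y))"
    by (rule commutingD[OF assms(1)]; unfold cact1_def; intro lin)
  also have "\<dots> = sw (rX x) (\<lambda>b \<xi>. sw (lX \<xi>) (\<lambda>a \<eta>. cact1 rY (g b) (cact1 lY (f a) (\<beta> \<eta>)) y))"
    by (simp add: cact1_commute[OF assms(2) bilD2[OF assms(3)] bilD2[OF assms(4)] bilD2[OF assms(5)]])
  finally show "cact2 lX lY f (cact2 rX rY g \<beta>) x y = cact2 rX rY g (cact2 lX lY f \<beta>) x y"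
    by (simp add: cact2_def[abs_def] cact1_sw)
qed

lemma cact3_commute:
  assumes "commuting sC sX lX rX" "commuting sC sY lY rY" "commuting sC sZ lZ rZ"
    "tril sC sC sC (*) f" "tril sC sC sC (*) g" "tril sX sY sZ (*) \<gamma>"
  shows "cact3 lX lY lZ f (cact3 rX rY rZ g \<gamma>) = cact3 rX rY rZ g (cact3 lX lY lZ f \<gamma>)"
proof (intro ext)
  fix x y z
  note [lin] = tril_lin[OF assms(4)] tril_lin[OF assms(5)] tril_lin[OF assms(6)]
  have bil: "bil sC sC (*) (f a)" "bil sC sC (*) (g a)" "bil sY sZ (*) (\<gamma> \<xi>)" for a \<xi>
    by (intro bilI lin)+
  have "cact3 lX lY lZ f (cact3 rX rY rZ g \<gamma>) x y z
      = sw (lX x) (\<lambda>a \<xi>. sw (rX \<xi>) (\<lambda>b \<eta>. cact2 lY lZ (f a) (cact2 rY rZ (g b) (\<gamma> \<eta>)) y z))"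
    by (simp add: cact3_def[abs_def] cact2_sw)
  also have "\<dots> = sw (rX x) (\<lambda>b \<xi>. sw (lX \<xi>) (\<lambda>a \<eta>. cact2 lY lZ (f a) (cact2 rY rZ (g b) (\<gamma> \<eta>)) y z))"
    by (rule commutingD[OF assms(1)]; unfold cact2_def cact1_def; intro lin)
  also have "\<dots> = sw (rX x) (\<lambda>b \<xi>. sw (lX \<xi>) (\<lambda>a \<eta>. cact2 rY rZ (g b) (cact2 lY lZ (f a) (\<gamma> \<eta>)) y z))"
    by (simp add: cact2_commute[OF assms(2,3)] bil)
  finally show "cact3 lX lY lZ f (cact3 rX rY rZ g \<gamma>) x y z = cact3 rX rY rZ g (cact3 lX lY lZ f \<gamma>) x y z"
    by (simp add: cact3_def[abs_def] cact2_sw)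
qed

lemma cact1_swapl: "cact1 (swapl \<Delta>) f g = cact1 \<Delta> g f"
  by (rule ext) (simp add: cact1_def sw_swapl mult.commute)

lemma cact2_swapl: "cact2 (swapl \<Delta>) (swapl \<Delta>) f g = cact2 \<Delta> \<Delta> g f"
  by (intro ext) (simp add: cact2_def sw_swapl cact1_swapl)

lemma cact3_swapl: "cact3 (swapl \<Delta>) (swapl \<Delta>) (swapl \<Delta>) f g = cact3 \<Delta> \<Delta> \<Delta> g f"
  by (intro ext) (simp add: cact3_def sw_swapl cact2_swapl)

text \<open>Bicomodules over a Hopf algebra; \<open>r\<close> is the right coaction with its legs exchanged, hence a left
  coaction of the opposite coalgebra.\<close>

definition bicomodule where
  "bicomodule H sX l r \<longleftrightarrow> vector_space sX \<and>
    comodule (scale H) (comult H) sX l \<and> comodule (scale H) (swapl (comult H)) sX r \<and>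
    commuting (scale H) sX l r \<and>
    (\<forall>\<phi> x. lin sX (*) \<phi> \<longrightarrow> sw (l x) (\<lambda>a \<xi>. counit H a * \<phi> \<xi>) = \<phi> x) \<and>
    (\<forall>\<phi> x. lin sX (*) \<phi> \<longrightarrow> sw (r x) (\<lambda>a \<xi>. counit H a * \<phi> \<xi>) = \<phi> x)"

context hopf_algebra
begin

text \<open>\<open>conv1\<close>, \<open>conv2\<close>, \<open>conv3\<close> are the convolution products on the duals of \<open>H\<close>, \<open>H \<otimes> H\<close> and
  \<open>H \<otimes> H \<otimes> H\<close>, with units \<open>\<epsilon>\<close>, \<open>eps2\<close> and \<open>\<epsilon> \<otimes> \<epsilon> \<otimes> \<epsilon>\<close>.\<close>

abbreviation "\<Delta> \<equiv> comult H"
abbreviation "\<Delta>r \<equiv> swapl (comult H)"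
abbreviation "conv1 \<equiv> cact1 \<Delta>"
abbreviation "conv2 \<equiv> cact2 \<Delta> \<Delta>"
abbreviation "conv3 \<equiv> cact3 \<Delta> \<Delta> \<Delta>"
abbreviation "eps2 \<equiv> (\<lambda>a b. \<epsilon> a * \<epsilon> b)"
abbreviation "lin1 \<equiv> lin sH ((*) :: 'k \<Rightarrow> 'k \<Rightarrow> 'k)"
abbreviation "bil2 \<equiv> bil sH sH ((*) :: 'k \<Rightarrow> 'k \<Rightarrow> 'k)"
abbreviation "tril3 \<equiv> tril sH sH sH ((*) :: 'k \<Rightarrow> 'k \<Rightarrow> 'k)"

lemma comodule_H: "comodule sH \<Delta> sH \<Delta>"
  unfolding comodule_def
proof (intro conjI allI impI)
  fix F assume "bil2 F"
  note [lin] = bil_lin[OF this]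
  show "lin sH (*) (\<lambda>x. D x F)" by (intro lin)
next
  fix F x assume "tril3 F"
  note [lin] = tril_lin[OF this]
  show "D x (\<lambda>p \<xi>. D p (\<lambda>a b. F a b \<xi>)) = D x (\<lambda>a y. D y (F a))"
    by (rule comult_assoc; intro lin)
qed

lemma bicomodule_H: "bicomodule H sH \<Delta> \<Delta>r"
  unfolding bicomodule_def
proof (intro conjI allI impI vector_space_H comodule_H)
  show "comodule sH \<Delta>r sH \<Delta>r"
    unfolding comodule_def
  proof (intro conjI allI impI; unfold sw_swapl)
    fix F assume "bil2 F"
    note [lin] = bil_lin[OF this]
    show "lin sH (*) (\<lambda>x. D x (\<lambda>a b. F b a))" by (intro lin)
  next
    fix F x assume "tril3 F"
    note [lin] = tril_lin[OF this]
    show "D x (\<lambda>\<xi> p. D p (\<lambda>b a. F a b \<xi>)) = D x (\<lambda>y a. D y (\<lambda>\<xi> b. F a b \<xi>))"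
      by (rule comult_assoc[symmetric]; intro lin)
  qed
  show "commuting sH sH \<Delta> \<Delta>r"
    unfolding commuting_def
  proof (intro allI impI; unfold sw_swapl)
    fix F x assume "tril3 F"
    note [lin] = tril_lin[OF this]
    show "D x (\<lambda>a \<xi>. D \<xi> (\<lambda>\<eta> b. F a b \<eta>)) = D x (\<lambda>\<xi> b. D \<xi> (\<lambda>a \<eta>. F a b \<eta>))"
      by (rule comult_assoc[symmetric]; intro lin)
  qed
  fix \<phi> x assume \<phi>: "lin1 \<phi>"
  show "D x (\<lambda>a \<xi>. \<epsilon> a * \<phi> \<xi>) = \<phi> x" by (rule comult_counit_left[OF \<phi>])
  show "sw (\<Delta>r x) (\<lambda>a \<xi>. \<epsilon> a * \<phi> \<xi>) = \<phi> x"
    unfolding sw_swapl mult.commute[of "\<epsilon> _"] by (rule comult_counit_right[OF \<phi>])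
qed

lemmas conv1_assoc = cact1_assoc[OF comodule_H]
lemmas conv2_assoc = cact2_assoc[OF comodule_H comodule_H]
lemmas conv3_assoc = cact3_assoc[OF comodule_H comodule_H comodule_H]
lemmas conv1_lin = cact1_lin[OF comodule_H]
lemmas conv2_bil = cact2_bil[OF comodule_H comodule_H]
lemmas conv3_tril = cact3_tril[OF comodule_H comodule_H comodule_H]

lemma conv1_unit: "lin1 f \<Longrightarrow> conv1 \<epsilon> f = f" "lin1 f \<Longrightarrow> conv1 f \<epsilon> = f"
  by (auto simp: cact1_def comult_counit_left comult_counit_right)

lemma cact2_counit:
  assumes "bicomodule H sX lX rX" "bicomodule H sY lY rY" "bil sX sY (*) \<beta>"
  shows "cact2 lX lY eps2 \<beta> = \<beta>" "cact2 rX rY eps2 \<beta> = \<beta>"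
  using assms(1,2) bilD1[OF assms(3)] bilD2[OF assms(3)]
  by (auto intro!: ext simp: cact2_def cact1_def bicomodule_def mult.assoc sw_mult_left[symmetric])

lemmas conv2_unit = cact2_counit(1)[OF bicomodule_H bicomodule_H]
  cact2_counit(2)[OF bicomodule_H bicomodule_H, unfolded cact2_swapl]

text \<open>A functional on two of three factors acts on these factors only.\<close>

lemma cact3_counit_right:
  assumes "bicomodule H sZ lZ rZ" "\<And>x y. lin sZ (*) (\<gamma> x y)"
  shows "cact3 lX lY lZ (\<lambda>a b c. f a b * \<epsilon> c) \<gamma> x y z = cact2 lX lY f (\<lambda>x y. \<gamma> x y z) x y"
    "cact3 rX rY rZ (\<lambda>a b c. f a b * \<epsilon> c) \<gamma> x y z = cact2 rX rY f (\<lambda>x y. \<gamma> x y z) x y"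
  using assms by (auto simp: cact3_def cact2_def cact1_def bicomodule_def mult.assoc sw_mult_left[symmetric])

lemma cact3_counit_left:
  assumes "bicomodule H sX lX rX" "\<And>y z. lin sX (*) (\<lambda>x. \<gamma> x y z)"
  shows "cact3 lX lY lZ (\<lambda>a b c. \<epsilon> a * f b c) \<gamma> x y z = cact2 lY lZ f (\<gamma> x) y z"
    "cact3 rX rY rZ (\<lambda>a b c. \<epsilon> a * f b c) \<gamma> x y z = cact2 rY rZ f (\<gamma> x) y z"
proof -
  have swp: "cact3 l l' l'' (\<lambda>a b c. \<epsilon> a * f b c) \<gamma> x y z
     = sw (l' y) (\<lambda>b \<eta>. sw (l'' z) (\<lambda>c \<zeta>. f b c * sw (l x) (\<lambda>a \<xi>. \<epsilon> a * \<gamma> \<xi> \<eta> \<zeta>)))" for l l' l''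
  proof -
    have "cact3 l l' l'' (\<lambda>a b c. \<epsilon> a * f b c) \<gamma> x y z
       = sw (l x) (\<lambda>a \<xi>. sw (l' y) (\<lambda>b \<eta>. sw (l'' z) (\<lambda>c \<zeta>. f b c * (\<epsilon> a * \<gamma> \<xi> \<eta> \<zeta>))))"
      by (simp add: cact3_def cact2_def cact1_def ac_simps)
    also have "\<dots> = sw (l' y) (\<lambda>b \<eta>. sw (l x) (\<lambda>a \<xi>. sw (l'' z) (\<lambda>c \<zeta>. f b c * (\<epsilon> a * \<gamma> \<xi> \<eta> \<zeta>))))"
      by (rule sw_swap)
    also have "\<dots> = sw (l' y) (\<lambda>b \<eta>. sw (l'' z) (\<lambda>c \<zeta>. sw (l x) (\<lambda>a \<xi>. f b c * (\<epsilon> a * \<gamma> \<xi> \<eta> \<zeta>))))"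
      by (rule sw_eqI, rule sw_swap)
    finally show ?thesis by (simp add: sw_mult_left)
  qed
  show "cact3 lX lY lZ (\<lambda>a b c. \<epsilon> a * f b c) \<gamma> x y z = cact2 lY lZ f (\<gamma> x) y z"
    "cact3 rX rY rZ (\<lambda>a b c. \<epsilon> a * f b c) \<gamma> x y z = cact2 rY rZ f (\<gamma> x) y z"
    using assms unfolding swp by (auto simp: bicomodule_def cact2_def cact1_def)
qed

text \<open>A map \<open>m : X \<otimes> Y \<rightarrow> Z\<close> that respects the coactions, where \<open>X \<otimes> Y\<close> carries the diagonal one.\<close>

definition colinear where
  "colinear sZ lX lY lZ m \<longleftrightarrow> (\<forall>F x y. bil sH sZ ((*) :: 'k \<Rightarrow> 'k \<Rightarrow> 'k) F \<longrightarrow>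
    sw (lZ (m x y)) F = sw (lX x) (\<lambda>a \<xi>. sw (lY y) (\<lambda>c \<eta>. F (a \<cdot> c) (m \<xi> \<eta>))))"

lemma colinear_cact1:
  assumes "colinear sZ lX lY lZ m" "lin1 f" "lin sZ (*) \<phi>"
  shows "cact1 lZ f \<phi> (m x y) = cact2 lX lY (\<lambda>a c. f (a \<cdot> c)) (\<lambda>\<xi> \<eta>. \<phi> (m \<xi> \<eta>)) x y"
proof -
  note [lin] = lin_compose[OF assms(2)] lin_compose[OF assms(3)]
  have "bil sH sZ (*) (\<lambda>a \<xi>. f a * \<phi> \<xi>)" by (intro bilI lin)
  with assms(1) show ?thesis by (simp add: colinear_def cact1_def cact2_def)
qed

text \<open>Acting on a functional evaluated at \<open>m(x \<otimes> y)\<close> is acting on three factors, with the functional on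
  the coalgebra pulled back along the product of \<open>H\<close>.\<close>

lemma colinear_first:
  assumes "colinear sZ lX lY lZ m" "comodule sH \<Delta>' sW lW" "bil2 f" "bil sZ sW (*) \<beta>"
  shows "cact2 lZ lW f \<beta> (m x y) w
    = cact3 lX lY lW (\<lambda>a b c. f (a \<cdot> b) c) (\<lambda>\<xi> \<eta> \<omega>. \<beta> (m \<xi> \<eta>) \<omega>) x y w"
proof -
  note [lin] = bil_lin[OF assms(3)] bil_lin[OF assms(4)]
  have "bil sH sZ (*) (\<lambda>a \<xi>. cact1 lW (f a) (\<beta> \<xi>) w)" unfolding cact1_def by (intro bilI lin)
  with assms(1) show ?thesis by (simp add: colinear_def cact2_def cact3_def)
qed

lemma colinear_second:
  assumes "colinear sZ lX lY lZ m" "bil2 f" "bil sW sZ (*) \<beta>"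
  shows "cact2 lW lZ f \<beta> w (m x y)
    = cact3 lW lX lY (\<lambda>a b c. f a (b \<cdot> c)) (\<lambda>\<omega> \<xi> \<eta>. \<beta> \<omega> (m \<xi> \<eta>)) w x y"
  unfolding cact2_def[of lW] cact3_def
  by (simp add: colinear_cact1[OF assms(1) bilD2[OF assms(2)] bilD2[OF assms(3)]])

lemma colinear_mult: "colinear sH \<Delta> \<Delta> \<Delta> (\<cdot>)"
  and colinear_mult_right: "colinear sH \<Delta>r \<Delta>r \<Delta>r (\<cdot>)"
proof -
  have *: "D (x \<cdot> y) F = D x (\<lambda>a \<xi>. D y (\<lambda>c \<eta>. F (a \<cdot> c) (\<xi> \<cdot> \<eta>)))"
    "D (x \<cdot> y) (\<lambda>a b. F b a) = D x (\<lambda>\<xi> a. D y (\<lambda>\<eta> c. F (a \<cdot> c) (\<xi> \<cdot> \<eta>)))" if "bil2 F" for F x y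
  proof -
    note [lin] = bil_lin[OF that]
    show "D (x \<cdot> y) F = D x (\<lambda>a \<xi>. D y (\<lambda>c \<eta>. F (a \<cdot> c) (\<xi> \<cdot> \<eta>)))"
      "D (x \<cdot> y) (\<lambda>a b. F b a) = D x (\<lambda>\<xi> a. D y (\<lambda>\<eta> c. F (a \<cdot> c) (\<xi> \<cdot> \<eta>)))"
      by (rule comult_of_mult; intro lin)+
  qed
  then show "colinear sH \<Delta> \<Delta> \<Delta> (\<cdot>)" "colinear sH \<Delta>r \<Delta>r \<Delta>r (\<cdot>)"
    by (simp_all add: colinear_def sw_swapl)
qed

end

section \<open>Cocycles\<close>

text \<open>A unital 2-cocycle \<open>\<chi>\<close> together with its convolution inverse \<open>\<chi>'\<close>.\<close>

locale cocycle_twist = hopf_algebra H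
  for H :: "('k::field, 'h::ab_group_add) hopf" (structure) +
  fixes \<chi> \<chi>' :: "'h \<Rightarrow> 'h \<Rightarrow> 'k"
  assumes \<chi>_bil: "bil2 \<chi>" and \<chi>'_bil: "bil2 \<chi>'"
    and \<chi>_\<chi>': "conv2 \<chi> \<chi>' = eps2" and \<chi>'_\<chi>: "conv2 \<chi>' \<chi> = eps2"
    and cocycle: "D g (\<lambda>g1 g2. D f (\<lambda>f1 f2. \<chi> g1 f1 * \<chi> h (g2 \<cdot> f2)))
        = D h (\<lambda>h1 h2. D g (\<lambda>g1 g2. \<chi> h1 g1 * \<chi> (h2 \<cdot> g2) f))"
    and \<chi>_unit_left: "\<chi> \<one> h = \<epsilon> h"
begin

lemmas \<chi>_lin [lin] = bil_lin[OF \<chi>_bil] bil_lin[OF \<chi>'_bil]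

lemma \<chi>'_unit_left: "\<chi>' \<one> h = \<epsilon> h"
proof -
  have "\<epsilon> h = conv2 \<chi> \<chi>' \<one> h" by (simp add: \<chi>_\<chi>' counit_unit)
  also have "\<dots> = cact1 \<Delta> (\<chi> \<one>) (\<chi>' \<one>) h"
    unfolding cact2_def by (rule comult_of_unit; unfold cact1_def; intro lin)
  also have "\<dots> = \<chi>' \<one> h"
    unfolding cact1_def \<chi>_unit_left by (rule comult_counit_left; intro lin)
  finally show ?thesis by simp
qed

lemma \<chi>_\<chi>'_unit_right: "conv1 (\<lambda>h. \<chi> h \<one>) (\<lambda>h. \<chi>' h \<one>) = \<epsilon>" "conv1 (\<lambda>h. \<chi>' h \<one>) (\<lambda>h. \<chi> h \<one>) = \<epsilon>"
proof (rule_tac [!] ext)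
  fix h
  have *: "conv2 f g h \<one> = conv1 (\<lambda>h. f h \<one>) (\<lambda>h. g h \<one>) h" if "bil2 f" "bil2 g" for f g
  proof -
    note [lin] = bil_lin[OF that(1)] bil_lin[OF that(2)]
    show ?thesis unfolding cact2_def cact1_def by (rule sw_eqI, rule comult_of_unit; intro lin)
  qed
  show "conv1 (\<lambda>h. \<chi> h \<one>) (\<lambda>h. \<chi>' h \<one>) h = \<epsilon> h" "conv1 (\<lambda>h. \<chi>' h \<one>) (\<lambda>h. \<chi> h \<one>) h = \<epsilon> h"
    using *[OF \<chi>_bil \<chi>'_bil] *[OF \<chi>'_bil \<chi>_bil] by (simp_all add: \<chi>_\<chi>' \<chi>'_\<chi> counit_unit)
qed

lemma \<chi>_unit_right: "\<chi> h \<one> = \<epsilon> h"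
proof -
  let ?f = "\<lambda>h. \<chi> h \<one>" and ?f' = "\<lambda>h. \<chi>' h \<one>"
  have f: "lin1 ?f" "lin1 ?f'" by (intro lin)+
  \<comment> \<open>The cocycle condition at \<open>h \<otimes> 1 \<otimes> 1\<close> says that \<open>\<chi>(- \<otimes> 1)\<close> is idempotent.\<close>
  have "conv1 ?f ?f = ?f"
  proof
    fix h
    have "conv1 ?f ?f h = D h (\<lambda>h1 h2. D \<one> (\<lambda>g1 g2. \<chi> h1 g1 * \<chi> (h2 \<cdot> g2) \<one>))"
    proof -
      have "D \<one> (\<lambda>g1 g2. \<chi> h1 g1 * \<chi> (h2 \<cdot> g2) \<one>) = \<chi> h1 \<one> * \<chi> (h2 \<cdot> \<one>) \<one>" for h1 h2
        by (rule comult_of_unit; intro lin)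
      then show ?thesis by (simp add: cact1_def unit_right)
    qed
    also have "\<dots> = D \<one> (\<lambda>g1 g2. D \<one> (\<lambda>f1 f2. \<chi> g1 f1 * \<chi> h (g2 \<cdot> f2)))"
      by (rule cocycle[symmetric])
    also have "\<dots> = D \<one> (\<lambda>f1 f2. \<chi> \<one> f1 * \<chi> h (\<one> \<cdot> f2))"
      by (rule comult_of_unit; intro lin)
    also have "\<dots> = \<chi> \<one> \<one> * \<chi> h (\<one> \<cdot> \<one>)"
      by (rule comult_of_unit; intro lin)
    finally show "conv1 ?f ?f h = \<chi> h \<one>" by (simp add: \<chi>_unit_left counit_unit unit_right)
  qed
  then have "conv1 ?f' (conv1 ?f ?f) = conv1 ?f' ?f" by simp
  then have "?f = \<epsilon>"
    unfolding conv1_assoc[OF f(2) f(1) f(1)] \<chi>_\<chi>'_unit_right conv1_unit(1)[OF f(1)] .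
  then show ?thesis by (rule fun_cong)
qed

lemma \<chi>'_unit_right: "\<chi>' h \<one> = \<epsilon> h"
proof -
  have "lin1 (\<lambda>h. \<chi>' h \<one>)" by (intro lin)
  then have "conv1 \<epsilon> (\<lambda>h. \<chi>' h \<one>) = (\<lambda>h. \<chi>' h \<one>)" by (rule conv1_unit(1))
  moreover have "conv1 \<epsilon> (\<lambda>h. \<chi>' h \<one>) = \<epsilon>"
    using \<chi>_\<chi>'_unit_right(1) unfolding \<chi>_unit_right .
  ultimately show ?thesis by (simp add: fun_eq_iff)
qed

text \<open>The four ways to obtain a functional on \<open>H \<otimes> H \<otimes> H\<close> from one on \<open>H \<otimes> H\<close>.  All are homomorphisms of
  convolution algebras (\<open>conv3_in\<close>), so they map \<open>\<chi>\<close> to invertible elements.\<close>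

abbreviation (input) "in12 f \<equiv> (\<lambda>a b c. f a b * \<epsilon> c)"
abbreviation (input) "in23 f \<equiv> (\<lambda>a b c. \<epsilon> a * f b c)"
abbreviation (input) "join12 f \<equiv> (\<lambda>a b c. f (a \<cdot> b) c)"
abbreviation (input) "join23 f \<equiv> (\<lambda>a b c. f a (b \<cdot> c))"
abbreviation (input) "eps3 \<equiv> (\<lambda>a b c. \<epsilon> a * \<epsilon> b * \<epsilon> c)"

lemma tril_in:
  assumes "bil2 f"
  shows "tril3 (in12 f)" "tril3 (in23 f)" "tril3 (join12 f)" "tril3 (join23 f)"
proof -
  note [lin] = bil_lin[OF assms]
  show "tril3 (in12 f)" "tril3 (in23 f)" "tril3 (join12 f)" "tril3 (join23 f)"
    by (intro trilI lin)+
qed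

lemmas \<chi>_tril = tril_in[OF \<chi>_bil] tril_in[OF \<chi>'_bil]

lemma conv3_in:
  assumes "bil2 f" "bil2 g"
  shows "conv3 (in12 f) (in12 g) = in12 (conv2 f g)" "conv3 (in23 f) (in23 g) = in23 (conv2 f g)"
    "conv3 (join12 f) (join12 g) = join12 (conv2 f g)" "conv3 (join23 f) (join23 g) = join23 (conv2 f g)"
proof -
  note [lin] = bil_lin[OF assms(1)] bil_lin[OF assms(2)]
  show "conv3 (in12 f) (in12 g) = in12 (conv2 f g)"
  proof (intro ext)
    fix a b c
    have "conv3 (in12 f) (in12 g) a b c = conv2 f (\<lambda>a b. g a b * \<epsilon> c) a b"
      by (rule cact3_counit_right(1)[OF bicomodule_H]; intro lin)
    then show "conv3 (in12 f) (in12 g) a b c = conv2 f g a b * \<epsilon> c" by (simp only: cact2_mult_right)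
  qed
  show "conv3 (in23 f) (in23 g) = in23 (conv2 f g)"
  proof (intro ext)
    fix a b c
    have "conv3 (in23 f) (in23 g) a b c = conv2 f (\<lambda>b c. \<epsilon> a * g b c) b c"
      by (rule cact3_counit_left(1)[OF bicomodule_H]; intro lin)
    then show "conv3 (in23 f) (in23 g) a b c = \<epsilon> a * conv2 f g b c" by (simp only: cact2_mult_left)
  qed
  show "conv3 (join12 f) (join12 g) = join12 (conv2 f g)"
    by (intro ext) (rule colinear_first[OF colinear_mult comodule_H assms, symmetric])
  show "conv3 (join23 f) (join23 g) = join23 (conv2 f g)"
    by (intro ext) (rule colinear_second[OF colinear_mult assms, symmetric])
qed

lemma conv3_inverse:
  "conv3 (in12 \<chi>) (in12 \<chi>') = eps3" "conv3 (in12 \<chi>') (in12 \<chi>) = eps3"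
  "conv3 (in23 \<chi>) (in23 \<chi>') = eps3" "conv3 (in23 \<chi>') (in23 \<chi>) = eps3"
  "conv3 (join12 \<chi>) (join12 \<chi>') = eps3" "conv3 (join12 \<chi>') (join12 \<chi>) = eps3"
  "conv3 (join23 \<chi>) (join23 \<chi>') = eps3" "conv3 (join23 \<chi>') (join23 \<chi>) = eps3"
  using conv3_in[OF \<chi>_bil \<chi>'_bil] conv3_in[OF \<chi>'_bil \<chi>_bil]
  by (simp_all only: \<chi>_\<chi>' \<chi>'_\<chi> counit_mult mult.assoc)

lemma conv3_unit: assumes "tril3 f" shows "conv3 eps3 f = f" "conv3 f eps3 = f"
proof -
  note [lin] = tril_lin[OF assms]
  have bil: "bil2 (\<lambda>a b. f a b c)" for c by (intro bilI lin)
  show "conv3 eps3 f = f"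
  proof (intro ext)
    fix a b c
    have "conv3 eps3 f a b c = conv2 eps2 (\<lambda>a b. f a b c) a b"
      by (rule cact3_counit_right(1)[OF bicomodule_H]; intro lin)
    also have "\<dots> = f a b c"
      by (simp only: conv2_unit(1)[OF bil])
    finally show "conv3 eps3 f a b c = f a b c" .
  qed
  show "conv3 f eps3 = f"
  proof (intro ext)
    fix a b c
    have "conv3 f eps3 a b c = cact3 \<Delta>r \<Delta>r \<Delta>r eps3 f a b c"
      unfolding cact3_swapl ..
    also have "\<dots> = cact2 \<Delta>r \<Delta>r eps2 (\<lambda>a b. f a b c) a b"
      by (rule cact3_counit_right(2)[OF bicomodule_H]; intro lin)
    also have "\<dots> = f a b c"
      by (simp only: cact2_swapl conv2_unit(2)[OF bil])
    finally show "conv3 f eps3 a b c = f a b c" .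
  qed
qed

lemma cocycle3: "conv3 (in12 \<chi>) (join12 \<chi>) = conv3 (in23 \<chi>) (join23 \<chi>)"
proof (intro ext)
  fix h g f
  have "conv3 (in12 \<chi>) (join12 \<chi>) h g f = conv2 \<chi> (\<lambda>h g. \<chi> (h \<cdot> g) f) h g"
    by (rule cact3_counit_right(1)[OF bicomodule_H]; intro lin)
  also have "\<dots> = conv2 \<chi> (\<lambda>g f. \<chi> h (g \<cdot> f)) g f"
    using cocycle[of g f h] by (simp add: cact2_def cact1_def)
  also have "\<dots> = conv3 (in23 \<chi>) (join23 \<chi>) h g f"
    by (rule cact3_counit_left(1)[OF bicomodule_H, symmetric]; intro lin)
  finally show "conv3 (in12 \<chi>) (join12 \<chi>) h g f = conv3 (in23 \<chi>) (join23 \<chi>) h g f" .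
qed

lemmas conv3_assoc_right = conv3_assoc[symmetric]

lemma conv3_cancel:
  assumes "tril3 g"
  shows "conv3 (in12 \<chi>) (conv3 (in12 \<chi>') g) = g" "conv3 (in12 \<chi>') (conv3 (in12 \<chi>) g) = g"
    "conv3 (in23 \<chi>) (conv3 (in23 \<chi>') g) = g" "conv3 (in23 \<chi>') (conv3 (in23 \<chi>) g) = g"
    "conv3 (join12 \<chi>) (conv3 (join12 \<chi>') g) = g" "conv3 (join12 \<chi>') (conv3 (join12 \<chi>) g) = g"
    "conv3 (join23 \<chi>) (conv3 (join23 \<chi>') g) = g" "conv3 (join23 \<chi>') (conv3 (join23 \<chi>) g) = g"
  by (simp_all only: conv3_assoc \<chi>_tril assms conv3_inverse conv3_unit)

lemma cocycle3_inverse: "conv3 (join12 \<chi>') (in12 \<chi>') = conv3 (join23 \<chi>') (in23 \<chi>')" (is "?P = ?Q")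
proof -
  note t = \<chi>_tril conv3_tril
  have "conv3 (conv3 (in23 \<chi>) (join23 \<chi>)) ?Q = eps3"
    by (simp only: conv3_assoc_right t conv3_cancel conv3_inverse)
  then have "?P = conv3 ?P (conv3 (conv3 (in12 \<chi>) (join12 \<chi>)) ?Q)"
    by (simp only: cocycle3 conv3_unit t)
  also have "\<dots> = ?Q"
    by (simp only: conv3_assoc_right t conv3_cancel)
  finally show ?thesis .
qed

lemma cocycle3_mixed:
  "conv3 (join23 \<chi>) (join12 \<chi>') = conv3 (in23 \<chi>') (in12 \<chi>)"
  "join12 \<chi>' = conv3 (join23 \<chi>') (conv3 (in23 \<chi>') (in12 \<chi>))"
  "conv3 (join12 \<chi>') (conv3 (in12 \<chi>') (in23 \<chi>)) = join23 \<chi>'"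
proof -
  note t = \<chi>_tril conv3_tril
  have "conv3 (join23 \<chi>) (join12 \<chi>')
      = conv3 (in23 \<chi>') (conv3 (conv3 (in23 \<chi>) (join23 \<chi>)) (join12 \<chi>'))"
    by (simp only: conv3_assoc_right t conv3_cancel)
  also have "\<dots> = conv3 (in23 \<chi>') (in12 \<chi>)"
    unfolding cocycle3[symmetric] by (simp only: conv3_assoc_right t conv3_inverse conv3_unit)
  finally show "conv3 (join23 \<chi>) (join12 \<chi>') = conv3 (in23 \<chi>') (in12 \<chi>)" .
  have "join12 \<chi>' = conv3 (conv3 (join12 \<chi>') (in12 \<chi>')) (in12 \<chi>)"
    by (simp only: conv3_assoc_right t conv3_inverse conv3_unit)
  also have "\<dots> = conv3 (join23 \<chi>') (conv3 (in23 \<chi>') (in12 \<chi>))"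
    unfolding cocycle3_inverse by (simp only: conv3_assoc_right t)
  finally show "join12 \<chi>' = conv3 (join23 \<chi>') (conv3 (in23 \<chi>') (in12 \<chi>))" .
  have "conv3 (join12 \<chi>') (conv3 (in12 \<chi>') (in23 \<chi>))
      = conv3 (conv3 (join12 \<chi>') (in12 \<chi>')) (in23 \<chi>)"
    by (simp only: conv3_assoc_right t)
  also have "\<dots> = join23 \<chi>'"
    unfolding cocycle3_inverse by (simp only: conv3_assoc_right t conv3_inverse conv3_unit)
  finally show "conv3 (join12 \<chi>') (conv3 (in12 \<chi>') (in23 \<chi>)) = join23 \<chi>'" .
qed

section \<open>The functional \<open>U\<close>\<close>

text \<open>\<open>\<beta>(h\<^bsub>(1)\<^esub> \<otimes> S h\<^bsub>(3)\<^esub>) \<phi>(h\<^bsub>(2)\<^esub>)\<close>; since \<open>S\<close> reverses coproducts this is an action of the convolution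
  algebra of \<open>H \<otimes> H\<close> on the functionals on \<open>H\<close> (\<open>wrap_wrap\<close>).\<close>

definition wrap :: "('h \<Rightarrow> 'h \<Rightarrow> 'k) \<Rightarrow> ('h \<Rightarrow> 'k) \<Rightarrow> 'h \<Rightarrow> 'k" where
  "wrap \<beta> \<phi> h = D h (\<lambda>a x. D x (\<lambda>m b. \<beta> a (S b) * \<phi> m))"

text \<open>\<open>\<omega>(h\<^bsub>(1)\<^esub> \<otimes> S h\<^bsub>(3)\<^esub> \<otimes> h\<^bsub>(4)\<^esub>) \<phi>(h\<^bsub>(2)\<^esub>)\<close>.\<close>

definition wrap3 :: "('h \<Rightarrow> 'h \<Rightarrow> 'h \<Rightarrow> 'k) \<Rightarrow> ('h \<Rightarrow> 'k) \<Rightarrow> 'h \<Rightarrow> 'k" where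
  "wrap3 \<omega> \<phi> h = D h (\<lambda>a x. D x (\<lambda>m y. D y (\<lambda>b c. \<omega> a (S b) c * \<phi> m)))"

text \<open>\<open>\<beta>(S h\<^bsub>(1)\<^esub> \<otimes> h\<^bsub>(2)\<^esub>)\<close>.\<close>

definition antipair :: "('h \<Rightarrow> 'h \<Rightarrow> 'k) \<Rightarrow> 'h \<Rightarrow> 'k" where
  "antipair \<beta> h = D h (\<lambda>a b. \<beta> (S a) b)"

text \<open>\<open>U(h) = \<chi>(h\<^bsub>(1)\<^esub> \<otimes> S h\<^bsub>(2)\<^esub>)\<close>, and its inverse \<open>U'(h) = \<chi>\<inverse>(S h\<^bsub>(1)\<^esub> \<otimes> h\<^bsub>(2)\<^esub>)\<close>.\<close>

definition "U = wrap \<chi> \<epsilon>"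
definition "U' = antipair \<chi>'"

lemma wrap_lin: assumes "bil2 \<beta>" "lin1 \<phi>" shows "lin1 (wrap \<beta> \<phi>)"
proof -
  note [lin] = bil_lin[OF assms(1)] lin_compose[OF assms(2)]
  show ?thesis unfolding wrap_def[abs_def] by (intro lin)
qed

lemma antipair_lin: assumes "bil2 \<beta>" shows "lin1 (antipair \<beta>)"
proof -
  note [lin] = bil_lin[OF assms(1)]
  show ?thesis unfolding antipair_def[abs_def] by (intro lin)
qed

lemma U_lin: "lin1 U" and U'_lin: "lin1 U'"
  unfolding U_def U'_def by (intro wrap_lin antipair_lin \<chi>_bil \<chi>'_bil counit_linear)+

lemma wrap_counit: assumes "bil2 \<beta>" shows "wrap \<beta> \<epsilon> h = D h (\<lambda>a b. \<beta> a (S b))"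
proof -
  note [lin] = bil_lin[OF assms(1)]
  show ?thesis unfolding wrap_def mult.commute[of _ "\<epsilon> _"]
    by (rule sw_eqI, rule comult_counit_left; intro lin)
qed

lemma wrap_eps2: assumes "lin1 \<phi>" shows "wrap eps2 \<phi> = \<phi>"
proof
  fix h
  note [lin] = lin_compose[OF assms(1)]
  have "wrap eps2 \<phi> h = D h (\<lambda>a x. \<epsilon> a * D x (\<lambda>m b. \<phi> m * \<epsilon> b))"
    by (simp add: wrap_def counit_antipode sw_mult_left ac_simps)
  then show "wrap eps2 \<phi> h = \<phi> h" by (simp add: comult_counit_right comult_counit_left assms)
qed

lemma wrap_wrap:
  assumes "bil2 \<beta>" "bil2 \<gamma>" "lin1 \<phi>"
  shows "wrap \<beta> (wrap \<gamma> \<phi>) = wrap (conv2 \<beta> \<gamma>) \<phi>"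
proof
  fix h
  note [lin] = bil_lin[OF assms(1)] bil_lin[OF assms(2)] lin_compose[OF assms(3)]
  let ?G = "\<lambda>a1 a2 m u v. \<beta> a1 (S v) * \<gamma> a2 (S u) * \<phi> m"
  have "wrap \<beta> (wrap \<gamma> \<phi>) h = D h (\<lambda>a1 x. D x (\<lambda>w v. D w (\<lambda>a2 y. D y (\<lambda>m u. ?G a1 a2 m u v))))"
    by (simp add: wrap_def sw_mult_left ac_simps)
  also have "\<dots> = D h (\<lambda>a1 x. D x (\<lambda>a2 z. D z (\<lambda>y v. D y (\<lambda>m u. ?G a1 a2 m u v))))"
    by (rule sw_eqI, rule comult_assoc; intro lin)
  also have "\<dots> = D h (\<lambda>a z. D a (\<lambda>a1 a2. D z (\<lambda>y v. D y (\<lambda>m u. ?G a1 a2 m u v))))"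
    by (rule comult_assoc[symmetric]; intro lin)
  also have "\<dots> = D h (\<lambda>a z. D a (\<lambda>a1 a2. D z (\<lambda>m b. D b (\<lambda>u v. ?G a1 a2 m u v))))"
    by (rule sw_eqI, rule sw_eqI, rule comult_assoc; intro lin)
  also have "\<dots> = D h (\<lambda>a z. D z (\<lambda>m b. D a (\<lambda>a1 a2. D b (\<lambda>u v. ?G a1 a2 m u v))))"
    by (rule sw_eqI, rule sw_swap)
  also have "\<dots> = D h (\<lambda>a z. D z (\<lambda>m b. D a (\<lambda>a1 a2. D (S b) (\<lambda>v u. \<beta> a1 v * \<gamma> a2 u * \<phi> m))))"
    by (rule sw_eqI, rule sw_eqI, rule sw_eqI, rule comult_of_antipode[symmetric]; intro lin)
  finally show "wrap \<beta> (wrap \<gamma> \<phi>) h = wrap (conv2 \<beta> \<gamma>) \<phi> h"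
    by (simp add: wrap_def cact2_def cact1_def sw_mult_right)
qed

lemma wrap_mult:
  assumes "lin1 f" shows "wrap (\<lambda>a b. f (a \<cdot> b)) \<epsilon> h = \<epsilon> h * f \<one>"
proof -
  note [lin] = lin_compose[OF assms(1)]
  have "wrap (\<lambda>a b. f (a \<cdot> b)) \<epsilon> h = D h (\<lambda>a b. f (a \<cdot> S b))" by (rule wrap_counit; intro bilI lin)
  then show ?thesis by (simp add: comult_antipode_right assms)
qed

text \<open>An antipode inside a threefold coproduct cancels against the next leg.\<close>

lemma contract_middle:
  assumes "\<And>b c. lin1 (\<lambda>a. F a b c)" "\<And>a c. lin1 (\<lambda>b. F a b c)" "\<And>a b. lin1 (F a b)"
  shows "D y (\<lambda>b c. D b (\<lambda>u v. D c (\<lambda>c1 c2. F u (S v \<cdot> c1) c2))) = D y (\<lambda>b c. F b \<one> c)"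
proof -
  note [lin] = tril_lin[OF trilI[of _ _ F, OF assms]]
  have "D y (\<lambda>b c. D b (\<lambda>u v. D c (\<lambda>c1 c2. F u (S v \<cdot> c1) c2)))
      = D y (\<lambda>u z. D z (\<lambda>v c. D c (\<lambda>c1 c2. F u (S v \<cdot> c1) c2)))"
    by (rule comult_assoc; intro lin)
  also have "\<dots> = D y (\<lambda>b c. F b \<one> c)"
    by (rule sw_eqI, rule contract_antipode_left; intro lin)
  finally show ?thesis .
qed

text \<open>A left factor \<open>\<chi>\<inverse>(id \<otimes> m)\<close> disappears, because its last two arguments meet as \<open>S h\<^bsub>(i)\<^esub> h\<^bsub>(i+1)\<^esub>\<close>.\<close>

lemma wrap3_join:
  assumes "tril3 \<omega>" "lin1 \<phi>"
  shows "wrap3 (conv3 (join23 \<chi>') \<omega>) \<phi> = wrap3 \<omega> \<phi>"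
proof
  fix h
  note [lin] = tril_lin[OF assms(1)] lin_compose[OF assms(2)]
  have inner: "D y (\<lambda>b c. conv3 (join23 \<chi>') \<omega> a (S b) c * \<phi> m) = D y (\<lambda>b c. \<omega> a (S b) c * \<phi> m)" for a m y
  proof -
    let ?G = "\<lambda>b1 c1 b2 c2. D a (\<lambda>a1 a2. \<chi>' a1 (b1 \<cdot> c1) * \<omega> a2 b2 c2 * \<phi> m)"
    have "conv3 (join23 \<chi>') \<omega> a (S b) c * \<phi> m = D b (\<lambda>u v. D c (\<lambda>c1 c2. ?G (S v) c1 (S u) c2))" for b c
    proof -
      have "conv3 (join23 \<chi>') \<omega> a (S b) c * \<phi> m
          = D a (\<lambda>a1 a2. D (S b) (\<lambda>b1 b2. D c (\<lambda>c1 c2. \<chi>' a1 (b1 \<cdot> c1) * \<omega> a2 b2 c2 * \<phi> m)))"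
        by (simp add: cact3_def cact2_def cact1_def sw_mult_right)
      also have "\<dots> = D (S b) (\<lambda>b1 b2. D a (\<lambda>a1 a2. D c (\<lambda>c1 c2. \<chi>' a1 (b1 \<cdot> c1) * \<omega> a2 b2 c2 * \<phi> m)))"
        by (rule sw_swap)
      also have "\<dots> = D (S b) (\<lambda>b1 b2. D c (\<lambda>c1 c2. ?G b1 c1 b2 c2))"
        by (rule sw_eqI, rule sw_swap)
      also have "\<dots> = D b (\<lambda>u v. D c (\<lambda>c1 c2. ?G (S v) c1 (S u) c2))"
        by (rule comult_of_antipode; intro lin)
      finally show ?thesis .
    qed
    then have "D y (\<lambda>b c. conv3 (join23 \<chi>') \<omega> a (S b) c * \<phi> m)
        = D y (\<lambda>b c. D b (\<lambda>u v. D c (\<lambda>c1 c2. D a (\<lambda>a1 a2. \<chi>' a1 (S v \<cdot> c1) * \<omega> a2 (S u) c2 * \<phi> m))))"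
      by simp
    also have "\<dots> = D y (\<lambda>b c. D a (\<lambda>a1 a2. \<chi>' a1 \<one> * \<omega> a2 (S b) c * \<phi> m))"
      by (rule contract_middle; intro lin)
    also have "\<dots> = D y (\<lambda>b c. D a (\<lambda>a1 a2. \<epsilon> a1 * (\<omega> a2 (S b) c * \<phi> m)))"
      by (simp add: \<chi>'_unit_right mult.assoc)
    also have "\<dots> = D y (\<lambda>b c. \<omega> a (S b) c * \<phi> m)"
      by (rule sw_eqI, rule comult_counit_left; intro lin)
    finally show ?thesis .
  qed
  show "wrap3 (conv3 (join23 \<chi>') \<omega>) \<phi> h = wrap3 \<omega> \<phi> h"
    unfolding wrap3_def by (simp add: inner)
qed

lemma wrap3_split:
  assumes "lin1 \<phi>"
  shows "wrap3 (conv3 (in23 \<chi>') (in12 \<chi>)) \<phi> = conv1 (wrap \<chi> \<phi>) U'"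
proof
  fix h
  note [lin] = lin_compose[OF assms]
  have *: "conv3 (in23 \<chi>') (in12 \<chi>) a b c = D b (\<lambda>b1 b2. \<chi>' b1 c * \<chi> a b2)" for a b c
  proof -
    have "conv3 (in23 \<chi>') (in12 \<chi>) a b c = conv2 \<chi>' (\<lambda>b c. \<chi> a b * \<epsilon> c) b c"
      by (rule cact3_counit_left(1)[OF bicomodule_H]; intro lin)
    also have "\<dots> = D b (\<lambda>b1 b2. D c (\<lambda>c1 c2. (\<chi>' b1 c1 * \<chi> a b2) * \<epsilon> c2))"
      by (simp add: cact2_def cact1_def mult.assoc)
    also have "\<dots> = D b (\<lambda>b1 b2. \<chi>' b1 c * \<chi> a b2)"
      by (rule sw_eqI, rule comult_counit_right; intro lin)
    finally show ?thesis .
  qed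
  have S: "D (S b) (\<lambda>b1 b2. \<chi>' b1 c * \<chi> a b2) = D b (\<lambda>u v. \<chi>' (S v) c * \<chi> a (S u))" for a b c
    by (rule comult_of_antipode; intro lin)
  have "wrap3 (conv3 (in23 \<chi>') (in12 \<chi>)) \<phi> h
      = D h (\<lambda>a x. D x (\<lambda>m y. D y (\<lambda>b c. D b (\<lambda>u v. \<chi>' (S v) c * \<chi> a (S u) * \<phi> m))))"
    by (simp add: wrap3_def * S sw_mult_right)
  also have "\<dots> = D h (\<lambda>a x. D x (\<lambda>m y. D y (\<lambda>u z. D z (\<lambda>v c. \<chi>' (S v) c * \<chi> a (S u) * \<phi> m))))"
    by (rule sw_eqI, rule sw_eqI, rule comult_assoc; intro lin)
  also have "\<dots> = D h (\<lambda>a x. D x (\<lambda>w z. D w (\<lambda>m u. D z (\<lambda>v c. \<chi>' (S v) c * \<chi> a (S u) * \<phi> m))))"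
    by (rule sw_eqI, rule comult_assoc[symmetric]; intro lin)
  also have "\<dots> = D h (\<lambda>y z. D y (\<lambda>a w. D w (\<lambda>m u. D z (\<lambda>v c. \<chi>' (S v) c * \<chi> a (S u) * \<phi> m))))"
    by (rule comult_assoc[symmetric]; intro lin)
  finally show "wrap3 (conv3 (in23 \<chi>') (in12 \<chi>)) \<phi> h = conv1 (wrap \<chi> \<phi>) U' h"
    by (simp add: cact1_def wrap_def U'_def antipair_def sw_mult_right sw_mult_left ac_simps)
qed

text \<open>The identity \<open>\<chi>\<inverse>(h\<^bsub>(1)\<^esub> S h\<^bsub>(3)\<^esub> \<otimes> h\<^bsub>(4)\<^esub>) h\<^bsub>(2)\<^esub> = \<chi>(h\<^bsub>(1)\<^esub> \<otimes> S h\<^bsub>(3)\<^esub>) h\<^bsub>(2)\<^esub> U\<inverse>(h\<^bsub>(4)\<^esub>)\<close>.\<close>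

lemma wrap3_join12:
  assumes "lin1 \<phi>" shows "wrap3 (join12 \<chi>') \<phi> = conv1 (wrap \<chi> \<phi>) U'"
  unfolding cocycle3_mixed(2) wrap3_join[OF conv3_tril[OF \<chi>_tril(6) \<chi>_tril(1)] assms] wrap3_split[OF assms] ..

text \<open>The previous identity with \<open>\<phi> = \<epsilon>\<close>.\<close>

lemma U_U': "conv1 U U' = \<epsilon>"
proof
  fix h
  have "conv1 U U' h = wrap3 (join12 \<chi>') \<epsilon> h"
    by (simp add: wrap3_join12[OF counit_linear] U_def)
  also have "\<dots> = D h (\<lambda>a x. D x (\<lambda>m y. \<epsilon> m * D y (\<lambda>b c. \<chi>' (a \<cdot> S b) c)))"
    by (simp add: wrap3_def sw_mult_left mult.commute)
  also have "\<dots> = D h (\<lambda>a x. D x (\<lambda>b c. \<chi>' (a \<cdot> S b) c))"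
    by (rule sw_eqI, rule comult_counit_left; intro lin)
  also have "\<dots> = \<chi>' \<one> h"
    by (rule contract_antipode_right; intro lin)
  finally show "conv1 U U' h = \<epsilon> h" by (simp add: \<chi>'_unit_left)
qed

text \<open>The other order uses the cocycle identity \<open>\<chi>\<inverse>(m \<otimes> id) * (\<chi>\<inverse>\<^sub>1\<^sub>2 * \<chi>\<^sub>2\<^sub>3) = \<chi>\<inverse>(id \<otimes> m)\<close> evaluated at
  \<open>S h\<^bsub>(1)\<^esub> \<otimes> h\<^bsub>(2)\<^esub> \<otimes> S h\<^bsub>(3)\<^esub>\<close>.\<close>

lemma U'_U: "conv1 U' U = \<epsilon>"
proof
  fix h
  \<comment> \<open>\<open>T\<close> is this evaluation; in it a left factor \<open>\<chi>\<inverse>(m \<otimes> id)\<close> contracts to a counit.\<close>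
  define T where "T \<omega> = D h (\<lambda>a x. D x (\<lambda>b c. \<omega> (S a) b (S c)))" for \<omega> :: "'h \<Rightarrow> 'h \<Rightarrow> 'h \<Rightarrow> 'k"
  have absorb: "T (conv3 (join12 \<chi>') \<omega>) = T \<omega>" if "tril3 \<omega>" for \<omega>
  proof -
    note [lin] = tril_lin[OF that]
    let ?G = "\<lambda>a1 b1 a2 b2 z. D z (\<lambda>u v. \<chi>' (a1 \<cdot> b1) (S v) * \<omega> a2 b2 (S u))"
    have "conv3 (join12 \<chi>') \<omega> (S a) b (S c) = D a (\<lambda>p q. D b (\<lambda>b1 b2. ?G (S q) b1 (S p) b2 c))" for a b c
    proof -
      have "conv3 (join12 \<chi>') \<omega> (S a) b (S c)
          = D (S a) (\<lambda>a1 a2. D b (\<lambda>b1 b2. D (S c) (\<lambda>c1 c2. \<chi>' (a1 \<cdot> b1) c1 * \<omega> a2 b2 c2)))"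
        by (simp add: cact3_def cact2_def cact1_def)
      also have "\<dots> = D (S a) (\<lambda>a1 a2. D b (\<lambda>b1 b2. ?G a1 b1 a2 b2 c))"
        by (rule sw_eqI, rule sw_eqI, rule comult_of_antipode; intro lin)
      also have "\<dots> = D a (\<lambda>p q. D b (\<lambda>b1 b2. ?G (S q) b1 (S p) b2 c))"
        by (rule comult_of_antipode; intro lin)
      finally show ?thesis .
    qed
    then have "T (conv3 (join12 \<chi>') \<omega>)
        = D h (\<lambda>a x. D x (\<lambda>b c. D a (\<lambda>p q. D b (\<lambda>b1 b2. ?G (S q) b1 (S p) b2 c))))"
      by (simp add: T_def)
    also have "\<dots> = D h (\<lambda>y c. D y (\<lambda>a b. D a (\<lambda>p q. D b (\<lambda>b1 b2. ?G (S q) b1 (S p) b2 c))))"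
      by (rule comult_assoc[symmetric]; intro lin)
    also have "\<dots> = D h (\<lambda>y c. D y (\<lambda>a b. ?G \<one> \<one> (S a) b c))"
    proof (rule sw_eqI)
      fix y c
      have "D y (\<lambda>a b. D a (\<lambda>p q. D b (\<lambda>b1 b2. ?G (S q) b1 (S p) b2 c)))
         = D y (\<lambda>a b. D a (\<lambda>p q. D b (\<lambda>b1 b2. ?G \<one> (S q \<cdot> b1) (S p) b2 c)))"
        by (simp add: unit_left)
      also have "\<dots> = D y (\<lambda>a b. ?G \<one> \<one> (S a) b c)"
        by (rule contract_middle; intro lin)
      finally show "D y (\<lambda>a b. D a (\<lambda>p q. D b (\<lambda>b1 b2. ?G (S q) b1 (S p) b2 c)))
         = D y (\<lambda>a b. ?G \<one> \<one> (S a) b c)" .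
    qed
    also have "\<dots> = D h (\<lambda>y c. D y (\<lambda>a b. D c (\<lambda>u v. \<omega> (S a) b (S u) * \<epsilon> v)))"
      by (simp add: unit_left \<chi>'_unit_left counit_antipode mult.commute)
    also have "\<dots> = D h (\<lambda>y c. D y (\<lambda>a b. \<omega> (S a) b (S c)))"
      by (rule sw_eqI, rule sw_eqI, rule comult_counit_right; intro lin)
    also have "\<dots> = D h (\<lambda>a x. D x (\<lambda>b c. \<omega> (S a) b (S c)))"
      by (rule comult_assoc; intro lin)
    finally show ?thesis by (simp add: T_def)
  qed
  have *: "conv3 (in12 \<chi>') (in23 \<chi>) a b c = D b (\<lambda>b1 b2. \<chi>' a b1 * \<chi> b2 c)" for a b c
  proof -
    have "conv3 (in12 \<chi>') (in23 \<chi>) a b c = conv2 \<chi>' (\<lambda>a b. \<epsilon> a * \<chi> b c) a b"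
      by (rule cact3_counit_right(1)[OF bicomodule_H]; intro lin)
    also have "\<dots> = D a (\<lambda>a1 a2. D b (\<lambda>b1 b2. (\<chi>' a1 b1 * \<chi> b2 c)) * \<epsilon> a2)"
      unfolding cact2_def cact1_def sw_mult_right by (simp only: ac_simps)
    also have "\<dots> = D b (\<lambda>b1 b2. \<chi>' a b1 * \<chi> b2 c)"
      by (rule comult_counit_right; intro lin)
    finally show ?thesis .
  qed
  have "conv1 U' U h = D h (\<lambda>w z. D w (\<lambda>a b1. D z (\<lambda>b2 c. \<chi>' (S a) b1 * \<chi> b2 (S c))))"
    by (simp only: cact1_def U'_def U_def antipair_def wrap_counit[OF \<chi>_bil] sw_mult_right) (simp only: sw_mult_left)
  also have "\<dots> = D h (\<lambda>a x. D x (\<lambda>b1 z. D z (\<lambda>b2 c. \<chi>' (S a) b1 * \<chi> b2 (S c))))"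
    by (rule comult_assoc; intro lin)
  also have "\<dots> = D h (\<lambda>a x. D x (\<lambda>b c. D b (\<lambda>b1 b2. \<chi>' (S a) b1 * \<chi> b2 (S c))))"
    by (rule sw_eqI, rule comult_assoc[symmetric]; intro lin)
  also have "\<dots> = T (conv3 (join12 \<chi>') (conv3 (in12 \<chi>') (in23 \<chi>)))"
    unfolding absorb[OF conv3_tril[OF \<chi>_tril(5) \<chi>_tril(2)]] by (simp add: T_def *)
  also have "\<dots> = D h (\<lambda>a x. D x (\<lambda>b c. \<chi>' (S a) (b \<cdot> S c)))"
    unfolding cocycle3_mixed(3) by (simp add: T_def)
  also have "\<dots> = D h (\<lambda>a x. \<epsilon> x * \<chi>' (S a) \<one>)"
    by (rule sw_eqI, rule comult_antipode_right; intro lin)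
  also have "\<dots> = D h (\<lambda>a x. \<epsilon> a * \<epsilon> x)"
    by (simp add: \<chi>'_unit_right counit_antipode mult.commute)
  also have "\<dots> = \<epsilon> h" by (rule comult_counit_left[OF counit_linear])
  finally show "conv1 U' U h = \<epsilon> h" .
qed

end

section \<open>Twisting bicolinear products\<close>

lemma cact2_nested:
  "sw (lX x) (\<lambda>a \<xi>. sw (rX \<xi>) (\<lambda>b \<eta>. sw (lY y) (\<lambda>c \<zeta>. sw (rY \<zeta>) (\<lambda>d \<theta>. f a c * f' b d * \<beta> \<eta> \<theta>))))
    = cact2 lX lY f (cact2 rX rY f' \<beta>) x y"
proof -
  have "sw (lX x) (\<lambda>a \<xi>. sw (rX \<xi>) (\<lambda>b \<eta>. sw (lY y) (\<lambda>c \<zeta>. sw (rY \<zeta>) (\<lambda>d \<theta>. f a c * f' b d * \<beta> \<eta> \<theta>))))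
      = sw (lX x) (\<lambda>a \<xi>. sw (lY y) (\<lambda>c \<zeta>. sw (rX \<xi>) (\<lambda>b \<eta>. sw (rY \<zeta>) (\<lambda>d \<theta>. f a c * f' b d * \<beta> \<eta> \<theta>))))"
    by (rule sw_eqI, rule sw_swap)
  then show ?thesis by (simp add: cact2_def cact1_def sw_mult_left mult.assoc)
qed

context cocycle_twist
begin

lemma conv2_inverse_unique:
  assumes "bil2 f" "bil2 f'" "bil2 f''" "conv2 f' f = eps2" "conv2 f f'' = eps2"
  shows "f' = f''"
proof -
  have "f' = conv2 f' (conv2 f f'')" by (simp only: assms conv2_unit(2))
  also have "\<dots> = conv2 (conv2 f' f) f''" by (rule conv2_assoc; fact)
  finally show ?thesis by (simp only: assms conv2_unit(1))
qed

lemma conv1_inverse_unique: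
  assumes "lin1 f" "lin1 f'" "lin1 f''" "conv1 f' f = \<epsilon>" "conv1 f f'' = \<epsilon>"
  shows "f' = f''"
proof -
  have "f' = conv1 f' (conv1 f f'')" by (simp only: assms conv1_unit(2))
  also have "\<dots> = conv1 (conv1 f' f) f''" by (rule conv1_assoc; fact)
  finally show ?thesis by (simp only: assms conv1_unit(1))
qed

lemma conv_inverse2_eq: "conv_inverse2 H \<chi> = \<chi>'"
proof -
  have iff: "is_conv_inverse2 H \<chi> f \<longleftrightarrow> bil2 f \<and> conv2 \<chi> f = eps2 \<and> conv2 f \<chi> = eps2" for f
    by (simp add: is_conv_inverse2_def fun_eq_iff cact2_def cact1_def sw_def)
  show ?thesis
    unfolding conv_inverse2_def
  proof (rule the_equality)
    show "is_conv_inverse2 H \<chi> \<chi>'" by (simp only: iff \<chi>'_bil \<chi>_\<chi>' \<chi>'_\<chi>)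
    fix f assume "is_conv_inverse2 H \<chi> f"
    then show "f = \<chi>'" using conv2_inverse_unique[OF \<chi>_bil _ \<chi>'_bil _ \<chi>_\<chi>'] unfolding iff by blast
  qed
qed

lemma twist_U_eq: "twist_U H \<chi> = U"
  by (rule ext) (simp add: twist_U_def U_def wrap_counit[OF \<chi>_bil] sw_def)

lemma conv_inverse1_eq: "conv_inverse1 H (twist_U H \<chi>) = U'"
proof -
  have iff: "is_conv_inverse1 H U f \<longleftrightarrow> lin1 f \<and> conv1 U f = \<epsilon> \<and> conv1 f U = \<epsilon>" for f
    by (simp add: is_conv_inverse1_def fun_eq_iff cact1_def sw_def)
  show ?thesis
    unfolding conv_inverse1_def twist_U_eq
  proof (rule the_equality)
    show "is_conv_inverse1 H U U'" by (simp only: iff U'_lin U_U' U'_U)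
    fix f assume "is_conv_inverse1 H U f"
    then show "f = U'" using conv1_inverse_unique[OF U_lin _ U'_lin _ U_U'] unfolding iff by blast
  qed
qed

abbreviation "Hx \<equiv> twist_hopf H \<chi>"
abbreviation tmult (infixl \<open>\<bullet>\<close> 70) where "tmult \<equiv> mult Hx"
abbreviation "Sx \<equiv> antipode Hx"

lemma twist_hopf_simps [simp]:
  "scale Hx = sH" "unit Hx = \<one>" "comult Hx = \<Delta>" "counit Hx = \<epsilon>"
  by (simp_all add: twist_hopf_def)

text \<open>\<open>m'\<close> is the twist of \<open>m : X \<otimes> Y \<rightarrow> Z\<close>:
  \<open>m'(x \<otimes> y) = \<chi>(x\<^bsub>(1)\<^esub> \<otimes> y\<^bsub>(1)\<^esub>) m(x\<^bsub>(2)\<^esub> \<otimes> y\<^bsub>(2)\<^esub>) \<chi>\<inverse>(x\<^bsub>(3)\<^esub> \<otimes> y\<^bsub>(3)\<^esub>)\<close>, with outer legs from the two coactions.\<close>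

definition twisted where
  "twisted sZ lX rX lY rY m m' \<longleftrightarrow> (\<forall>\<phi> x y. lin sZ ((*) :: 'k \<Rightarrow> 'k \<Rightarrow> 'k) \<phi> \<longrightarrow>
    \<phi> (m' x y) = cact2 lX lY \<chi> (cact2 rX rY \<chi>' (\<lambda>x y. \<phi> (m x y))) x y)"

lemma twistedD: "twisted sZ lX rX lY rY m m' \<Longrightarrow> lin sZ (*) \<phi>
    \<Longrightarrow> (\<lambda>x y. \<phi> (m' x y)) = cact2 lX lY \<chi> (cact2 rX rY \<chi>' (\<lambda>x y. \<phi> (m x y)))"
  by (intro ext) (simp add: twisted_def)

lemma twisted_mult: "twisted sH \<Delta> \<Delta>r \<Delta> \<Delta>r (\<cdot>) (\<bullet>)"
  unfolding twisted_def cact2_nested[symmetric] sw_swapl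
proof (intro allI impI)
  fix \<phi> :: "'h \<Rightarrow> 'k" and x y assume \<phi>: "lin1 \<phi>"
  show "\<phi> (x \<bullet> y) = D x (\<lambda>a \<xi>. D \<xi> (\<lambda>\<eta> b. D y (\<lambda>c \<zeta>. D \<zeta> (\<lambda>\<theta> d. \<chi> a c * \<chi>' b d * \<phi> (\<eta> \<cdot> \<theta>)))))"
    by (simp add: twist_hopf_def comult3_sum conv_inverse2_eq lin_sw[OF \<phi>] lin_scale[OF \<phi>])
qed

lemma twisted_bil:
  assumes "twisted sZ lX rX lY rY m m'" "bicomodule H sX lX rX" "bicomodule H sY lY rY"
    "vector_space sZ" "bil sX sY sZ m"
  shows "bil sX sY sZ m'"
proof -
  have *: "bil sX sY (*) (\<lambda>x y. \<phi> (m' x y))" if \<phi>: "lin sZ (*) \<phi>" for \<phi>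
    unfolding twistedD[OF assms(1) \<phi>] using assms(2,3)
  proof (intro cact2_bil)
    show "bil sX sY (*) (\<lambda>x y. \<phi> (m x y))"
      by (intro bilI lin_compose[OF \<phi>] bilD1[OF assms(5)] bilD2[OF assms(5)])
  qed (auto simp: bicomodule_def \<chi>_bil \<chi>'_bil)
  show ?thesis
  proof (intro bilI linI; rule eq_by_functionals[OF assms(4)])
    fix \<phi> :: "_ \<Rightarrow> 'k" and x y z and c assume \<phi>: "lin sZ (*) \<phi>"
    note b = lin_add[OF bilD1[OF *[OF \<phi>]]] lin_add[OF bilD2[OF *[OF \<phi>]]]
      lin_scale[OF bilD1[OF *[OF \<phi>]]] lin_scale[OF bilD2[OF *[OF \<phi>]]]
    show "\<phi> (m' (x + y) z) = \<phi> (m' x z + m' y z)" "\<phi> (m' (sX c x) z) = \<phi> (sZ c (m' x z))"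
      by (simp_all add: b lin_add[OF \<phi>] lin_scale[OF \<phi>])
    fix x' y' show "\<phi> (m' x (x' + y')) = \<phi> (m' x x' + m' x y')" "\<phi> (m' x (sY c x')) = \<phi> (sZ c (m' x x'))"
      by (simp_all add: b lin_add[OF \<phi>] lin_scale[OF \<phi>])
  qed
qed

lemma mult_functional_bil: assumes "lin1 f" shows "bil2 (\<lambda>a b. f (a \<cdot> b))"
  by (intro bilI lin lin_compose[OF assms])

lemma twisted_mult_conv:
  assumes "lin1 f"
  shows "(\<lambda>a b. f (a \<bullet> b)) = conv2 \<chi> (conv2 (\<lambda>a b. f (a \<cdot> b)) \<chi>')"
  unfolding twistedD[OF twisted_mult assms] cact2_swapl ..

text \<open>A twisted map is colinear over the twisted product.  For the left coaction, functionals \<open>f\<close> on \<open>H\<close>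
  and \<open>\<phi>\<close> on \<open>Z\<close>: \<open>(f \<cdot> \<phi>) \<circ> m' = \<chi> \<cdot> fm \<cdot> (\<phi> \<circ> m) \<cdot> \<chi>\<inverse> = (\<chi> * fm * \<chi>\<inverse>) \<cdot> \<chi> \<cdot> (\<phi> \<circ> m) \<cdot> \<chi>\<inverse>\<close>, where \<open>fm\<close> is
  \<open>f\<close> after the product of \<open>H\<close>.\<close>

lemma twisted_colinear:
  assumes tw: "twisted sZ lX rX lY rY m m'"
    and X: "bicomodule H sX lX rX" and Y: "bicomodule H sY lY rY" and Z: "bicomodule H sZ lZ rZ"
    and m: "bil sX sY sZ m" "colinear sZ lX lY lZ m" "colinear sZ rX rY rZ m"
  shows "bil sH sZ (*) F \<Longrightarrow> sw (lZ (m' x y)) F = sw (lX x) (\<lambda>a \<xi>. sw (lY y) (\<lambda>c \<eta>. F (a \<bullet> c) (m' \<xi> \<eta>)))"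
    and "bil sH sZ (*) F \<Longrightarrow> sw (rZ (m' x y)) F = sw (rX x) (\<lambda>a \<xi>. sw (rY y) (\<lambda>c \<eta>. F (a \<bullet> c) (m' \<xi> \<eta>)))"
proof -
  have coX: "comodule sH \<Delta> sX lX" "comodule sH \<Delta>r sX rX" "commuting sH sX lX rX"
    and coY: "comodule sH \<Delta> sY lY" "comodule sH \<Delta>r sY rY" "commuting sH sY lY rY"
    and coZ: "comodule sH \<Delta> sZ lZ" "comodule sH \<Delta>r sZ rZ" and vZ: "vector_space sZ"
    using X Y Z by (auto simp: bicomodule_def)
  have L: "cact1 lZ f \<phi> (m' x y) = cact2 lX lY (\<lambda>a c. f (a \<bullet> c)) (\<lambda>\<xi> \<eta>. \<phi> (m' \<xi> \<eta>)) x y"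
    and R: "cact1 rZ f \<phi> (m' x y) = cact2 rX rY (\<lambda>a c. f (a \<bullet> c)) (\<lambda>\<xi> \<eta>. \<phi> (m' \<xi> \<eta>)) x y"
    if f: "lin1 f" and \<phi>: "lin sZ (*) \<phi>" for f \<phi> x y
  proof -
    let ?fm = "\<lambda>a b. f (a \<cdot> b)" and ?\<phi>m = "\<lambda>x y. \<phi> (m x y)"
    have b\<phi>: "bil sX sY (*) ?\<phi>m"
      by (intro bilI lin_compose[OF \<phi>] bilD1[OF m(1)] bilD2[OF m(1)])
    note bl = \<chi>_bil \<chi>'_bil mult_functional_bil[OF f] b\<phi>
      cact2_bil[OF coX(2) coY(2)] cact2_bil[OF coX(1) coY(1)] conv2_bil
    let ?R = "cact2 rX rY \<chi>' ?\<phi>m"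
    have "(\<lambda>x y. cact1 lZ f \<phi> (m' x y)) = cact2 lX lY \<chi> (cact2 rX rY \<chi>' (\<lambda>x y. cact1 lZ f \<phi> (m x y)))"
      by (rule twistedD[OF tw cact1_lin[OF coZ(1) f \<phi>]])
    also have "\<dots> = cact2 lX lY \<chi> (cact2 rX rY \<chi>' (cact2 lX lY ?fm ?\<phi>m))"
      by (simp only: colinear_cact1[OF m(2) f \<phi>])
    also have "\<dots> = cact2 lX lY \<chi> (cact2 lX lY ?fm ?R)"
      by (simp only: cact2_commute[OF coX(3) coY(3) bl(3) bl(2) b\<phi>])
    also have "\<dots> = cact2 lX lY (conv2 \<chi> ?fm) ?R"
      by (rule cact2_assoc[OF coX(1) coY(1)]; intro bl)
    also have "conv2 \<chi> ?fm = conv2 (conv2 \<chi> (conv2 ?fm \<chi>')) \<chi>"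
      by (simp only: conv2_assoc[symmetric] bl \<chi>'_\<chi> conv2_unit)
    also have "cact2 lX lY \<dots> ?R = cact2 lX lY (conv2 \<chi> (conv2 ?fm \<chi>')) (cact2 lX lY \<chi> ?R)"
      by (rule cact2_assoc[OF coX(1) coY(1), symmetric]; intro bl)
    also have "\<dots> = cact2 lX lY (\<lambda>a c. f (a \<bullet> c)) (\<lambda>\<xi> \<eta>. \<phi> (m' \<xi> \<eta>))"
      by (simp only: twisted_mult_conv[OF f] twistedD[OF tw \<phi>])
    finally show "cact1 lZ f \<phi> (m' x y) = cact2 lX lY (\<lambda>a c. f (a \<bullet> c)) (\<lambda>\<xi> \<eta>. \<phi> (m' \<xi> \<eta>)) x y"
      by (rule fun_cong[OF fun_cong])
    have "(\<lambda>x y. cact1 rZ f \<phi> (m' x y)) = cact2 lX lY \<chi> (cact2 rX rY \<chi>' (\<lambda>x y. cact1 rZ f \<phi> (m x y)))"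
      by (rule twistedD[OF tw cact1_lin[OF coZ(2) f \<phi>]])
    also have "\<dots> = cact2 lX lY \<chi> (cact2 rX rY \<chi>' (cact2 rX rY ?fm ?\<phi>m))"
      by (simp only: colinear_cact1[OF m(3) f \<phi>])
    also have "\<dots> = cact2 lX lY \<chi> (cact2 rX rY (conv2 ?fm \<chi>') ?\<phi>m)"
      by (subst cact2_assoc[OF coX(2) coY(2) bl(2) bl(3) b\<phi>]) (simp only: cact2_swapl)
    also have "conv2 ?fm \<chi>' = conv2 \<chi>' (conv2 \<chi> (conv2 ?fm \<chi>'))"
      by (simp only: conv2_assoc bl \<chi>'_\<chi> conv2_unit)
    also have "cact2 rX rY \<dots> ?\<phi>m = cact2 rX rY (conv2 \<chi> (conv2 ?fm \<chi>')) ?R"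
      by (subst cact2_assoc[OF coX(2) coY(2)]) (simp_all only: cact2_swapl bl)
    also have "cact2 lX lY \<chi> \<dots> = cact2 rX rY (conv2 \<chi> (conv2 ?fm \<chi>')) (cact2 lX lY \<chi> ?R)"
      by (rule cact2_commute[OF coX(3) coY(3)]; intro bl)
    also have "\<dots> = cact2 rX rY (\<lambda>a c. f (a \<bullet> c)) (\<lambda>\<xi> \<eta>. \<phi> (m' \<xi> \<eta>))"
      by (simp only: twisted_mult_conv[OF f] twistedD[OF tw \<phi>])
    finally show "cact1 rZ f \<phi> (m' x y) = cact2 rX rY (\<lambda>a c. f (a \<bullet> c)) (\<lambda>\<xi> \<eta>. \<phi> (m' \<xi> \<eta>)) x y"
      by (rule fun_cong[OF fun_cong])
  qed
  have "tensor_eq sH sZ (lZ (m' x y)) [(a \<bullet> c, m' \<xi> \<eta>). (a, \<xi>) \<leftarrow> lX x, (c, \<eta>) \<leftarrow> lY y]"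
    using L by (intro tensor_eq_by_functionals[OF vector_space_H vZ]) (simp add: sw_compr cact2_def cact1_def)
  from tensor_eqD[OF this]
  show "bil sH sZ (*) F \<Longrightarrow> sw (lZ (m' x y)) F = sw (lX x) (\<lambda>a \<xi>. sw (lY y) (\<lambda>c \<eta>. F (a \<bullet> c) (m' \<xi> \<eta>)))"
    by (simp add: sw_compr)
  have "tensor_eq sH sZ (rZ (m' x y)) [(a \<bullet> c, m' \<xi> \<eta>). (a, \<xi>) \<leftarrow> rX x, (c, \<eta>) \<leftarrow> rY y]"
    using R by (intro tensor_eq_by_functionals[OF vector_space_H vZ]) (simp add: sw_compr cact2_def cact1_def)
  from tensor_eqD[OF this]
  show "bil sH sZ (*) F \<Longrightarrow> sw (rZ (m' x y)) F = sw (rX x) (\<lambda>a \<xi>. sw (rY y) (\<lambda>c \<eta>. F (a \<bullet> c) (m' \<xi> \<eta>)))"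
    by (simp add: sw_compr)
qed

text \<open>Twisting preserves a law \<open>m\<^sub>2(m\<^sub>1(x, y), w) = m\<^sub>4(x, m\<^sub>3(y, w))\<close>: a functional of either side is
  twisted by \<open>\<chi>\<^sub>1\<^sub>2 * \<chi>(m \<otimes> id)\<close> or by \<open>\<chi>\<^sub>2\<^sub>3 * \<chi>(id \<otimes> m)\<close>, and these are equal by the cocycle condition.\<close>

lemma twisted_assoc:
  assumes X: "bicomodule H sX lX rX" and Y: "bicomodule H sY lY rY" and W: "bicomodule H sW lW rW"
    and P: "bicomodule H sP lP rP" and Q: "bicomodule H sQ lQ rQ" and Z: "bicomodule H sZ lZ rZ"
    and t: "twisted sP lX rX lY rY m1 m1'" "twisted sZ lP rP lW rW m2 m2'"
      "twisted sQ lY rY lW rW m3 m3'" "twisted sZ lX rX lQ rQ m4 m4'"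
    and b: "bil sX sY sP m1" "bil sP sW sZ m2" "bil sY sW sQ m3" "bil sX sQ sZ m4"
    and c: "colinear sP lX lY lP m1" "colinear sP rX rY rP m1"
      "colinear sQ lY lW lQ m3" "colinear sQ rY rW rQ m3"
    and assoc: "\<And>x y w. m2 (m1 x y) w = m4 x (m3 y w)"
  shows "m2' (m1' x y) w = m4' x (m3' y w)"
proof (rule eq_by_functionals[of sZ])
  show "vector_space sZ" using Z by (simp add: bicomodule_def)
  fix \<phi> :: "_ \<Rightarrow> 'k" assume \<phi>: "lin sZ (*) \<phi>"
  have coX: "comodule sH \<Delta> sX lX" "comodule sH \<Delta>r sX rX" "commuting sH sX lX rX"
    and coY: "comodule sH \<Delta> sY lY" "comodule sH \<Delta>r sY rY" "commuting sH sY lY rY"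
    and coW: "comodule sH \<Delta> sW lW" "comodule sH \<Delta>r sW rW" "commuting sH sW lW rW"
    and coP: "comodule sH \<Delta> sP lP" "comodule sH \<Delta>r sP rP"
    and coQ: "comodule sH \<Delta> sQ lQ" "comodule sH \<Delta>r sQ rQ"
    using X Y W P Q by (auto simp: bicomodule_def)
  let ?\<gamma> = "\<lambda>x y w. \<phi> (m2 (m1 x y) w)"
  have \<gamma>: "tril sX sY sW (*) ?\<gamma>"
    by (intro trilI lin_compose[OF \<phi>] lin bil_lin[OF b(1)] bil_lin[OF b(2)])
  have b2: "bil sP sW (*) (\<lambda>z w. \<phi> (m2 z w))" and b4: "bil sX sQ (*) (\<lambda>z w. \<phi> (m4 z w))"
    by (intro bilI lin_compose[OF \<phi>] lin bil_lin[OF b(2)] bil_lin[OF b(4)])+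
  note tr = \<chi>_tril \<gamma> cact3_tril[OF coX(1) coY(1) coW(1)] cact3_tril[OF coX(2) coY(2) coW(2)] conv3_tril
  define L R where "L = (cact3 lX lY lW :: ('h \<Rightarrow> 'h \<Rightarrow> 'h \<Rightarrow> 'k) \<Rightarrow> _)"
    and "R = (cact3 rX rY rW :: ('h \<Rightarrow> 'h \<Rightarrow> 'h \<Rightarrow> 'k) \<Rightarrow> _)"
  have twice: "L f (R f' (L g (R g' ?\<gamma>))) = L (conv3 f g) (R (conv3 g' f') ?\<gamma>)"
    if fg: "tril3 f" "tril3 f'" "tril3 g" "tril3 g'" for f f' g g'
  proof -
    have "L f (R f' (L g (R g' ?\<gamma>))) = L f (L g (R f' (R g' ?\<gamma>)))"
      unfolding L_def R_def
      by (subst cact3_commute[OF coX(3) coY(3) coW(3) fg(3) fg(2)]) (simp_all only: tr fg)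
    also have "R f' (R g' ?\<gamma>) = R (conv3 g' f') ?\<gamma>"
      unfolding R_def by (subst cact3_assoc[OF coX(2) coY(2) coW(2)]) (simp_all only: tr fg cact3_swapl)
    also have "L f (L g \<dots>) = L (conv3 f g) \<dots>"
      unfolding L_def R_def by (rule cact3_assoc[OF coX(1) coY(1) coW(1)]; intro tr fg)
    finally show ?thesis .
  qed
  have 1: "\<phi> (m2' (m1' x y) w) = L (in12 \<chi>) (R (in12 \<chi>') (L (join12 \<chi>) (R (join12 \<chi>') ?\<gamma>))) x y w"
  proof -
    let ?B = "cact2 rP rW \<chi>' (\<lambda>z w. \<phi> (m2 z w))"
    let ?T = "L (join12 \<chi>) (R (join12 \<chi>') ?\<gamma>)"
    have B: "bil sP sW (*) ?B" by (rule cact2_bil[OF coP(2) coW(2) \<chi>'_bil b2])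
    have T: "tril sX sY sW (*) ?T" "tril sX sY sW (*) (R (in12 \<chi>') ?T)"
      unfolding L_def R_def by (intro tr)+
    have "bil sP sW (*) (cact2 lP lW \<chi> ?B)" by (rule cact2_bil[OF coP(1) coW(1) \<chi>_bil B])
    from bilD1[OF this] have \<theta>: "lin sP (*) (\<lambda>z. cact2 lP lW \<chi> ?B z w)" .
    have \<theta>m: "cact2 lP lW \<chi> ?B (m1 x y) w = ?T x y w" for x y
      unfolding colinear_first[OF c(1) coW(1) \<chi>_bil B] colinear_first[OF c(2) coW(2) \<chi>'_bil b2] L_def R_def ..
    have "\<phi> (m2' (m1' x y) w) = cact2 lP lW \<chi> ?B (m1' x y) w"
      using twistedD[OF t(2) \<phi>] by (simp add: fun_eq_iff)
    also have "\<dots> = cact2 lX lY \<chi> (cact2 rX rY \<chi>' (\<lambda>x y. ?T x y w)) x y"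
      using twistedD[OF t(1) \<theta>] by (simp add: fun_eq_iff \<theta>m)
    also have "cact2 rX rY \<chi>' (\<lambda>x y. ?T x y w) = (\<lambda>x y. R (in12 \<chi>') ?T x y w)"
      unfolding R_def
      by (intro ext, rule cact3_counit_right(2)[OF W, symmetric], rule tril_lin(3)[OF T(1)[unfolded R_def]], rule lin_id)
    also have "cact2 lX lY \<chi> \<dots> x y = L (in12 \<chi>) (R (in12 \<chi>') ?T) x y w"
      unfolding L_def[of]
      by (rule cact3_counit_right(1)[OF W, symmetric], rule tril_lin(3)[OF T(2)[unfolded L_def]], rule lin_id)
    finally show ?thesis .
  qed
  have 2: "\<phi> (m4' x (m3' y w)) = L (in23 \<chi>) (R (in23 \<chi>') (L (join23 \<chi>) (R (join23 \<chi>') ?\<gamma>))) x y w"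
  proof -
    let ?B = "cact2 rX rQ \<chi>' (\<lambda>z w. \<phi> (m4 z w))"
    let ?T = "L (join23 \<chi>) (R (join23 \<chi>') ?\<gamma>)"
    have B: "bil sX sQ (*) ?B" by (rule cact2_bil[OF coX(2) coQ(2) \<chi>'_bil b4])
    have T: "tril sX sY sW (*) ?T" "tril sX sY sW (*) (R (in23 \<chi>') ?T)"
      unfolding L_def R_def by (intro tr)+
    have "bil sX sQ (*) (cact2 lX lQ \<chi> ?B)" by (rule cact2_bil[OF coX(1) coQ(1) \<chi>_bil B])
    from bilD2[OF this] have \<theta>: "lin sQ (*) (\<lambda>z. cact2 lX lQ \<chi> ?B x z)" .
    have \<theta>m: "cact2 lX lQ \<chi> ?B x (m3 y w) = ?T x y w" for y w
      unfolding colinear_second[OF c(3) \<chi>_bil B] colinear_second[OF c(4) \<chi>'_bil b4] L_def R_def assoc ..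
    have "\<phi> (m4' x (m3' y w)) = cact2 lX lQ \<chi> ?B x (m3' y w)"
      using twistedD[OF t(4) \<phi>] by (simp add: fun_eq_iff)
    also have "\<dots> = cact2 lY lW \<chi> (cact2 rY rW \<chi>' (?T x)) y w"
      using twistedD[OF t(3) \<theta>] by (simp add: fun_eq_iff \<theta>m)
    also have "cact2 rY rW \<chi>' (?T x) = R (in23 \<chi>') ?T x"
      unfolding R_def
      by (intro ext, rule cact3_counit_left(2)[OF X, symmetric], rule tril_lin(1)[OF T(1)[unfolded R_def]], rule lin_id)
    also have "cact2 lY lW \<chi> \<dots> y w = L (in23 \<chi>) (R (in23 \<chi>') ?T) x y w"
      unfolding L_def[of]
      by (rule cact3_counit_left(1)[OF X, symmetric], rule tril_lin(1)[OF T(2)[unfolded L_def]], rule lin_id)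
    finally show ?thesis .
  qed
  show "\<phi> (m2' (m1' x y) w) = \<phi> (m4' x (m3' y w))"
    unfolding 1 2 by (simp only: twice \<chi>_tril cocycle3 cocycle3_inverse)
qed

section \<open>The twisted Hopf algebra\<close>

lemma antipode_twist:
  assumes "lin1 \<phi>"
  shows "\<phi> (Sx h) = D h (\<lambda>u x. D x (\<lambda>s v. U u * \<phi> (S s) * U' v))"
  by (simp add: twist_hopf_def comult3_sum lin_sw[OF assms] lin_scale[OF assms] twist_U_eq conv_inverse1_eq[unfolded twist_U_eq] ac_simps)

lemmas U_lins [lin] = lin_compose[OF U_lin] lin_compose[OF U'_lin]

text \<open>Placing \<open>\<beta>(S h\<^bsub>(2)\<^esub> \<otimes> h\<^bsub>(3)\<^esub>)\<close> between the arguments of \<open>\<gamma>(S h\<^bsub>(1)\<^esub> \<otimes> h\<^bsub>(4)\<^esub>)\<close> multiplies \<open>\<gamma>\<close> by \<open>\<beta>\<close>.\<close>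

lemma antipair_conv:
  assumes "bil2 \<beta>" "bil2 \<gamma>"
  shows "D h (\<lambda>s z. D z (\<lambda>v b. antipair \<beta> v * \<gamma> (S s) b)) = antipair (conv2 \<beta> \<gamma>) h"
proof -
  note [lin] = bil_lin[OF assms(1)] bil_lin[OF assms(2)]
  have "D h (\<lambda>s z. D z (\<lambda>v b. antipair \<beta> v * \<gamma> (S s) b))
      = D h (\<lambda>s1 z. D z (\<lambda>w b2. D w (\<lambda>s2 b1. \<beta> (S s2) b1 * \<gamma> (S s1) b2)))"
    by (simp add: antipair_def sw_mult_right)
  also have "\<dots> = D h (\<lambda>s1 z. D z (\<lambda>s2 b. D b (\<lambda>b1 b2. \<beta> (S s2) b1 * \<gamma> (S s1) b2)))"
    by (rule sw_eqI, rule comult_assoc; intro lin)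
  also have "\<dots> = D h (\<lambda>s b. D s (\<lambda>s1 s2. D b (\<lambda>b1 b2. \<beta> (S s2) b1 * \<gamma> (S s1) b2)))"
    by (rule comult_assoc[symmetric]; intro lin)
  also have "\<dots> = D h (\<lambda>s b. D (S s) (\<lambda>s2 s1. D b (\<lambda>b1 b2. \<beta> s2 b1 * \<gamma> s1 b2)))"
    by (rule sw_eqI, rule comult_of_antipode[symmetric]; intro lin)
  finally show ?thesis by (simp add: antipair_def cact2_def cact1_def)
qed

lemma antipair_mult:
  assumes "lin1 f" "bil2 \<gamma>"
  shows "antipair (conv2 (\<lambda>a b. f (a \<cdot> b)) \<gamma>) h = f \<one> * antipair \<gamma> h"
proof -
  note [lin] = lin_compose[OF assms(1)] bil_lin[OF assms(2)]
  have "antipair (conv2 (\<lambda>a b. f (a \<cdot> b)) \<gamma>) h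
      = D h (\<lambda>s b. D (S s) (\<lambda>s2 s1. D b (\<lambda>b1 b2. f (s2 \<cdot> b1) * \<gamma> s1 b2)))"
    by (simp add: antipair_def cact2_def cact1_def)
  also have "\<dots> = D h (\<lambda>s b. D s (\<lambda>s1 s2. D b (\<lambda>b1 b2. f (S s2 \<cdot> b1) * \<gamma> (S s1) b2)))"
    by (rule sw_eqI, rule comult_of_antipode; intro lin)
  also have "\<dots> = D h (\<lambda>s b. f \<one> * \<gamma> (S s) b)"
    by (rule contract_middle; intro lin)
  finally show ?thesis by (simp add: antipair_def sw_mult_left)
qed

lemma antipode_twist_left:
  assumes "lin1 f" shows "D h (\<lambda>a b. f (Sx a \<bullet> b)) = \<epsilon> h * f \<one>"
proof -
  let ?fm = "\<lambda>a b. f (a \<cdot> b)"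
  note bl = \<chi>_bil \<chi>'_bil mult_functional_bil[OF assms] conv2_bil
  define B where "B = conv2 \<chi> (conv2 ?fm \<chi>')"
  have B: "bil2 B" unfolding B_def by (intro bl)
  have Bf: "f (a \<bullet> b) = B a b" for a b
    unfolding B_def twisted_mult_conv[OF assms, symmetric] ..
  note [lin] = bil_lin[OF B]
  have "D h (\<lambda>a b. f (Sx a \<bullet> b)) = D h (\<lambda>a b. D a (\<lambda>u x. D x (\<lambda>s v. U u * B (S s) b * U' v)))"
    unfolding Bf by (rule sw_eqI, rule antipode_twist; intro lin)
  also have "\<dots> = D h (\<lambda>u y. D y (\<lambda>x b. D x (\<lambda>s v. U u * B (S s) b * U' v)))"
    by (rule comult_assoc; intro lin)
  also have "\<dots> = D h (\<lambda>u y. D y (\<lambda>s z. D z (\<lambda>v b. U u * B (S s) b * U' v)))"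
    by (rule sw_eqI, rule comult_assoc; intro lin)
  also have "\<dots> = D h (\<lambda>u y. U u * D y (\<lambda>s z. D z (\<lambda>v b. antipair \<chi>' v * B (S s) b)))"
    by (simp add: sw_mult_left U'_def ac_simps)
  also have "\<dots> = conv1 U (antipair (conv2 \<chi>' B)) h"
    by (simp only: antipair_conv[OF \<chi>'_bil B] cact1_def)
  also have "conv2 \<chi>' B = conv2 ?fm \<chi>'"
    unfolding B_def by (simp only: conv2_assoc bl \<chi>'_\<chi> conv2_unit)
  also have "conv1 U (antipair (conv2 ?fm \<chi>')) h = f \<one> * conv1 U U' h"
    by (simp add: cact1_def antipair_mult[OF assms \<chi>'_bil] U'_def sw_mult_left ac_simps)
  finally show ?thesis by (simp add: U_U')
qed

lemma antipode_twist_right: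
  assumes "lin1 f" shows "D h (\<lambda>a b. f (a \<bullet> Sx b)) = \<epsilon> h * f \<one>"
proof -
  let ?fm = "\<lambda>a b. f (a \<cdot> b)"
  note bl = \<chi>_bil \<chi>'_bil mult_functional_bil[OF assms] conv2_bil
  define B where "B = conv2 \<chi> (conv2 ?fm \<chi>')"
  have B: "bil2 B" unfolding B_def by (intro bl)
  have Bf: "f (a \<bullet> b) = B a b" for a b
    unfolding B_def twisted_mult_conv[OF assms, symmetric] ..
  note [lin] = bil_lin[OF B]
  have "D h (\<lambda>a b. f (a \<bullet> Sx b)) = D h (\<lambda>a b. D b (\<lambda>u x. D x (\<lambda>s v. U u * B a (S s) * U' v)))"
    unfolding Bf by (rule sw_eqI, rule antipode_twist; intro lin)
  also have "\<dots> = D h (\<lambda>a b. D b (\<lambda>y v. D y (\<lambda>u s. U u * B a (S s) * U' v)))"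
    by (rule sw_eqI, rule comult_assoc[symmetric]; intro lin)
  also have "\<dots> = D h (\<lambda>w v. D w (\<lambda>a y. D y (\<lambda>u s. U u * B a (S s) * U' v)))"
    by (rule comult_assoc[symmetric]; intro lin)
  also have "\<dots> = conv1 (wrap B U) U' h"
    unfolding cact1_def wrap_def sw_mult_right by (simp only: ac_simps)
  also have "wrap B U = wrap (conv2 B \<chi>) \<epsilon>"
    unfolding U_def by (rule wrap_wrap[OF B \<chi>_bil counit_linear])
  also have "conv2 B \<chi> = conv2 \<chi> ?fm"
    unfolding B_def by (simp only: conv2_assoc[symmetric] bl \<chi>'_\<chi> conv2_unit)
  also have "wrap (conv2 \<chi> ?fm) \<epsilon> = wrap \<chi> (wrap ?fm \<epsilon>)"
    by (rule wrap_wrap[symmetric]; intro bl counit_linear)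
  also have "conv1 (wrap \<chi> (wrap ?fm \<epsilon>)) U' h = f \<one> * conv1 U U' h"
    by (simp add: cact1_def wrap_def[of \<chi>] wrap_mult[OF assms] U_def sw_mult_left sw_mult_right ac_simps)
  finally show ?thesis by (simp add: U_U')
qed

text \<open>\<open>S\<^sup>\<chi>\<close> is \<open>S\<close> after \<open>h \<mapsto> U(h\<^bsub>(1)\<^esub>) h\<^bsub>(2)\<^esub> U\<inverse>(h\<^bsub>(3)\<^esub>)\<close>, which is inverted by exchanging \<open>U\<close> and \<open>U\<inverse>\<close>.\<close>

lemma antipode_twist_bij: "bij Sx"
proof -
  define c where "c u v h = D h (\<lambda>a x. D x (\<lambda>m b. sH (u a * v b) m))" for u v :: "'h \<Rightarrow> 'k" and h
  have c: "\<phi> (c u v h) = conv1 u (conv1 \<phi> v) h" if "lin1 \<phi>" for \<phi> u v h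
    by (simp add: c_def lin_sw[OF that] lin_scale[OF that] cact1_def sw_mult_left ac_simps)
  have inv: "c u v (c u' v' h) = h"
    if "lin1 u" "lin1 v" "lin1 u'" "lin1 v'" "conv1 u' u = \<epsilon>" "conv1 v v' = \<epsilon>" for u v u' v' h
  proof (rule eq_by_functionals[OF vector_space_H])
    fix \<phi> assume \<phi>: "lin1 \<phi>"
    note l = that(1-4) \<phi> conv1_lin
    have "(\<lambda>h. \<phi> (c u v h)) = conv1 u (conv1 \<phi> v)" by (rule ext) (rule c[OF \<phi>])
    moreover have "lin1 (conv1 u (conv1 \<phi> v))" by (intro l)
    ultimately have "\<phi> (c u v (c u' v' h)) = conv1 u' (conv1 (conv1 u (conv1 \<phi> v)) v') h"
      using c[of "\<lambda>h. \<phi> (c u v h)" u' v' h] by simp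
    also have "conv1 u' (conv1 (conv1 u (conv1 \<phi> v)) v') = conv1 (conv1 u' u) (conv1 \<phi> (conv1 v v'))"
      by (simp only: conv1_assoc l)
    also have "\<dots> = \<phi>" by (simp only: that conv1_unit \<phi>)
    finally show "\<phi> (c u v (c u' v' h)) = \<phi> h" .
  qed
  have Sx: "Sx h = S (c U U' h)" for h
  proof (rule eq_by_functionals[OF vector_space_H])
    fix \<phi> assume \<phi>: "lin1 \<phi>"
    have "lin1 (\<lambda>h. \<phi> (S h))" by (intro lin lin_compose[OF \<phi>])
    from c[OF this, of U U' h] show "\<phi> (Sx h) = \<phi> (S (c U U' h))"
      by (simp add: antipode_twist[OF \<phi>] cact1_def sw_mult_left mult.assoc)
  qed
  have "bij (c U U')"
  proof (rule bijI')
    show "(c U U' x = c U U' y) = (x = y)" for x y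
      using inv[OF U'_lin U_lin U_lin U'_lin U_U' U_U'] by metis
    show "\<exists>x. y = c U U' x" for y
      using inv[OF U_lin U'_lin U'_lin U_lin U'_U U'_U] by metis
  qed
  then have "bij (S \<circ> c U U')" using antipode_bij by (rule bij_comp)
  moreover have "S \<circ> c U U' = Sx" by (auto simp: Sx)
  ultimately show ?thesis by simp
qed

lemma twist_unit_left:
  assumes "twisted sX \<Delta> \<Delta>r lX rX m m'" "bicomodule H sX lX rX" "bil sH sX sX m" "\<And>x. m \<one> x = x"
  shows "m' \<one> x = x"
proof (rule eq_by_functionals[of sX])
  show "vector_space sX" using assms(2) by (simp add: bicomodule_def)
  fix \<phi> :: "_ \<Rightarrow> 'k" assume \<phi>: "lin sX (*) \<phi>"
  have co: "comodule sH \<Delta> sX lX" "comodule sH \<Delta>r sX rX" using assms(2) by (auto simp: bicomodule_def)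
  have b: "bil sH sX (*) (\<lambda>x y. \<phi> (m x y))"
    by (intro bilI lin_compose[OF \<phi>] lin bil_lin[OF assms(3)])
  have 2: "cact2 \<Delta>r rX \<chi>' (\<lambda>x y. \<phi> (m x y)) \<one> x = \<phi> x" for x
  proof -
    have "cact2 \<Delta>r rX \<chi>' (\<lambda>x y. \<phi> (m x y)) \<one> x = cact1 rX (\<chi>' \<one>) (\<lambda>y. \<phi> (m \<one> y)) x"
      unfolding cact2_def sw_swapl
      by (rule comult_of_unit; unfold cact1_def; intro lin bil_lin[OF b])
    also have "\<dots> = \<phi> x" using assms(2) \<phi> by (simp add: cact1_def \<chi>'_unit_left assms(4) bicomodule_def)
    finally show ?thesis .
  qed
  have B: "bil sH sX (*) (cact2 \<Delta>r rX \<chi>' (\<lambda>x y. \<phi> (m x y)))"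
    using bicomodule_H co(2) \<chi>'_bil b by (intro cact2_bil) (auto simp: bicomodule_def)
  have "\<phi> (m' \<one> x) = cact2 \<Delta> lX \<chi> (cact2 \<Delta>r rX \<chi>' (\<lambda>x y. \<phi> (m x y))) \<one> x"
    using twistedD[OF assms(1) \<phi>] by (simp add: fun_eq_iff)
  also have "\<dots> = cact1 lX (\<chi> \<one>) (cact2 \<Delta>r rX \<chi>' (\<lambda>x y. \<phi> (m x y)) \<one>) x"
    unfolding cact2_def[of \<Delta>]
    by (rule comult_of_unit; unfold cact1_def; intro lin bil_lin[OF B])
  also have "\<dots> = \<phi> x" using assms(2) \<phi> by (simp add: cact1_def \<chi>_unit_left 2[abs_def] bicomodule_def)
  finally show "\<phi> (m' \<one> x) = \<phi> x" .
qed

lemma twist_unit_right: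
  assumes "twisted sX lX rX \<Delta> \<Delta>r m m'" "bicomodule H sX lX rX" "bil sX sH sX m" "\<And>x. m x \<one> = x"
  shows "m' x \<one> = x"
proof (rule eq_by_functionals[of sX])
  show "vector_space sX" using assms(2) by (simp add: bicomodule_def)
  fix \<phi> :: "_ \<Rightarrow> 'k" assume \<phi>: "lin sX (*) \<phi>"
  have co: "comodule sH \<Delta> sX lX" "comodule sH \<Delta>r sX rX" using assms(2) by (auto simp: bicomodule_def)
  have b: "bil sX sH (*) (\<lambda>x y. \<phi> (m x y))"
    by (intro bilI lin_compose[OF \<phi>] lin bil_lin[OF assms(3)])
  have 2: "cact2 rX \<Delta>r \<chi>' (\<lambda>x y. \<phi> (m x y)) x \<one> = \<phi> x" for x
  proof -
    have "cact2 rX \<Delta>r \<chi>' (\<lambda>x y. \<phi> (m x y)) x \<one> = sw (rX x) (\<lambda>a \<xi>. \<chi>' a \<one> * \<phi> (m \<xi> \<one>))"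
      unfolding cact2_def cact1_def sw_swapl
      by (rule sw_eqI, rule comult_of_unit; intro lin bil_lin[OF b])
    also have "\<dots> = \<phi> x" using assms(2) \<phi> by (simp add: \<chi>'_unit_right assms(4) bicomodule_def)
    finally show ?thesis .
  qed
  have B: "bil sX sH (*) (cact2 rX \<Delta>r \<chi>' (\<lambda>x y. \<phi> (m x y)))"
    using bicomodule_H co(2) \<chi>'_bil b by (intro cact2_bil) (auto simp: bicomodule_def)
  have "\<phi> (m' x \<one>) = cact2 lX \<Delta> \<chi> (cact2 rX \<Delta>r \<chi>' (\<lambda>x y. \<phi> (m x y))) x \<one>"
    using twistedD[OF assms(1) \<phi>] by (simp add: fun_eq_iff)
  also have "\<dots> = sw (lX x) (\<lambda>a \<xi>. \<chi> a \<one> * cact2 rX \<Delta>r \<chi>' (\<lambda>x y. \<phi> (m x y)) \<xi> \<one>)"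
    unfolding cact2_def[of lX] cact1_def[of \<Delta>]
    by (rule sw_eqI, rule comult_of_unit; intro lin bil_lin[OF B])
  also have "\<dots> = \<phi> x" using assms(2) \<phi> by (simp add: \<chi>_unit_right 2 bicomodule_def)
  finally show "\<phi> (m' x \<one>) = \<phi> x" .
qed

theorem hopf_algebra_twist: "hopf_algebra Hx"
proof (intro hopf_algebra.intro, unfold twist_hopf_simps)
  show "bil sH sH sH (\<bullet>)"
    by (rule twisted_bil[OF twisted_mult bicomodule_H bicomodule_H vector_space_H mult_bilinear])
  show "(x \<bullet> y) \<bullet> z = x \<bullet> (y \<bullet> z)" for x y z
    by (rule twisted_assoc[OF bicomodule_H bicomodule_H bicomodule_H bicomodule_H bicomodule_H bicomodule_H
      twisted_mult twisted_mult twisted_mult twisted_mult mult_bilinear mult_bilinear mult_bilinear mult_bilinear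
      colinear_mult colinear_mult_right colinear_mult colinear_mult_right mult_assoc])
  show "\<one> \<bullet> x = x" for x
    by (rule twist_unit_left[OF twisted_mult bicomodule_H mult_bilinear unit_left])
  show "x \<bullet> \<one> = x" for x
    by (rule twist_unit_right[OF twisted_mult bicomodule_H mult_bilinear unit_right])
  show "tensor_eq sH sH (\<Delta> (x \<bullet> y)) [(a \<bullet> c, b \<bullet> d). (a, b) \<leftarrow> \<Delta> x, (c, d) \<leftarrow> \<Delta> y]" for x y
    using twisted_colinear(1)[OF twisted_mult bicomodule_H bicomodule_H bicomodule_H mult_bilinear colinear_mult colinear_mult_right]
    by (intro tensor_eqI) (simp add: sw_compr)
  show "\<epsilon> (x \<bullet> y) = \<epsilon> x * \<epsilon> y" for x y
  proof -
    have "(\<lambda>x y. \<epsilon> (x \<bullet> y)) = conv2 \<chi> (conv2 eps2 \<chi>')"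
      unfolding twisted_mult_conv[OF counit_linear] counit_mult ..
    also have "\<dots> = eps2" by (simp only: conv2_unit \<chi>'_bil \<chi>_\<chi>')
    finally show ?thesis by (simp add: fun_eq_iff)
  qed
  show "lin sH sH Sx"
  proof (intro linI; rule eq_by_functionals[OF vector_space_H])
    fix x y c and \<phi> :: "'h \<Rightarrow> 'k" assume \<phi>: "lin1 \<phi>"
    have "lin1 (\<lambda>h. \<phi> (Sx h))"
      unfolding antipode_twist[OF \<phi>] by (intro lin lin_compose[OF \<phi>])
    from lin_add[OF this] lin_scale[OF this]
    show "\<phi> (Sx (x + y)) = \<phi> (Sx x + Sx y)" "\<phi> (Sx (sH c x)) = \<phi> (sH c (Sx x))"
      by (simp_all add: lin_add[OF \<phi>] lin_scale[OF \<phi>])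
  qed
  show "(\<Sum>(a, b)\<leftarrow>\<Delta> h. Sx a \<bullet> b) = sH (\<epsilon> h) \<one>" for h
    unfolding sw_def[symmetric]
    by (rule eq_by_functionals[OF vector_space_H]) (simp add: lin_sw lin_scale antipode_twist_left)
  show "(\<Sum>(a, b)\<leftarrow>\<Delta> h. a \<bullet> Sx b) = sH (\<epsilon> h) \<one>" for h
    unfolding sw_def[symmetric]
    by (rule eq_by_functionals[OF vector_space_H]) (simp add: lin_sw lin_scale antipode_twist_right)
qed (rule vector_space_H comult_linear coassoc counit_linear counit_left counit_right comult_unit
  counit_unit antipode_twist_bij)+

end

section \<open>The twisted calculus\<close>

text \<open>A bicovariant calculus over a Hopf algebra with a cocycle.\<close>

locale calculus_twist = cocycle_twist H \<chi> \<chi>' + bicovariant_calculus H \<Omega>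
  for H :: "('k::field, 'h::ab_group_add) hopf" (structure) and \<chi> \<chi>'
    and \<Omega> :: "('k, 'h, 'w::ab_group_add) calculus"
begin

abbreviation "sW \<equiv> form_scale \<Omega>"
abbreviation "lc \<equiv> lcoact \<Omega>"
abbreviation "rc \<equiv> swapl (rcoact \<Omega>)"
abbreviation "d \<equiv> diff \<Omega>"
abbreviation "\<Omega>x \<equiv> twist_calculus H \<chi> \<Omega>"

lemma twist_calculus_simps [simp]:
  "form_scale \<Omega>x = sW" "lcoact \<Omega>x = lc" "rcoact \<Omega>x = rcoact \<Omega>" "diff \<Omega>x = d"
  by (simp_all add: twist_calculus_def)

lemma lc_lin:
  assumes "bil sH sW ((*) :: 'k \<Rightarrow> 'k \<Rightarrow> 'k) F" shows "lin sW (*) (\<lambda>x. sw (lc x) F)"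
proof -
  interpret vector_space sW by (rule vector_space_\<Omega>)
  show ?thesis
    by (rule tensor_linear_onD[OF lcoact_linear vector_space_\<Omega> subspace_UNIV subspace_UNIV vector_space_\<Omega> _ assms]) auto
qed

lemma rc_lin:
  assumes F: "bil sH sW ((*) :: 'k \<Rightarrow> 'k \<Rightarrow> 'k) F" shows "lin sW (*) (\<lambda>x. sw (rc x) F)"
proof -
  interpret vector_space sH by (rule vector_space_H)
  interpret W: vector_space sW by (rule vector_space_\<Omega>)
  have "bil sW sH (*) (\<lambda>a b. F b a)"
    by (intro bilI lin bil_lin[OF F])
  then show ?thesis unfolding sw_swapl
    by (intro tensor_linear_onD[OF rcoact_linear vector_space_H subspace_UNIV W.subspace_UNIV vector_space_\<Omega>]) auto
qed

lemma bicomodule_\<Omega>: "bicomodule H sW lc rc"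
  unfolding bicomodule_def comodule_def commuting_def
proof (intro conjI allI impI vector_space_\<Omega>)
  fix F :: "'h \<Rightarrow> 'w \<Rightarrow> 'k" assume "bil sH sW (*) F"
  then show "lin sW (*) (\<lambda>x. sw (lc x) F)" "lin sW (*) (\<lambda>x. sw (rc x) F)"
    by (rule lc_lin rc_lin)+
next
  fix F :: "'h \<Rightarrow> 'h \<Rightarrow> 'w \<Rightarrow> 'k" and x assume F: "tril sH sH sW (*) F"
  note [lin] = tril_lin[OF F]
  show "sw (lc x) (\<lambda>p \<xi>. D p (\<lambda>a b. F a b \<xi>)) = sw (lc x) (\<lambda>a y. sw (lc y) (F a))"
    using lcoact_coassoc[of x] F unfolding tensor3_eq_iff sum_compr_left sum_compr_right by blast
  have "tril sW sH sH (*) (\<lambda>\<eta> b a. F a b \<eta>)" by (intro trilI lin)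
  then show "sw (rc x) (\<lambda>p \<xi>. sw (\<Delta>r p) (\<lambda>a b. F a b \<xi>)) = sw (rc x) (\<lambda>a y. sw (rc y) (F a))"
    using rcoact_coassoc[of x] unfolding tensor3_eq_iff sum_compr_left sum_compr_right sw_swapl by simp
  have "tril sH sW sH (*) (\<lambda>a \<eta> b. F a b \<eta>)" by (intro trilI lin)
  then show "sw (lc x) (\<lambda>a \<xi>. sw (rc \<xi>) (\<lambda>b \<eta>. F a b \<eta>)) = sw (rc x) (\<lambda>b \<xi>. sw (lc \<xi>) (\<lambda>a \<eta>. F a b \<eta>))"
    using lcoact_rcoact[of x] unfolding tensor3_eq_iff sum_compr_left sum_compr_right sw_swapl by simp
next
  fix \<phi> :: "'w \<Rightarrow> 'k" and x assume \<phi>: "lin sW (*) \<phi>"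
  show "sw (lc x) (\<lambda>a \<xi>. \<epsilon> a * \<phi> \<xi>) = \<phi> x"
    using arg_cong[OF lcoact_counit[of x, folded sw_def], of \<phi>] by (simp add: lin_sw[OF \<phi>] lin_scale[OF \<phi>])
  show "sw (rc x) (\<lambda>a \<xi>. \<epsilon> a * \<phi> \<xi>) = \<phi> x"
    using arg_cong[OF rcoact_counit[of x, folded sw_def], of \<phi>] by (simp add: lin_sw[OF \<phi>] lin_scale[OF \<phi>] sw_swapl)
qed

lemma colinear_acts:
  shows colinear_lact: "colinear sW \<Delta> lc lc (lact \<Omega>)" "colinear sW \<Delta>r rc rc (lact \<Omega>)"
    and colinear_ract: "colinear sW lc \<Delta> lc (ract \<Omega>)" "colinear sW rc \<Delta>r rc (ract \<Omega>)"
proof -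
  have sym: "bil sW sH (*) (\<lambda>a b. F b a)" if "bil sH sW (*) F" for F :: "'h \<Rightarrow> 'w \<Rightarrow> 'k"
    by (intro bilI lin bil_lin[OF that])
  show "colinear sW \<Delta> lc lc (lact \<Omega>)" "colinear sW lc \<Delta> lc (ract \<Omega>)"
    using tensor_eqD[OF lcoact_lact] tensor_eqD[OF lcoact_ract] by (simp_all add: colinear_def sw_compr)
  show "colinear sW \<Delta>r rc rc (lact \<Omega>)" "colinear sW rc \<Delta>r rc (ract \<Omega>)"
    using tensor_eqD[OF rcoact_lact sym] tensor_eqD[OF rcoact_ract sym] by (simp_all add: colinear_def sw_compr sw_swapl)
qed

lemma bicoact_sum: "(\<Sum>(a, \<eta>, b)\<leftarrow>bicoact \<Omega> \<omega>. f a \<eta> b) = sw (lc \<omega>) (\<lambda>a \<xi>. sw (rcoact \<Omega> \<xi>) (\<lambda>\<eta> b. f a \<eta> b))"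
  unfolding bicoact_def by (rule sum_compr_right)

lemma twisted_lact: "twisted sW \<Delta> \<Delta>r lc rc (lact \<Omega>) (lact \<Omega>x)"
  and twisted_ract: "twisted sW lc rc \<Delta> \<Delta>r (ract \<Omega>) (ract \<Omega>x)"
  unfolding twisted_def cact2_nested[symmetric] sw_swapl
proof (safe)
  fix \<phi> :: "'w \<Rightarrow> 'k" and x y assume \<phi>: "lin sW (*) \<phi>"
  show "\<phi> (lact \<Omega>x x y) = D x (\<lambda>a \<xi>. D \<xi> (\<lambda>\<eta> b. sw (lc y) (\<lambda>c \<zeta>. sw (rcoact \<Omega> \<zeta>) (\<lambda>\<theta> d. \<chi> a c * \<chi>' b d * \<phi> (lact \<Omega> \<eta> \<theta>)))))"
    by (simp add: twist_calculus_def comult3_sum bicoact_sum conv_inverse2_eq lin_sw[OF \<phi>] lin_scale[OF \<phi>])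
next
  fix \<phi> :: "'w \<Rightarrow> 'k" and x y assume \<phi>: "lin sW (*) \<phi>"
  show "\<phi> (ract \<Omega>x x y) = sw (lc x) (\<lambda>a \<xi>. sw (rcoact \<Omega> \<xi>) (\<lambda>\<eta> b. D y (\<lambda>c \<zeta>. D \<zeta> (\<lambda>\<theta> d. \<chi> a c * \<chi>' b d * \<phi> (ract \<Omega> \<eta> \<theta>)))))"
    by (simp add: twist_calculus_def comult3_sum bicoact_sum conv_inverse2_eq lin_sw[OF \<phi>] lin_scale[OF \<phi>])
qed

lemma lc_diff: "bil sH sW ((*) :: 'k \<Rightarrow> 'k \<Rightarrow> 'k) F \<Longrightarrow> sw (lc (d h)) F = D h (\<lambda>a b. F a (d b))"
  using tensor_eqD[OF lcoact_diff[of h], of F] by (simp add: sw_map_prod)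

lemma rc_diff:
  assumes "bil sH sW ((*) :: 'k \<Rightarrow> 'k \<Rightarrow> 'k) F" shows "sw (rc (d h)) F = sw (\<Delta>r h) (\<lambda>a b. F a (d b))"
proof -
  have "bil sW sH (*) (\<lambda>a b. F b a)" by (intro bilI lin bil_lin[OF assms])
  from tensor_eqD[OF rcoact_diff[of h] this] show ?thesis by (simp add: sw_map_prod sw_swapl)
qed

text \<open>As \<open>d\<close> is a map of bicomodules, the twisted products \<open>h \<bullet> d g\<close> and \<open>d h \<bullet> g\<close> are the twists of
  \<open>h d g\<close> and \<open>d h g\<close>, viewed as maps on \<open>H \<otimes> H\<close>.\<close>

lemma twist_lact_diff:
  assumes \<phi>: "lin sW (*) \<phi>"
  shows "(\<lambda>h g. \<phi> (lact \<Omega>x h (d g))) = conv2 \<chi> (conv2 (\<lambda>h g. \<phi> (lact \<Omega> h (d g))) \<chi>')"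
proof (intro ext)
  fix h g
  have b: "bil sH sW (*) (\<lambda>h \<omega>. \<phi> (lact \<Omega> h \<omega>))"
    by (intro bilI lin_compose[OF \<phi>] lin bil_lin[OF lact_bilinear])
  let ?B = "cact2 \<Delta>r rc \<chi>' (\<lambda>h \<omega>. \<phi> (lact \<Omega> h \<omega>))"
  have B: "bil sH sW (*) ?B"
    using bicomodule_H bicomodule_\<Omega> \<chi>'_bil b by (intro cact2_bil) (auto simp: bicomodule_def)
  note [lin] = bil_lin[OF b] bil_lin[OF B]
  have "\<phi> (lact \<Omega>x h (d g)) = cact2 \<Delta> lc \<chi> ?B h (d g)"
    using twistedD[OF twisted_lact \<phi>] by (simp add: fun_eq_iff)
  also have "\<dots> = D h (\<lambda>a h'. D g (\<lambda>c g'. \<chi> a c * ?B h' (d g')))"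
    unfolding cact2_def[of \<Delta>] cact1_def by (rule sw_eqI, rule lc_diff; intro bilI lin)
  also have "\<dots> = conv2 \<chi> (\<lambda>h g. ?B h (d g)) h g"
    by (simp add: cact2_def cact1_def)
  also have "(\<lambda>h g. ?B h (d g)) = cact2 \<Delta>r \<Delta>r \<chi>' (\<lambda>h g. \<phi> (lact \<Omega> h (d g)))"
    unfolding cact2_def[of \<Delta>r] cact1_def by (intro ext sw_eqI, rule rc_diff; intro bilI lin)
  finally show "\<phi> (lact \<Omega>x h (d g)) = conv2 \<chi> (conv2 (\<lambda>h g. \<phi> (lact \<Omega> h (d g))) \<chi>') h g"
    by (simp only: cact2_swapl)
qed

lemma twist_ract_diff:
  assumes \<phi>: "lin sW (*) \<phi>"
  shows "(\<lambda>h g. \<phi> (ract \<Omega>x (d h) g)) = conv2 \<chi> (conv2 (\<lambda>h g. \<phi> (ract \<Omega> (d h) g)) \<chi>')"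
proof (intro ext)
  fix h g
  have b: "bil sW sH (*) (\<lambda>\<omega> h. \<phi> (ract \<Omega> \<omega> h))"
    by (intro bilI lin_compose[OF \<phi>] lin bil_lin[OF ract_bilinear])
  let ?B = "cact2 rc \<Delta>r \<chi>' (\<lambda>\<omega> h. \<phi> (ract \<Omega> \<omega> h))"
  have B: "bil sW sH (*) ?B"
    using bicomodule_H bicomodule_\<Omega> \<chi>'_bil b by (intro cact2_bil) (auto simp: bicomodule_def)
  note [lin] = bil_lin[OF b] bil_lin[OF B]
  have "\<phi> (ract \<Omega>x (d h) g) = cact2 lc \<Delta> \<chi> ?B (d h) g"
    using twistedD[OF twisted_ract \<phi>] by (simp add: fun_eq_iff)
  also have "\<dots> = D h (\<lambda>a h'. D g (\<lambda>c g'. \<chi> a c * ?B (d h') g'))"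
    unfolding cact2_def[of lc] cact1_def by (rule lc_diff; intro bilI lin)
  also have "\<dots> = conv2 \<chi> (\<lambda>h g. ?B (d h) g) h g"
    by (simp add: cact2_def cact1_def)
  also have "(\<lambda>h g. ?B (d h) g) = cact2 \<Delta>r \<Delta>r \<chi>' (\<lambda>h g. \<phi> (ract \<Omega> (d h) g))"
    unfolding cact2_def[of rc] cact2_def[of \<Delta>r] cact1_def
    by (intro ext, rule rc_diff; intro bilI lin; unfold sw_swapl; intro lin)
  finally show "\<phi> (ract \<Omega>x (d h) g) = conv2 \<chi> (conv2 (\<lambda>h g. \<phi> (ract \<Omega> (d h) g)) \<chi>') h g"
    by (simp only: cact2_swapl)
qed

lemma sw_in_span:
  assumes "vector_space s" "\<And>a b. f a b \<in> module.span s R" shows "sw xs f \<in> module.span s R"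
proof -
  interpret V: vector_space s by fact
  show ?thesis
  proof (induction xs)
    case Nil
    show ?case by (simp add: V.span_zero)
  next
    case (Cons p xs)
    then show ?case using V.span_add[OF assms(2)] by (cases p) simp
  qed
qed

lemma twist_diff_span: "module.span sW {lact \<Omega>x h (d g) | h g. True} = UNIV"
proof -
  interpret W: vector_space sW by (rule vector_space_\<Omega>)
  let ?R = "{lact \<Omega>x h (d g) | h g. True}"
  have "lact \<Omega> h (d g) \<in> W.span ?R" for h g
  proof -
    \<comment> \<open>Twisting back with \<open>\<chi>\<inverse>\<close> writes \<open>h d g\<close> as \<open>\<chi>\<inverse>(h\<^bsub>(1)\<^esub> \<otimes> g\<^bsub>(1)\<^esub>) h\<^bsub>(2)\<^esub> \<bullet> d g\<^bsub>(2)\<^esub> \<chi>(h\<^bsub>(3)\<^esub> \<otimes> g\<^bsub>(3)\<^esub>)\<close>.\<close>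
    let ?u = "D h (\<lambda>h1 x. D x (\<lambda>h2 h3. D g (\<lambda>g1 y. D y (\<lambda>g2 g3. sW (\<chi>' h1 g1 * \<chi> h3 g3) (lact \<Omega>x h2 (d g2))))))"
    have "?u = lact \<Omega> h (d g)"
    proof (rule eq_by_functionals[OF vector_space_\<Omega>])
      fix \<phi> :: "'w \<Rightarrow> 'k" assume \<phi>: "lin sW (*) \<phi>"
      let ?\<beta> = "\<lambda>h g. \<phi> (lact \<Omega> h (d g))"
      have b: "bil2 ?\<beta>"
        by (intro bilI lin_compose[OF \<phi>] lin bil_lin[OF lact_bilinear] lin_compose[OF diff_linear])
      note bl = \<chi>_bil \<chi>'_bil b conv2_bil
      have "\<phi> ?u = cact2 \<Delta> \<Delta> \<chi>' (cact2 \<Delta>r \<Delta>r \<chi> (\<lambda>h g. \<phi> (lact \<Omega>x h (d g)))) h g"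
        unfolding cact2_nested[symmetric] sw_swapl by (simp add: lin_sw[OF \<phi>] lin_scale[OF \<phi>])
      also have "\<dots> = conv2 \<chi>' (conv2 (conv2 \<chi> (conv2 ?\<beta> \<chi>')) \<chi>) h g"
        by (simp only: cact2_swapl twist_lact_diff[OF \<phi>])
      also have "conv2 (conv2 \<chi> (conv2 ?\<beta> \<chi>')) \<chi> = conv2 \<chi> ?\<beta>"
        by (simp only: conv2_assoc[symmetric] bl \<chi>'_\<chi> conv2_unit)
      also have "conv2 \<chi>' (conv2 \<chi> ?\<beta>) = ?\<beta>"
        by (simp only: conv2_assoc bl \<chi>'_\<chi> conv2_unit)
      finally show "\<phi> ?u = \<phi> (lact \<Omega> h (d g))" .
    qed
    moreover have "?u \<in> W.span ?R"
      by (intro sw_in_span[OF vector_space_\<Omega>] W.span_scale W.span_base) blast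
    ultimately show ?thesis by simp
  qed
  then have "{lact \<Omega> h (d g) | h g. True} \<subseteq> W.span ?R" by auto
  then have "W.span {lact \<Omega> h (d g) | h g. True} \<subseteq> W.span ?R"
    by (rule W.span_minimal) (rule W.subspace_span)
  then show ?thesis unfolding diff_span by (rule top_le)
qed

theorem bicovariant_calculus_twist: "bicovariant_calculus Hx \<Omega>x"
proof (intro bicovariant_calculus.intro hopf_algebra_twist bicovariant_calculus_axioms.intro,
    unfold twist_hopf_simps twist_calculus_simps)
  show "bil sH sW sW (lact \<Omega>x)"
    by (rule twisted_bil[OF twisted_lact bicomodule_H bicomodule_\<Omega> vector_space_\<Omega> lact_bilinear])
  show "bil sW sH sW (ract \<Omega>x)"
    by (rule twisted_bil[OF twisted_ract bicomodule_\<Omega> bicomodule_H vector_space_\<Omega> ract_bilinear])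
  fix h g \<omega>
  show "lact \<Omega>x \<one> \<omega> = \<omega>" by (rule twist_unit_left[OF twisted_lact bicomodule_\<Omega> lact_bilinear lact_unit])
  show "ract \<Omega>x \<omega> \<one> = \<omega>" by (rule twist_unit_right[OF twisted_ract bicomodule_\<Omega> ract_bilinear ract_unit])
  show "lact \<Omega>x (h \<bullet> g) \<omega> = lact \<Omega>x h (lact \<Omega>x g \<omega>)"
    by (rule twisted_assoc[OF bicomodule_H bicomodule_H bicomodule_\<Omega> bicomodule_H bicomodule_\<Omega> bicomodule_\<Omega>
      twisted_mult twisted_lact twisted_lact twisted_lact mult_bilinear lact_bilinear lact_bilinear lact_bilinear
      colinear_mult colinear_mult_right colinear_lact lact_mult])
  show "ract \<Omega>x \<omega> (h \<bullet> g) = ract \<Omega>x (ract \<Omega>x \<omega> h) g"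
    by (rule twisted_assoc[OF bicomodule_\<Omega> bicomodule_H bicomodule_H bicomodule_\<Omega> bicomodule_H bicomodule_\<Omega>
      twisted_ract twisted_ract twisted_mult twisted_ract ract_bilinear ract_bilinear mult_bilinear ract_bilinear
      colinear_ract colinear_mult colinear_mult_right ract_mult[symmetric], symmetric])
  show "ract \<Omega>x (lact \<Omega>x h \<omega>) g = lact \<Omega>x h (ract \<Omega>x \<omega> g)"
    by (rule twisted_assoc[OF bicomodule_H bicomodule_\<Omega> bicomodule_H bicomodule_\<Omega> bicomodule_\<Omega> bicomodule_\<Omega>
      twisted_lact twisted_ract twisted_ract twisted_lact lact_bilinear ract_bilinear ract_bilinear lact_bilinear
      colinear_lact colinear_ract lact_ract])
  note Lact = twisted_colinear[OF twisted_lact bicomodule_H bicomodule_\<Omega> bicomodule_\<Omega> lact_bilinear colinear_lact]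
  note Ract = twisted_colinear[OF twisted_ract bicomodule_\<Omega> bicomodule_H bicomodule_\<Omega> ract_bilinear colinear_ract]
  show "tensor_eq sH sW (lc (lact \<Omega>x h \<omega>)) [(h1 \<bullet> a, lact \<Omega>x h2 \<eta>). (h1, h2) \<leftarrow> \<Delta> h, (a, \<eta>) \<leftarrow> lc \<omega>]"
    by (rule tensor_eqI, unfold sw_compr, rule Lact)
  show "tensor_eq sH sW (lc (ract \<Omega>x \<omega> h)) [(a \<bullet> h1, ract \<Omega>x \<eta> h2). (a, \<eta>) \<leftarrow> lc \<omega>, (h1, h2) \<leftarrow> \<Delta> h]"
    by (rule tensor_eqI, unfold sw_compr, rule Ract)
  have sym: "bil sH sW (*) (\<lambda>a b. F b a)" if "bil sW sH (*) F" for F :: "'w \<Rightarrow> 'h \<Rightarrow> 'k"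
    by (intro bilI lin bil_lin[OF that])
  show "tensor_eq sW sH (rcoact \<Omega> (lact \<Omega>x h \<omega>)) [(lact \<Omega>x h1 \<eta>, h2 \<bullet> a). (h1, h2) \<leftarrow> \<Delta> h, (\<eta>, a) \<leftarrow> rcoact \<Omega> \<omega>]"
    by (rule tensor_eqI, unfold sw_compr) (use Lact(2)[OF sym] in \<open>simp add: sw_swapl\<close>)
  show "tensor_eq sW sH (rcoact \<Omega> (ract \<Omega>x \<omega> h)) [(ract \<Omega>x \<eta> h1, a \<bullet> h2). (\<eta>, a) \<leftarrow> rcoact \<Omega> \<omega>, (h1, h2) \<leftarrow> \<Delta> h]"
    by (rule tensor_eqI, unfold sw_compr) (use Ract(2)[OF sym] in \<open>simp add: sw_swapl\<close>)
  show "d (h \<bullet> g) = ract \<Omega>x (d h) g + lact \<Omega>x h (d g)"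
  proof (rule eq_by_functionals[OF vector_space_\<Omega>])
    fix \<phi> :: "'w \<Rightarrow> 'k" assume \<phi>: "lin sW (*) \<phi>"
    have \<phi>d: "lin1 (\<lambda>h. \<phi> (d h))" by (intro lin_compose[OF \<phi>] diff_linear)
    have add: "conv2 \<chi> (conv2 (\<lambda>h g. \<beta> h g + \<gamma> h g) \<chi>') h g
        = conv2 \<chi> (conv2 \<beta> \<chi>') h g + conv2 \<chi> (conv2 \<gamma> \<chi>') h g" for \<beta> \<gamma> h g
      by (simp add: cact2_def cact1_def distrib_left distrib_right sw_add)
    have "\<phi> (d (h \<bullet> g)) = conv2 \<chi> (conv2 (\<lambda>h g. \<phi> (d (h \<cdot> g))) \<chi>') h g"
      using twisted_mult_conv[OF \<phi>d] by (simp add: fun_eq_iff)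
    also have "\<dots> = \<phi> (ract \<Omega>x (d h) g) + \<phi> (lact \<Omega>x h (d g))"
      unfolding diff_mult lin_add[OF \<phi>] add
      using twist_ract_diff[OF \<phi>] twist_lact_diff[OF \<phi>] by (simp add: fun_eq_iff)
    finally show "\<phi> (d (h \<bullet> g)) = \<phi> (ract \<Omega>x (d h) g + lact \<Omega>x h (d g))" by (simp add: lin_add[OF \<phi>])
  qed
qed (rule vector_space_\<Omega> lcoact_linear lcoact_coassoc lcoact_counit rcoact_linear rcoact_coassoc
  rcoact_counit lcoact_rcoact diff_linear lcoact_diff rcoact_diff twist_diff_span)+

end

section \<open>The comparison map\<close>

context hopf_algebra
begin

abbreviation "la \<equiv> coact (regular_crossed H)"

lemma comodule_ad: "comodule sH \<Delta> sH la"
  unfolding comodule_def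
proof (intro conjI allI impI)
  fix F assume "bil2 F"
  note [lin] = bil_lin[OF this]
  show "lin1 (\<lambda>x. ad x F)" by (intro lin)
next
  fix F x assume "tril3 F"
  note [lin] = tril_lin[OF this]
  show "ad x (\<lambda>p \<xi>. D p (\<lambda>a b. F a b \<xi>)) = ad x (\<lambda>a y. ad y (F a))"
    by (rule ad_coassoc; intro lin)
qed

lemma ad_counit2:
  assumes "bil2 \<beta>" shows "cact2 la \<Delta> eps2 \<beta> = \<beta>"
proof (intro ext)
  fix x y
  note [lin] = bil_lin[OF assms]
  have "cact2 la \<Delta> eps2 \<beta> x y = ad x (\<lambda>a \<xi>. \<epsilon> a * D y (\<lambda>c \<eta>. \<epsilon> c * \<beta> \<xi> \<eta>))"
    by (simp add: cact2_def cact1_def sw_mult_left mult.assoc)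
  also have "\<dots> = ad x (\<lambda>a \<xi>. \<epsilon> a * \<beta> \<xi> y)"
    by (rule sw_eqI, rule arg_cong[where f = "(*) _"], rule comult_counit_left; intro lin)
  also have "\<dots> = \<beta> x y" by (rule ad_counit; intro lin)
  finally show "cact2 la \<Delta> eps2 \<beta> x y = \<beta> x y" .
qed

text \<open>The compatibility of action and coaction at \<open>1\<close>:
  \<open>q\<^bsub>(1)\<^esub> \<otimes> q\<^bsub>(2)\<^esub> = (q\<^bsub>(1)\<^esub>)\<^bsub>(-1)\<^esub> q\<^bsub>(2)\<^esub> \<otimes> (q\<^bsub>(1)\<^esub>)\<^bsub>(0)\<^esub>\<close>, with \<open>(-1)\<close> and \<open>(0)\<close> the legs of the adjoint coaction.\<close>

lemma ad_act_unit:
  assumes "bil2 N" shows "D q (\<lambda>a b. ad a (\<lambda>p z. N (p \<cdot> b) z)) = D q N"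
proof -
  note [lin] = bil_lin[OF assms]
  have "D q (\<lambda>a b. ad a (\<lambda>p z. N (p \<cdot> b) z)) = D q (\<lambda>a b. ad (a \<cdot> \<one>) (\<lambda>p z. N (p \<cdot> b) z))"
    by (simp add: unit_right)
  also have "\<dots> = D q (\<lambda>a b. ad \<one> (\<lambda>p z. N (a \<cdot> p) (b \<cdot> z)))"
    by (rule ad_act[symmetric]; intro lin)
  also have "\<dots> = D q (\<lambda>a b. N (a \<cdot> \<one>) (b \<cdot> \<one>))"
    by (rule sw_eqI, rule ad_unit; intro lin)
  finally show ?thesis by (simp add: unit_right)
qed

lemma ad_insert:
  assumes "tril3 T"
  shows "D g (\<lambda>s y. D y (\<lambda>t v. T s t v)) = D g (\<lambda>a y. D y (\<lambda>b v. ad a (\<lambda>p z. T (p \<cdot> b) z v)))"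
proof -
  note [lin] = tril_lin[OF assms]
  have "D g (\<lambda>s y. D y (\<lambda>t v. T s t v)) = D g (\<lambda>k v. D k (\<lambda>s t. T s t v))"
    by (rule comult_assoc[symmetric]; intro lin)
  also have "\<dots> = D g (\<lambda>k v. D k (\<lambda>a b. ad a (\<lambda>p z. T (p \<cdot> b) z v)))"
    by (rule sw_eqI, rule ad_act_unit[symmetric]; intro bilI lin)
  also have "\<dots> = D g (\<lambda>a y. D y (\<lambda>b v. ad a (\<lambda>p z. T (p \<cdot> b) z v)))"
    by (rule comult_assoc; intro lin)
  finally show ?thesis .
qed

end

context cocycle_twist
begin

abbreviation "\<alpha> \<equiv> twist_alpha H \<chi>"
abbreviation "\<alpha>i \<equiv> twist_alpha_inv H \<chi>"

text \<open>On functionals, \<open>\<alpha>\<close> is convolution with \<open>U\<close> followed by wrapping with \<open>\<chi>\<inverse>\<close>, and \<open>\<alpha>\<inverse>\<close> is wrapping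
  with \<open>\<chi>\<close> followed by convolution with \<open>U\<inverse>\<close>.\<close>

lemma alpha_functional:
  assumes "lin1 \<phi>" shows "\<phi> (\<alpha> h) = wrap \<chi>' (conv1 \<phi> U) h"
proof -
  note [lin] = lin_compose[OF assms]
  let ?G = "\<lambda>a m c e b. \<chi>' a (S b) * \<chi> c (S e) * \<phi> m"
  have "\<phi> (\<alpha> h) = D h (\<lambda>a x. D x (\<lambda>m y. D y (\<lambda>c z. D z (\<lambda>e b. ?G a m c e b))))"
    by (simp add: twist_alpha_def comult5_sum lin_sw[OF assms] lin_scale[OF assms] conv_inverse2_eq)
  also have "\<dots> = D h (\<lambda>a x. D x (\<lambda>m y. D y (\<lambda>u b. D u (\<lambda>c e. ?G a m c e b))))"
    by (rule sw_eqI, rule sw_eqI, rule comult_assoc[symmetric]; intro lin)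
  also have "\<dots> = D h (\<lambda>a x. D x (\<lambda>w b. D w (\<lambda>m u. D u (\<lambda>c e. ?G a m c e b))))"
    by (rule sw_eqI, rule comult_assoc[symmetric]; intro lin)
  also have "\<dots> = wrap \<chi>' (conv1 \<phi> U) h"
    by (simp add: wrap_def[of \<chi>'] cact1_def U_def wrap_counit[OF \<chi>_bil] sw_mult_left ac_simps)
  finally show ?thesis .
qed

lemma alpha_inv_functional:
  assumes "lin1 \<phi>" shows "\<phi> (\<alpha>i h) = conv1 (wrap \<chi> \<phi>) U' h"
proof -
  have "\<phi> (\<alpha>i h) = wrap3 (join12 \<chi>') \<phi> h"
    by (simp add: twist_alpha_inv_def comult4_sum lin_sw[OF assms] lin_scale[OF assms] conv_inverse2_eq wrap3_def)
  then show ?thesis by (simp add: wrap3_join12[OF assms])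
qed

text \<open>In terms of the adjoint coaction, \<open>\<alpha>\<inverse>(h) = \<chi>\<inverse>((h\<^bsub>(1)\<^esub>)\<^bsub>(-1)\<^esub> \<otimes> h\<^bsub>(2)\<^esub>) (h\<^bsub>(1)\<^esub>)\<^bsub>(0)\<^esub>\<close>.\<close>

lemma alpha_inv_ad:
  assumes "lin1 \<phi>" shows "\<phi> (\<alpha>i h) = D h (\<lambda>a c. ad a (\<lambda>p z. \<chi>' p c * \<phi> z))"
proof -
  note [lin] = lin_compose[OF assms]
  have "\<phi> (\<alpha>i h) = D h (\<lambda>a x. D x (\<lambda>m y. D y (\<lambda>b c. \<chi>' (a \<cdot> S b) c * \<phi> m)))"
    by (simp add: twist_alpha_inv_def comult4_sum lin_sw[OF assms] lin_scale[OF assms] conv_inverse2_eq)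
  also have "\<dots> = D h (\<lambda>a x. D x (\<lambda>y c. D y (\<lambda>m b. \<chi>' (a \<cdot> S b) c * \<phi> m)))"
    by (rule sw_eqI, rule comult_assoc[symmetric]; intro lin)
  also have "\<dots> = D h (\<lambda>x c. D x (\<lambda>a y. D y (\<lambda>m b. \<chi>' (a \<cdot> S b) c * \<phi> m)))"
    by (rule comult_assoc[symmetric]; intro lin)
  finally show ?thesis by (simp add: ad_sum)
qed

lemma lin_by_functionals:
  assumes "vector_space t" "\<And>\<phi>. lin t ((*) :: 'k \<Rightarrow> 'k \<Rightarrow> 'k) \<phi> \<Longrightarrow> lin s (*) (\<lambda>x. \<phi> (f x))"
  shows "lin s t f"
  by (intro linI; rule eq_by_functionals[OF assms(1)])
    (simp_all add: lin_add[OF assms(2)] lin_scale[OF assms(2)] lin_add lin_scale)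

lemma alpha_lin: "lin sH sH \<alpha>"
proof (rule lin_by_functionals[OF vector_space_H])
  fix \<phi> assume "lin1 \<phi>"
  then show "lin1 (\<lambda>x. \<phi> (\<alpha> x))"
    unfolding alpha_functional[OF \<open>lin1 \<phi>\<close>] by (intro wrap_lin \<chi>'_bil conv1_lin U_lin)
qed

lemma alpha_inv_lin: "lin sH sH \<alpha>i"
proof (rule lin_by_functionals[OF vector_space_H])
  fix \<phi> assume "lin1 \<phi>"
  then show "lin1 (\<lambda>x. \<phi> (\<alpha>i x))"
    unfolding alpha_inv_functional[OF \<open>lin1 \<phi>\<close>] by (intro wrap_lin \<chi>_bil conv1_lin U'_lin)
qed

lemmas alpha_lins [lin] = lin_compose[OF alpha_lin] lin_compose[OF alpha_inv_lin]

lemma alpha_inv_alpha: "\<alpha>i (\<alpha> h) = h"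
proof (rule eq_by_functionals[OF vector_space_H])
  fix \<phi> assume \<phi>: "lin1 \<phi>"
  note l = wrap_lin \<chi>_bil \<chi>'_bil conv1_lin U_lin U'_lin \<phi>
  have "lin1 (\<lambda>x. \<phi> (\<alpha>i x))" by (intro lin_compose[OF \<phi>] lin)
  then have "\<phi> (\<alpha>i (\<alpha> h)) = wrap \<chi>' (conv1 (\<lambda>x. \<phi> (\<alpha>i x)) U) h"
    by (rule alpha_functional)
  also have "\<dots> = wrap \<chi>' (conv1 (conv1 (wrap \<chi> \<phi>) U') U) h"
    unfolding alpha_inv_functional[OF \<phi>] ..
  also have "conv1 (conv1 (wrap \<chi> \<phi>) U') U = wrap \<chi> \<phi>"
    by (simp only: conv1_assoc[symmetric] l U'_U conv1_unit)
  also have "wrap \<chi>' (wrap \<chi> \<phi>) = \<phi>"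
    by (simp only: wrap_wrap[OF \<chi>'_bil \<chi>_bil \<phi>] \<chi>'_\<chi> wrap_eps2[OF \<phi>])
  finally show "\<phi> (\<alpha>i (\<alpha> h)) = \<phi> h" .
qed

lemma alpha_alpha_inv: "\<alpha> (\<alpha>i h) = h"
proof (rule eq_by_functionals[OF vector_space_H])
  fix \<phi> assume \<phi>: "lin1 \<phi>"
  note l = wrap_lin \<chi>_bil \<chi>'_bil conv1_lin U_lin U'_lin \<phi>
  have "lin1 (\<lambda>x. \<phi> (\<alpha> x))" by (intro lin_compose[OF \<phi>] lin)
  then have "\<phi> (\<alpha> (\<alpha>i h)) = conv1 (wrap \<chi> (\<lambda>x. \<phi> (\<alpha> x))) U' h"
    by (rule alpha_inv_functional)
  also have "\<dots> = conv1 (wrap \<chi> (wrap \<chi>' (conv1 \<phi> U))) U' h"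
    unfolding alpha_functional[OF \<phi>] ..
  also have "wrap \<chi> (wrap \<chi>' (conv1 \<phi> U)) = conv1 \<phi> U"
    by (simp only: wrap_wrap \<chi>_bil \<chi>'_bil l \<chi>_\<chi>' wrap_eps2)
  also have "conv1 (conv1 \<phi> U) U' = \<phi>"
    by (simp only: conv1_assoc[symmetric] l U_U' conv1_unit)
  finally show "\<phi> (\<alpha> (\<alpha>i h)) = \<phi> h" .
qed

lemma counit_alpha_inv: "\<epsilon> (\<alpha>i h) = \<epsilon> h"
  unfolding alpha_inv_functional[OF counit_linear] U_def[symmetric] U_U' ..

lemma counit_alpha: "\<epsilon> (\<alpha> h) = \<epsilon> h"
  using counit_alpha_inv[of "\<alpha> h"] by (simp add: alpha_inv_alpha)

lemma alpha_inv_unit: "\<alpha>i \<one> = \<one>"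
proof (rule eq_by_functionals[OF vector_space_H])
  fix \<phi> assume \<phi>: "lin1 \<phi>"
  note [lin] = lin_compose[OF \<phi>]
  have "\<phi> (\<alpha>i \<one>) = D \<one> (\<lambda>a c. ad a (\<lambda>p z. \<chi>' p c * \<phi> z))" by (rule alpha_inv_ad[OF \<phi>])
  also have "\<dots> = ad \<one> (\<lambda>p z. \<chi>' p \<one> * \<phi> z)" by (rule comult_of_unit; intro lin)
  also have "\<dots> = \<chi>' \<one> \<one> * \<phi> \<one>" by (rule ad_unit; intro lin)
  finally show "\<phi> (\<alpha>i \<one>) = \<phi> \<one>" by (simp add: \<chi>'_unit_left counit_unit)
qed

text \<open>Applying \<open>\<alpha>\<inverse>\<close> to the first leg of \<open>\<Delta> h\<close> is acting with \<open>\<chi>\<inverse>\<close> along the adjoint coaction and \<open>\<Delta>\<close>;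
  this is what cancels against an action of \<open>\<chi>\<close>.\<close>

lemma comult_alpha_inv:
  assumes "bil2 M" shows "D h (\<lambda>a b. M (\<alpha>i a) b) = D h (cact2 la \<Delta> \<chi>' M)"
proof -
  note [lin] = bil_lin[OF assms]
  have "D h (\<lambda>a b. M (\<alpha>i a) b) = D h (\<lambda>a b. D a (\<lambda>a c. ad a (\<lambda>p z. \<chi>' p c * M z b)))"
    by (rule sw_eqI, rule alpha_inv_ad; intro lin)
  also have "\<dots> = D h (\<lambda>a y. D y (\<lambda>c b. ad a (\<lambda>p z. \<chi>' p c * M z b)))"
    by (rule comult_assoc; intro lin)
  also have "\<dots> = D h (\<lambda>a y. ad a (\<lambda>p z. D y (\<lambda>c b. \<chi>' p c * M z b)))"
    by (rule sw_eqI, rule sw_swap)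
  finally show ?thesis by (simp add: cact2_def[abs_def] cact1_def)
qed

text \<open>\<open>(\<alpha>\<inverse> h\<^bsub>(1)\<^esub>)\<^bsub>(-1)\<^esub> \<bullet> h\<^bsub>(2)\<^esub> \<otimes> (\<alpha>\<inverse> h\<^bsub>(1)\<^esub>)\<^bsub>(0)\<^esub> = h\<^bsub>(1)\<^esub> \<otimes> \<alpha>\<inverse> h\<^bsub>(2)\<^esub>\<close>.  Multiplying the first leg by
  \<open>S\<^sup>\<chi> h\<^bsub>(3)\<^esub>\<close> gives the colinearity of \<open>\<alpha>\<inverse>\<close> for the two adjoint coactions (\<open>coact_alpha_inv\<close>).\<close>

lemma ad_alpha_inv_mult:
  assumes f: "lin1 f" and \<phi>: "lin1 \<phi>"
  shows "D h (\<lambda>a b. ad (\<alpha>i a) (\<lambda>p z. f (p \<bullet> b) * \<phi> z)) = D h (\<lambda>a b. f a * \<phi> (\<alpha>i b))"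
proof -
  note [lin] = lin_compose[OF f] lin_compose[OF \<phi>]
  let ?fm = "\<lambda>a b. f (a \<cdot> b)" and ?fx = "\<lambda>a b. f (a \<bullet> b)" and ?J = "\<lambda>z b. \<phi> z * \<epsilon> b"
  have fx: "?fx = conv2 \<chi> (conv2 ?fm \<chi>')" by (rule twisted_mult_conv[OF f])
  have bfx: "bil2 ?fx" unfolding fx by (intro conv2_bil \<chi>_bil \<chi>'_bil mult_functional_bil f)
  note [lin] = bil_lin[OF bfx]
  have bJ: "bil2 ?J" by (intro bilI lin)
  note bl = \<chi>_bil \<chi>'_bil mult_functional_bil[OF f] bJ bfx conv2_bil cact2_bil[OF comodule_ad comodule_H]
  have J: "cact2 la \<Delta> g ?J z b = ad z (\<lambda>p w. g p b * \<phi> w)" if g: "bil2 g" for g z b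
  proof -
    note [lin] = bil_lin[OF g]
    have "cact2 la \<Delta> g ?J z b = ad z (\<lambda>p w. D b (\<lambda>c b'. (g p c * \<phi> w) * \<epsilon> b'))"
      by (simp add: cact2_def cact1_def mult.assoc)
    also have "\<dots> = ad z (\<lambda>p w. g p b * \<phi> w)"
      by (rule sw_eqI, rule comult_counit_right; intro lin)
    finally show ?thesis .
  qed
  let ?O = "cact2 la \<Delta> \<chi>' ?J"
  have O: "bil2 ?O" by (intro bl)
  note [lin] = bil_lin[OF O]
  have "D h (\<lambda>a b. ad (\<alpha>i a) (\<lambda>p z. f (p \<bullet> b) * \<phi> z)) = D h (\<lambda>a b. cact2 la \<Delta> ?fx ?J (\<alpha>i a) b)"
    unfolding J[OF bfx] ..
  also have "\<dots> = D h (cact2 la \<Delta> \<chi>' (cact2 la \<Delta> ?fx ?J))"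
    by (rule comult_alpha_inv; intro bl)
  also have "cact2 la \<Delta> \<chi>' (cact2 la \<Delta> ?fx ?J) = cact2 la \<Delta> (conv2 \<chi>' ?fx) ?J"
    by (rule cact2_assoc[OF comodule_ad comodule_H]; intro bl)
  also have "conv2 \<chi>' ?fx = conv2 ?fm \<chi>'"
    unfolding fx by (simp only: conv2_assoc bl \<chi>'_\<chi> conv2_unit)
  also have "cact2 la \<Delta> (conv2 ?fm \<chi>') ?J = cact2 la \<Delta> ?fm ?O"
    by (rule cact2_assoc[OF comodule_ad comodule_H, symmetric]; intro bl)
  also have "D h (cact2 la \<Delta> ?fm ?O) = D h (\<lambda>a y. ad a (\<lambda>p z. D y (\<lambda>b c. f (p \<cdot> b) * ?O z c)))"
    by (simp add: cact2_def[of _ _ ?fm, abs_def] cact1_def)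
  also have "\<dots> = D h (\<lambda>a y. D y (\<lambda>b c. ad a (\<lambda>p z. f (p \<cdot> b) * ?O z c)))"
    by (rule sw_eqI, rule sw_swap)
  also have "\<dots> = D h (\<lambda>s y. D y (\<lambda>t c. f s * ?O t c))"
    by (rule ad_insert[symmetric, of "\<lambda>s t c. f s * ?O t c"]; intro trilI lin)
  also have "\<dots> = D h (\<lambda>a b. f a * \<phi> (\<alpha>i b))"
    unfolding alpha_inv_ad[OF \<phi>] sw_mult_left[symmetric] J[OF \<chi>'_bil] ..
  finally show ?thesis .
qed

lemma coact_alpha_inv:
  "tensor_eq sH sH (la (\<alpha>i h)) (map (\<lambda>(a, w). (a, \<alpha>i w)) (coact (regular_crossed Hx) h))"
proof (rule tensor_eq_by_functionals[OF vector_space_H vector_space_H])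
  fix f \<phi> assume f: "lin1 f" and \<phi>: "lin1 \<phi>"
  interpret T: hopf_algebra Hx by (rule hopf_algebra_twist)
  note [lin] = lin_compose[OF f] lin_compose[OF \<phi>] T.mult_lin[unfolded twist_hopf_simps] T.antipode_lin[unfolded twist_hopf_simps]
  have "ad (\<alpha>i h) (\<lambda>p z. f p * \<phi> z) = D h (\<lambda>a b. ad (\<alpha>i a) (\<lambda>p z. f p * \<phi> z) * \<epsilon> b)"
    by (rule comult_counit_right[symmetric]; intro lin)
  also have "\<dots> = D h (\<lambda>a x. D x (\<lambda>b c. ad (\<alpha>i a) (\<lambda>p z. f (p \<bullet> (b \<bullet> Sx c)) * \<phi> z)))"
  proof (rule sw_eqI)
    fix a b
    have "D b (\<lambda>b c. ad (\<alpha>i a) (\<lambda>p z. f (p \<bullet> (b \<bullet> Sx c)) * \<phi> z)) = \<epsilon> b * ad (\<alpha>i a) (\<lambda>p z. f (p \<bullet> \<one>) * \<phi> z)"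
      by (rule T.comult_antipode_right[unfolded twist_hopf_simps]; intro lin)
    then show "ad (\<alpha>i a) (\<lambda>p z. f p * \<phi> z) * \<epsilon> b = D b (\<lambda>b c. ad (\<alpha>i a) (\<lambda>p z. f (p \<bullet> (b \<bullet> Sx c)) * \<phi> z))"
      using T.unit_right by (simp add: mult.commute)
  qed
  also have "\<dots> = D h (\<lambda>x c. D x (\<lambda>a b. ad (\<alpha>i a) (\<lambda>p z. f (p \<bullet> (b \<bullet> Sx c)) * \<phi> z)))"
    by (rule comult_assoc[symmetric]; intro lin)
  also have "\<dots> = D h (\<lambda>x c. D x (\<lambda>a b. f (a \<bullet> Sx c) * \<phi> (\<alpha>i b)))"
    unfolding T.mult_assoc[symmetric]
    by (rule sw_eqI, rule ad_alpha_inv_mult[of "\<lambda>s. f (s \<bullet> Sx _)"]; intro lin)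
  also have "\<dots> = D h (\<lambda>a x. D x (\<lambda>b c. f (a \<bullet> Sx c) * \<phi> (\<alpha>i b)))"
    by (rule comult_assoc; intro lin)
  finally show "sw (la (\<alpha>i h)) (\<lambda>a b. f a * \<phi> b)
      = sw (map (\<lambda>(a, w). (a, \<alpha>i w)) (coact (regular_crossed Hx) h)) (\<lambda>a b. f a * \<phi> b)"
    by (simp add: sw_map_prod T.ad_sum)
qed

lemma twist_act_functional:
  assumes "lin (vscale V) (*) \<phi>"
  shows "\<phi> (act (twist_crossed H \<chi> V) h v) = D h (\<lambda>h1 x. D x (\<lambda>h2 h3.
    sw (coact V v) (\<lambda>p w. sw (coact V (act V h2 w)) (\<lambda>q u. \<chi> h1 p * \<chi>' q h3 * \<phi> u))))"
proof -
  have "act (twist_crossed H \<chi> V) h v = D h (\<lambda>h1 x. D x (\<lambda>h2 h3.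
      sw (coact V v) (\<lambda>p w. sw (coact V (act V h2 w)) (\<lambda>q u. vscale V (\<chi> h1 p * \<chi>' q h3) u))))"
    unfolding twist_crossed_def conv_inverse2_eq by (simp add: comult3_sum) (simp add: sw_def)
  then show ?thesis by (simp add: lin_sw[OF assms] lin_scale[OF assms])
qed

text \<open>The part \<open>\<alpha>\<inverse>(h\<^bsub>(1)\<^esub> g\<^bsub>(1)\<^esub>) \<chi>\<inverse>(h\<^bsub>(2)\<^esub> \<otimes> g\<^bsub>(2)\<^esub>)\<close> of \<open>\<alpha>\<inverse>(h \<bullet> g)\<close>.  The inverted cocycle equation splits
  \<open>\<chi>\<inverse>(p \<otimes> h\<^bsub>(2)\<^esub> g\<^bsub>(2)\<^esub>) \<chi>\<inverse>(h\<^bsub>(3)\<^esub> \<otimes> g\<^bsub>(3)\<^esub>)\<close> into \<open>\<chi>\<inverse>(p\<^bsub>(1)\<^esub> h\<^bsub>(2)\<^esub> \<otimes> g\<^bsub>(2)\<^esub>) \<chi>\<inverse>(p\<^bsub>(2)\<^esub> \<otimes> h\<^bsub>(3)\<^esub>)\<close>, and then \<open>ad_act\<close>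
  moves \<open>h\<close> out of the coaction.\<close>

lemma alpha_inv_mult_conv:
  assumes \<phi>: "lin1 \<phi>"
  defines "N \<equiv> \<lambda>w c. ad w (\<lambda>u z. \<chi>' u c * \<phi> z)"
  shows "conv2 (\<lambda>a b. \<phi> (\<alpha>i (a \<cdot> b))) \<chi>' h g
    = D h (\<lambda>q x. D g (\<lambda>t v. D q (\<lambda>s b. ad t (\<lambda>p w. \<chi>' (s \<cdot> p) v * N (b \<cdot> w) x))))"
proof -
  note [lin] = lin_compose[OF \<phi>]
  have N: "bil2 N" unfolding N_def by (intro bilI lin)
  note [lin] = bil_lin[OF N]
  have join23: "conv3 (join23 \<chi>') (in23 \<chi>') p u v = D u (\<lambda>b x. D v (\<lambda>c y. \<chi>' p (b \<cdot> c) * \<chi>' x y))" for p u v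
  proof -
    have "conv3 (join23 \<chi>') (in23 \<chi>') p u v = D p (\<lambda>p1 p2. D u (\<lambda>b x. D v (\<lambda>c y. \<chi>' p1 (b \<cdot> c) * \<chi>' x y)) * \<epsilon> p2)"
      unfolding cact3_def cact2_def cact1_def sw_mult_right by (simp only: ac_simps)
    also have "\<dots> = D u (\<lambda>b x. D v (\<lambda>c y. \<chi>' p (b \<cdot> c) * \<chi>' x y))"
      by (rule comult_counit_right; intro lin)
    finally show ?thesis .
  qed
  have join12: "conv3 (join12 \<chi>') (in12 \<chi>') p u v = D p (\<lambda>p1 p2. D u (\<lambda>b x. \<chi>' (p1 \<cdot> b) v * \<chi>' p2 x))" for p u v
  proof -
    have "conv3 (join12 \<chi>') (in12 \<chi>') p u v
        = D p (\<lambda>p1 p2. D u (\<lambda>b x. D v (\<lambda>c y. (\<chi>' (p1 \<cdot> b) c * \<chi>' p2 x) * \<epsilon> y)))"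
      unfolding cact3_def cact2_def cact1_def by (simp only: ac_simps)
    also have "\<dots> = D p (\<lambda>p1 p2. D u (\<lambda>b x. \<chi>' (p1 \<cdot> b) v * \<chi>' p2 x))"
      by (rule sw_eqI, rule sw_eqI, rule comult_counit_right; intro lin)
    finally show ?thesis .
  qed
  have "conv2 (\<lambda>a b. \<phi> (\<alpha>i (a \<cdot> b))) \<chi>' h g
      = D h (\<lambda>k x. D g (\<lambda>l y. D (k \<cdot> l) (\<lambda>a c. ad a (\<lambda>p z. \<chi>' p c * \<phi> z)) * \<chi>' x y))"
    by (simp add: cact2_def cact1_def alpha_inv_ad[OF \<phi>])
  also have "\<dots> = D h (\<lambda>k x. D g (\<lambda>l y. D k (\<lambda>s b. D l (\<lambda>t c. ad (s \<cdot> t) (\<lambda>p z. \<chi>' p (b \<cdot> c) * \<phi> z))) * \<chi>' x y))"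
    by (rule sw_eqI, rule sw_eqI, rule arg_cong[where f = "\<lambda>r. r * _"], rule comult_of_mult; intro lin)
  also have "\<dots> = D h (\<lambda>k x. D g (\<lambda>l y. D k (\<lambda>s b. D l (\<lambda>t c. ad (s \<cdot> t) (\<lambda>p z. \<chi>' p (b \<cdot> c) * \<chi>' x y * \<phi> z)))))"
    unfolding sw_mult_right by (simp only: ac_simps)
  also have "\<dots> = D h (\<lambda>k x. D k (\<lambda>s b. D g (\<lambda>l y. D l (\<lambda>t c. ad (s \<cdot> t) (\<lambda>p z. \<chi>' p (b \<cdot> c) * \<chi>' x y * \<phi> z)))))"
    by (rule sw_eqI, rule sw_swap)
  also have "\<dots> = D h (\<lambda>s u. D u (\<lambda>b x. D g (\<lambda>l y. D l (\<lambda>t c. ad (s \<cdot> t) (\<lambda>p z. \<chi>' p (b \<cdot> c) * \<chi>' x y * \<phi> z)))))"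
    by (rule comult_assoc; intro lin)
  also have "\<dots> = D h (\<lambda>s u. D u (\<lambda>b x. D g (\<lambda>t v. D v (\<lambda>c y. ad (s \<cdot> t) (\<lambda>p z. \<chi>' p (b \<cdot> c) * \<chi>' x y * \<phi> z)))))"
    by (rule sw_eqI, rule sw_eqI, rule comult_assoc; intro lin)
  also have "\<dots> = D h (\<lambda>s u. D g (\<lambda>t v. D u (\<lambda>b x. D v (\<lambda>c y. ad (s \<cdot> t) (\<lambda>p z. \<chi>' p (b \<cdot> c) * \<chi>' x y * \<phi> z)))))"
    by (rule sw_eqI, rule sw_swap)
  also have "\<dots> = D h (\<lambda>s u. D g (\<lambda>t v. ad (s \<cdot> t) (\<lambda>p z. conv3 (join23 \<chi>') (in23 \<chi>') p u v * \<phi> z)))"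
  proof (rule sw_eqI, rule sw_eqI)
    fix s u t v
    have "D u (\<lambda>b x. D v (\<lambda>c y. ad (s \<cdot> t) (\<lambda>p z. \<chi>' p (b \<cdot> c) * \<chi>' x y * \<phi> z)))
        = ad (s \<cdot> t) (\<lambda>p z. D u (\<lambda>b x. D v (\<lambda>c y. \<chi>' p (b \<cdot> c) * \<chi>' x y * \<phi> z)))"
      by (rule sw_swap2)
    then show "D u (\<lambda>b x. D v (\<lambda>c y. ad (s \<cdot> t) (\<lambda>p z. \<chi>' p (b \<cdot> c) * \<chi>' x y * \<phi> z)))
        = ad (s \<cdot> t) (\<lambda>p z. conv3 (join23 \<chi>') (in23 \<chi>') p u v * \<phi> z)"
      by (simp only: join23 sw_mult_right)
  qed
  also have "\<dots> = D h (\<lambda>s u. D g (\<lambda>t v. D u (\<lambda>b x. ad (s \<cdot> t) (\<lambda>p w. \<chi>' (p \<cdot> b) v * N w x))))"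
  proof (rule sw_eqI, rule sw_eqI)
    fix s u t v
    have "ad (s \<cdot> t) (\<lambda>p z. conv3 (join23 \<chi>') (in23 \<chi>') p u v * \<phi> z)
        = ad (s \<cdot> t) (\<lambda>p z. D p (\<lambda>p1 p2. D u (\<lambda>b x. \<chi>' (p1 \<cdot> b) v * (\<chi>' p2 x * \<phi> z))))"
      by (simp only: cocycle3_inverse[symmetric] join12 sw_mult_right mult.assoc)
    also have "\<dots> = ad (s \<cdot> t) (\<lambda>p z. D u (\<lambda>b x. D p (\<lambda>p1 p2. \<chi>' (p1 \<cdot> b) v * (\<chi>' p2 x * \<phi> z))))"
      by (rule sw_eqI, rule sw_swap)
    also have "\<dots> = D u (\<lambda>b x. ad (s \<cdot> t) (\<lambda>p z. D p (\<lambda>p1 p2. \<chi>' (p1 \<cdot> b) v * (\<chi>' p2 x * \<phi> z))))"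
      by (rule sw_swap)
    also have "\<dots> = D u (\<lambda>b x. ad (s \<cdot> t) (\<lambda>p1 w. ad w (\<lambda>p2 z. \<chi>' (p1 \<cdot> b) v * (\<chi>' p2 x * \<phi> z))))"
      by (rule sw_eqI, rule ad_coassoc; intro lin)
    finally show "ad (s \<cdot> t) (\<lambda>p z. conv3 (join23 \<chi>') (in23 \<chi>') p u v * \<phi> z)
        = D u (\<lambda>b x. ad (s \<cdot> t) (\<lambda>p w. \<chi>' (p \<cdot> b) v * N w x))"
      by (simp only: N_def sw_mult_left)
  qed
  also have "\<dots> = D h (\<lambda>s u. D u (\<lambda>b x. D g (\<lambda>t v. ad (s \<cdot> t) (\<lambda>p w. \<chi>' (p \<cdot> b) v * N w x))))"
    by (rule sw_eqI, rule sw_swap)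
  also have "\<dots> = D h (\<lambda>q x. D q (\<lambda>s b. D g (\<lambda>t v. ad (s \<cdot> t) (\<lambda>p w. \<chi>' (p \<cdot> b) v * N w x))))"
    by (rule comult_assoc[symmetric]; intro lin)
  also have "\<dots> = D h (\<lambda>q x. D g (\<lambda>t v. D q (\<lambda>s b. ad (s \<cdot> t) (\<lambda>p w. \<chi>' (p \<cdot> b) v * N w x))))"
    by (rule sw_eqI, rule sw_swap)
  also have "\<dots> = D h (\<lambda>q x. D g (\<lambda>t v. D q (\<lambda>s b. ad t (\<lambda>p w. \<chi>' (s \<cdot> p) v * N (b \<cdot> w) x))))"
    by (rule sw_eqI, rule sw_eqI, rule ad_act[symmetric]; intro lin)
  finally show ?thesis .
qed

text \<open>\<open>\<alpha>\<inverse>\<close> intertwines the product of the twisted Hopf algebra with the twisted action.  After the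
  previous lemma, \<open>ad_insert\<close> replaces the remaining \<open>g\<^bsub>(1)\<^esub>\<close> in \<open>\<chi>(h\<^bsub>(1)\<^esub> \<otimes> g\<^bsub>(1)\<^esub>)\<close> by a leg of the coaction
  times \<open>g\<^bsub>(2)\<^esub>\<close>, and the cocycle identity \<open>\<chi>(id \<otimes> m) * \<chi>\<inverse>(m \<otimes> id) = \<chi>\<inverse>\<^sub>2\<^sub>3 * \<chi>\<^sub>1\<^sub>2\<close> applies.\<close>

theorem alpha_inv_act:
  "\<alpha>i (h \<bullet> g) = act (twist_crossed H \<chi> (regular_crossed H)) h (\<alpha>i g)"
proof (rule eq_by_functionals[OF vector_space_H])
  fix \<phi> assume \<phi>: "lin1 \<phi>"
  note [lin] = lin_compose[OF \<phi>]
  define N where "N w c = ad w (\<lambda>u z. \<chi>' u c * \<phi> z)" for w c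
  have N: "bil2 N" unfolding N_def[abs_def] by (intro bilI lin)
  note [lin] = bil_lin[OF N]
  have \<phi>i: "lin1 (\<lambda>x. \<phi> (\<alpha>i x))" by (intro lin)
  have mixed: "D k (\<lambda>h1 s. D R (\<lambda>P p. D y (\<lambda>b0 v. \<chi> h1 (P \<cdot> b0) * \<chi>' (s \<cdot> p) v)))
      = D R (\<lambda>p p'. \<chi>' p y * \<chi> k p')" for k R y
  proof -
    have "D k (\<lambda>h1 s. D R (\<lambda>P p. D y (\<lambda>b0 v. \<chi> h1 (P \<cdot> b0) * \<chi>' (s \<cdot> p) v)))
        = conv3 (join23 \<chi>) (join12 \<chi>') k R y" by (simp add: cact3_def cact2_def cact1_def)
    also have "\<dots> = conv2 \<chi>' (\<lambda>b c. \<chi> k b * \<epsilon> c) R y"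
      unfolding cocycle3_mixed(1) by (rule cact3_counit_left(1)[OF bicomodule_H]; intro lin)
    also have "\<dots> = D R (\<lambda>p p'. D y (\<lambda>c1 c2. (\<chi>' p c1 * \<chi> k p') * \<epsilon> c2))"
      by (simp add: cact2_def cact1_def mult.assoc)
    also have "\<dots> = D R (\<lambda>p p'. \<chi>' p y * \<chi> k p')"
      by (rule sw_eqI, rule comult_counit_right; intro lin)
    finally show ?thesis .
  qed
  define \<Psi> where "\<Psi> y = \<phi> (act (twist_crossed H \<chi> (regular_crossed H)) h y)" for y
  have \<Psi>: "\<Psi> y = D h (\<lambda>k u. D u (\<lambda>b x. ad y (\<lambda>p w. \<chi> k p * N (b \<cdot> w) x)))" for y
  proof -
    have "lin (vscale (regular_crossed H)) (*) \<phi>" using \<phi> by (simp add: regular_crossed_def)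
    from twist_act_functional[OF this, of h y] show ?thesis
      by (simp add: \<Psi>_def N_def sw_mult_left mult.assoc) (simp add: regular_crossed_def)
  qed
  have \<Psi>_lin: "lin1 \<Psi>" unfolding \<Psi>[abs_def] by (intro lin)
  note [lin] = lin_compose[OF \<Psi>_lin]
  \<comment> \<open>\<open>?T g\<^bsub>(1)\<^esub> g\<^bsub>(2)\<^esub> g\<^bsub>(3)\<^esub>\<close>, summed over the coproduct of \<open>g\<close>, is the value of \<open>\<phi>\<close> at \<open>\<alpha>\<inverse>(h \<bullet> g)\<close>.\<close>
  let ?T = "\<lambda>s' t v. D h (\<lambda>h1 h'. D h' (\<lambda>q x. D q (\<lambda>s b. ad t (\<lambda>p w. \<chi> h1 s' * \<chi>' (s \<cdot> p) v * N (b \<cdot> w) x))))"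
  let ?M = "\<lambda>R y w k u. D u (\<lambda>b x. D R (\<lambda>p p'. \<chi>' p y * \<chi> k p' * N (b \<cdot> w) x))"
  have "\<phi> (\<alpha>i (h \<bullet> g)) = conv2 \<chi> (conv2 (\<lambda>a b. \<phi> (\<alpha>i (a \<cdot> b))) \<chi>') h g"
    using twisted_mult_conv[OF \<phi>i] by (simp add: fun_eq_iff)
  also have "\<dots> = D h (\<lambda>h1 h'. D g (\<lambda>g1 g'. \<chi> h1 g1 *
        D h' (\<lambda>q x. D g' (\<lambda>t v. D q (\<lambda>s b. ad t (\<lambda>p w. \<chi>' (s \<cdot> p) v * N (b \<cdot> w) x))))))"
    unfolding cact2_def[of _ _ \<chi>] cact1_def alpha_inv_mult_conv[OF \<phi>] N_def ..
  also have "\<dots> = D h (\<lambda>h1 h'. D g (\<lambda>g1 g'. D h' (\<lambda>q x. D g' (\<lambda>t v. D q (\<lambda>s b.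
        ad t (\<lambda>p w. \<chi> h1 g1 * \<chi>' (s \<cdot> p) v * N (b \<cdot> w) x))))))"
    unfolding sw_mult_left mult.assoc ..
  also have "\<dots> = D g (\<lambda>g1 g'. D h (\<lambda>h1 h'. D h' (\<lambda>q x. D g' (\<lambda>t v. D q (\<lambda>s b.
        ad t (\<lambda>p w. \<chi> h1 g1 * \<chi>' (s \<cdot> p) v * N (b \<cdot> w) x))))))"
    by (rule sw_swap)
  also have "\<dots> = D g (\<lambda>g1 g'. D g' (\<lambda>t v. ?T g1 t v))"
    by (rule sw_eqI, rule sw_swap2)
  also have "\<dots> = D g (\<lambda>a y. D y (\<lambda>b0 v. ad a (\<lambda>P z. ?T (P \<cdot> b0) z v)))"
    by (rule ad_insert; intro trilI lin)
  also have "\<dots> = D g (\<lambda>a y. ad a (\<lambda>P z. D y (\<lambda>b0 v. ?T (P \<cdot> b0) z v)))"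
    by (rule sw_eqI, rule sw_swap)
  also have "\<dots> = D g (\<lambda>a y. ad a (\<lambda>P z. ad z (\<lambda>p w. D y (\<lambda>b0 v. D h (\<lambda>h1 h'. D h' (\<lambda>q x. D q (\<lambda>s b.
        \<chi> h1 (P \<cdot> b0) * \<chi>' (s \<cdot> p) v * N (b \<cdot> w) x)))))))"
    by (rule sw_eqI, rule sw_eqI, rule sw_swap4)
  also have "\<dots> = D g (\<lambda>a y. ad a (\<lambda>R w. D R (\<lambda>P p. D y (\<lambda>b0 v. D h (\<lambda>h1 h'. D h' (\<lambda>q x. D q (\<lambda>s b.
        \<chi> h1 (P \<cdot> b0) * \<chi>' (s \<cdot> p) v * N (b \<cdot> w) x)))))))"
    by (rule sw_eqI, rule ad_coassoc[symmetric]; intro lin)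
  also have "\<dots> = D g (\<lambda>a y. ad a (\<lambda>R w. D h (\<lambda>k u. ?M R y w k u)))"
  proof (rule sw_eqI, rule sw_eqI)
    fix y R w
    let ?G = "\<lambda>h1 s b x P p b0 v. \<chi> h1 (P \<cdot> b0) * \<chi>' (s \<cdot> p) v * N (b \<cdot> w) x"
    have "D h (\<lambda>h1 h'. D h' (\<lambda>q x. D q (\<lambda>s b. ?G h1 s b x P p b0 v)))
        = D h (\<lambda>k u. D u (\<lambda>b x. D k (\<lambda>h1 s. ?G h1 s b x P p b0 v)))" for P p b0 v
    proof -
      have "D h (\<lambda>h1 h'. D h' (\<lambda>q x. D q (\<lambda>s b. ?G h1 s b x P p b0 v)))
          = D h (\<lambda>h1 h'. D h' (\<lambda>s u. D u (\<lambda>b x. ?G h1 s b x P p b0 v)))"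
        by (rule sw_eqI, rule comult_assoc; intro lin)
      also have "\<dots> = D h (\<lambda>k u. D k (\<lambda>h1 s. D u (\<lambda>b x. ?G h1 s b x P p b0 v)))"
        by (rule comult_assoc[symmetric]; intro lin)
      also have "\<dots> = D h (\<lambda>k u. D u (\<lambda>b x. D k (\<lambda>h1 s. ?G h1 s b x P p b0 v)))"
        by (rule sw_eqI, rule sw_swap)
      finally show ?thesis .
    qed
    then have "D R (\<lambda>P p. D y (\<lambda>b0 v. D h (\<lambda>h1 h'. D h' (\<lambda>q x. D q (\<lambda>s b. ?G h1 s b x P p b0 v)))))
        = D R (\<lambda>P p. D y (\<lambda>b0 v. D h (\<lambda>k u. D u (\<lambda>b x. D k (\<lambda>h1 s. ?G h1 s b x P p b0 v)))))"
      by simp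
    also have "\<dots> = D h (\<lambda>k u. D R (\<lambda>P p. D y (\<lambda>b0 v. D u (\<lambda>b x. D k (\<lambda>h1 s. ?G h1 s b x P p b0 v)))))"
      by (rule sw_swap2)
    also have "\<dots> = D h (\<lambda>k u. D u (\<lambda>b x. D R (\<lambda>P p. D y (\<lambda>b0 v. D k (\<lambda>h1 s. ?G h1 s b x P p b0 v)))))"
      by (rule sw_eqI, rule sw_swap2)
    also have "\<dots> = D h (\<lambda>k u. D u (\<lambda>b x. D k (\<lambda>h1 s. D R (\<lambda>P p. D y (\<lambda>b0 v. ?G h1 s b x P p b0 v)))))"
      by (rule sw_eqI, rule sw_eqI, rule sw_swap2)
    also have "\<dots> = D h (\<lambda>k u. D u (\<lambda>b x. D k (\<lambda>h1 s. D R (\<lambda>P p. D y (\<lambda>b0 v. \<chi> h1 (P \<cdot> b0) * \<chi>' (s \<cdot> p) v))) * N (b \<cdot> w) x))"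
      by (simp only: sw_mult_right)
    also have "\<dots> = D h (\<lambda>k u. ?M R y w k u)"
      unfolding mixed sw_mult_right ..
    finally show "D R (\<lambda>P p. D y (\<lambda>b0 v. D h (\<lambda>h1 h'. D h' (\<lambda>q x. D q (\<lambda>s b. ?G h1 s b x P p b0 v)))))
        = D h (\<lambda>k u. ?M R y w k u)" .
  qed
  also have "\<dots> = D g (\<lambda>a y. ad a (\<lambda>R w. D R (\<lambda>p p'. D h (\<lambda>k u. D u (\<lambda>b x. \<chi>' p y * \<chi> k p' * N (b \<cdot> w) x)))))"
    by (rule sw_eqI, rule sw_eqI, rule sw_swap2)
  also have "\<dots> = D g (\<lambda>a y. ad a (\<lambda>p z. ad z (\<lambda>p' w. D h (\<lambda>k u. D u (\<lambda>b x. \<chi>' p y * \<chi> k p' * N (b \<cdot> w) x)))))"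
    by (rule sw_eqI, rule ad_coassoc; intro lin)
  also have "\<dots> = D g (\<lambda>a y. ad a (\<lambda>p z. \<chi>' p y * \<Psi> z))"
  proof (rule sw_eqI, rule sw_eqI)
    fix y p z
    have "ad z (\<lambda>p' w. D h (\<lambda>k u. D u (\<lambda>b x. \<chi>' p y * \<chi> k p' * N (b \<cdot> w) x)))
        = D h (\<lambda>k u. D u (\<lambda>b x. ad z (\<lambda>p' w. \<chi>' p y * \<chi> k p' * N (b \<cdot> w) x)))"
      by (rule sw_swap2[symmetric])
    then show "ad z (\<lambda>p' w. D h (\<lambda>k u. D u (\<lambda>b x. \<chi>' p y * \<chi> k p' * N (b \<cdot> w) x))) = \<chi>' p y * \<Psi> z"
      by (simp only: \<Psi> sw_mult_left mult.assoc)
  qed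
  also have "\<dots> = \<Psi> (\<alpha>i g)"
    by (rule alpha_inv_ad[OF \<Psi>_lin, symmetric])
  finally show "\<phi> (\<alpha>i (h \<bullet> g)) = \<phi> (act (twist_crossed H \<chi> (regular_crossed H)) h (\<alpha>i g))"
    by (simp add: \<Psi>_def)
qed

end

section \<open>Twisting crossed modules\<close>

lemma crossed_morphism_compose:
  assumes "crossed_morphism K A B f" "crossed_morphism K B C g"
  shows "crossed_morphism K A C (g \<circ> f)"
proof -
  interpret A: crossed_module K A using assms(1) by (simp add: crossed_morphism_def)
  interpret B: crossed_module K B using assms(1) by (simp add: crossed_morphism_def)
  interpret C: crossed_module K C using assms(2) by (simp add: crossed_morphism_def)
  have f: "f v \<in> vcarrier B" if "v \<in> vcarrier A" for v
    using assms(1) that by (auto simp: crossed_morphism_def)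
  have g: "linear_on (vcarrier B) (vscale B) (vscale C) g"
    using assms(2) by (simp add: crossed_morphism_def)
  have "tensor_eq (scale K) (vscale C) (coact C (g (f v))) [(a, g (f w)). (a, w) \<leftarrow> coact A v]"
    if v: "v \<in> vcarrier A" for v
  proof (rule tensor_eqI)
    fix F :: "_ \<Rightarrow> _ \<Rightarrow> 'a" assume F: "bil (scale K) (vscale C) (*) F"
    have "tensor_eq (scale K) (vscale C) (coact C (g (f v))) [(a, g w). (a, w) \<leftarrow> coact B (f v)]"
      using assms(2) f[OF v] by (simp add: crossed_morphism_def)
    from tensor_eqD[OF this F]
    have "sw (coact C (g (f v))) F = sw (coact B (f v)) (\<lambda>a w. F a (g w))"
      by (simp add: sw_map_prod)
    also have "\<dots> = sw [(a, f w). (a, w) \<leftarrow> coact A v] (\<lambda>a w. F a (g w))"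
    proof (rule tensor_eqD_on[OF _ B.vector_space_V B.subspace_V])
      show "tensor_eq (scale K) (vscale B) (coact B (f v)) [(a, f w). (a, w) \<leftarrow> coact A v]"
        using assms(1) v by (simp add: crossed_morphism_def)
      show "set (coact B (f v)) \<subseteq> UNIV \<times> vcarrier B" by (rule B.coact_closed[OF f[OF v]])
      show "set [(a, f w). (a, w) \<leftarrow> coact A v] \<subseteq> UNIV \<times> vcarrier B"
        using A.coact_closed[OF v] f by auto
      show "bilinear_on UNIV (vcarrier B) (scale K) (vscale B) (*) (\<lambda>a w. F a (g w))"
        unfolding bilinear_on_def by (intro conjI ballI bil_lin[OF F] lin_id g)
    qed
    finally show "sw (coact C (g (f v))) F = sw [(a, g (f w)). (a, w) \<leftarrow> coact A v] F"
      by (simp add: sw_map_prod)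
  qed
  moreover have "linear_on (vcarrier A) (vscale A) (vscale C) (g \<circ> f)"
    using assms f unfolding crossed_morphism_def linear_on_def by simp
  ultimately show ?thesis
    using assms f A.crossed_module_axioms C.crossed_module_axioms
    unfolding crossed_morphism_def by (auto simp: image_subset_iff)
qed

lemma crossed_isomorphismI:
  assumes f: "crossed_morphism K A B f"
    and g: "lin (vscale B) (vscale A) g" "\<And>w. w \<in> vcarrier B \<Longrightarrow> g w \<in> vcarrier A"
    and gf: "\<And>v. v \<in> vcarrier A \<Longrightarrow> g (f v) = v" and fg: "\<And>w. w \<in> vcarrier B \<Longrightarrow> f (g w) = w"
  shows "crossed_isomorphism K B A g f"
proof -
  interpret A: crossed_module K A using f by (simp add: crossed_morphism_def)
  interpret B: crossed_module K B using f by (simp add: crossed_morphism_def)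
  have "crossed_morphism K B A g"
    unfolding crossed_morphism_def
  proof (intro conjI allI ballI A.crossed_module_axioms B.crossed_module_axioms)
    show "g ` vcarrier B \<subseteq> vcarrier A" using g(2) by auto
    show "linear_on (vcarrier B) (vscale B) (vscale A) g" using g(1) by (auto simp: linear_on_def)
    fix h w assume w: "w \<in> vcarrier B"
    have "act B h (f (g w)) = f (act A h (g w))"
      using f g(2)[OF w] by (simp add: crossed_morphism_def)
    then have "act B h w = f (act A h (g w))" by (simp add: fg[OF w])
    then show "g (act B h w) = act A h (g w)"
      using gf[OF A.act_closed[OF g(2)[OF w]]] by simp
  next
    fix w assume w: "w \<in> vcarrier B"
    show "tensor_eq (scale K) (vscale A) (coact A (g w)) [(a, g v). (a, v) \<leftarrow> coact B w]"
    proof (rule tensor_eqI)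
      fix F :: "_ \<Rightarrow> _ \<Rightarrow> 'a" assume F: "bil (scale K) (vscale A) (*) F"
      have b: "bil (scale K) (vscale B) (*) (\<lambda>a v. F a (g v))"
        by (intro bilI bil_lin[OF F] lin_id g)
      have "tensor_eq (scale K) (vscale B) (coact B (f (g w))) [(a, f v). (a, v) \<leftarrow> coact A (g w)]"
        using f g(2)[OF w] by (simp add: crossed_morphism_def)
      from tensor_eqD[OF this b]
      have "sw (coact B w) (\<lambda>a v. F a (g v)) = sw (coact A (g w)) (\<lambda>a v. F a (g (f v)))"
        by (simp add: sw_map_prod fg[OF w])
      also have "\<dots> = sw (coact A (g w)) F"
        using A.coact_closed[OF g(2)[OF w]] by (intro sw_cong) (auto simp: gf)
      finally show "sw (coact A (g w)) F = sw [(a, g v). (a, v) \<leftarrow> coact B w] F"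
        by (simp add: sw_map_prod)
    qed
  qed
  with f show ?thesis by (simp add: crossed_isomorphism_def gf fg)
qed

context cocycle_twist
begin

abbreviation "Fx \<equiv> twist_crossed H \<chi>"

lemma twist_crossed_simps [simp]:
  "vcarrier (Fx V) = vcarrier V" "vscale (Fx V) = vscale V" "coact (Fx V) = coact V"
  by (simp_all add: twist_crossed_def)

text \<open>The coaction axioms for the twist of \<open>V\<close> are those of \<open>V\<close>, as the coalgebra does not change; the
  axioms that involve the action hold because they hold in \<open>A\<close>.\<close>

lemma crossed_transfer:
  assumes A: "crossed_module Hx A" and V: "crossed_module H V"
    and surj: "f ` vcarrier A = vcarrier V"
    and f: "linear_on (vcarrier A) (vscale A) (vscale V) f"
    and act: "\<And>h a. a \<in> vcarrier A \<Longrightarrow> f (act A h a) = act (Fx V) h (f a)"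
    and coact: "\<And>a. a \<in> vcarrier A \<Longrightarrow>
      tensor_eq sH (vscale V) (coact V (f a)) [(p, f w). (p, w) \<leftarrow> coact A a]"
  shows "crossed_morphism Hx A (Fx V) f"
proof -
  interpret A: crossed_module Hx A by fact
  interpret V: crossed_module H V by fact
  interpret sA: vector_space "vscale A" by (rule A.vector_space_V)
  have fV: "f a \<in> vcarrier V" if "a \<in> vcarrier A" for a using surj that by auto
  have ex: "\<exists>a. a \<in> vcarrier A \<and> v = f a" if "v \<in> vcarrier V" for v using surj that by auto
  note closed = A.act_closed sA.subspace_add[OF A.subspace_V] sA.subspace_scale[OF A.subspace_V]
  have fadd: "f (a + b) = f a + f b" if "a \<in> vcarrier A" "b \<in> vcarrier A" for a b
    using f that by (simp add: linear_on_def)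
  have fscale: "f (vscale A c a) = vscale V c (f a)" if "a \<in> vcarrier A" for a c
    using f that by (simp add: linear_on_def)
  have bil_act: "bilinear_on UNIV (vcarrier V) sH (vscale V) (vscale V) (act (Fx V))"
    unfolding bilinear_on_def
  proof (intro conjI ballI)
    fix h
    show "linear_on (vcarrier V) (vscale V) (vscale V) (act (Fx V) h)"
      unfolding linear_on_def
    proof (intro conjI ballI allI)
      fix v assume "v \<in> vcarrier V"
      then obtain a where a: "a \<in> vcarrier A" "v = f a" using ex by blast
      note lin_act = A.act_lin_on(2)[of h, unfolded linear_on_def]
      { fix w assume "w \<in> vcarrier V"
        then obtain b where b: "b \<in> vcarrier A" "w = f b" using ex by blast
        have "act (Fx V) h (v + w) = f (act A h (a + b))"
          using a b closed by (simp add: act fadd)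
        also have "\<dots> = act (Fx V) h v + act (Fx V) h w"
          using a b closed lin_act by (simp add: act[symmetric] fadd)
        finally show "act (Fx V) h (v + w) = act (Fx V) h v + act (Fx V) h w" . }
      fix c
      have "act (Fx V) h (vscale V c v) = f (act A h (vscale A c a))"
        using a closed by (simp add: act fscale)
      also have "\<dots> = vscale V c (act (Fx V) h v)"
        using a closed lin_act by (simp add: act[symmetric] fscale)
      finally show "act (Fx V) h (vscale V c v) = vscale V c (act (Fx V) h v)" .
    qed
  next
    fix v assume "v \<in> vcarrier V"
    then obtain a where a: "a \<in> vcarrier A" "v = f a" using ex by blast
    show "lin sH (vscale V) (\<lambda>h. act (Fx V) h v)"
      using A.act_lin_on(1)[OF a(1)] a closed
      by (simp add: linear_on_def act[symmetric] fadd fscale)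
  qed
  have "crossed_module Hx (Fx V)"
  proof (intro crossed_module.intro crossed_module_axioms.intro hopf_algebra_twist, unfold twist_crossed_simps twist_hopf_simps)
    show "bilinear_on UNIV (vcarrier V) sH (vscale V) (vscale V) (act (Fx V))"
      by (rule bil_act)
    fix v h g assume "v \<in> vcarrier V"
    then obtain a where a: "a \<in> vcarrier A" "v = f a" using ex by blast
    show "act (Fx V) h v \<in> vcarrier V" using a by (simp add: act[symmetric] fV A.act_closed)
    show "act (Fx V) \<one> v = v" using a A.act_unit by (simp add: act[symmetric])
    show "act (Fx V) (h \<bullet> g) v = act (Fx V) h (act (Fx V) g v)"
      using a A.act_mult[OF a(1), of h g] by (simp add: act[symmetric] A.act_closed)
    show "tensor_eq sH (vscale V)
          [(h1 \<bullet> v1, act (Fx V) h2 w). (h1, h2) \<leftarrow> \<Delta> h, (v1, w) \<leftarrow> coact V v]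
          [(u1 \<bullet> h2, w). (h1, h2) \<leftarrow> \<Delta> h, (u1, w) \<leftarrow> coact V (act (Fx V) h1 v)]"
    proof (rule tensor_eqI, unfold sw_compr)
      fix F :: "'h \<Rightarrow> _ \<Rightarrow> 'k" assume F: "bil sH (vscale V) (*) F"
      note [lin] = bil_lin[OF F] A.mult_lin[unfolded twist_hopf_simps]
      have "D h (\<lambda>h1 h2. sw (coact V v) (\<lambda>v1 w. F (h1 \<bullet> v1) (act (Fx V) h2 w)))
          = D h (\<lambda>h1 h2. sw (coact A a) (\<lambda>v1 w. F (h1 \<bullet> v1) (f (act A h2 w))))"
      proof (rule sw_eqI)
        fix h1 h2
        have "sw (coact V v) (\<lambda>v1 w. F (h1 \<bullet> v1) (act (Fx V) h2 w))
            = sw [(p, f w). (p, w) \<leftarrow> coact A a] (\<lambda>v1 w. F (h1 \<bullet> v1) (act (Fx V) h2 w))"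
          unfolding a(2)
        proof (rule tensor_eqD_on[OF coact[OF a(1)] V.vector_space_V V.subspace_V])
          show "set (coact V (f a)) \<subseteq> UNIV \<times> vcarrier V" by (rule V.coact_closed[OF fV[OF a(1)]])
          show "set [(p, f w). (p, w) \<leftarrow> coact A a] \<subseteq> UNIV \<times> vcarrier V"
            using A.coact_closed[OF a(1)] fV by auto
          show "bilinear_on UNIV (vcarrier V) sH (vscale V) (*) (\<lambda>v1 w. F (h1 \<bullet> v1) (act (Fx V) h2 w))"
            unfolding bilinear_on_def using bil_act
            by (intro conjI ballI lin) (simp add: bilinear_on_def)
        qed
        also have "\<dots> = sw (coact A a) (\<lambda>v1 w. F (h1 \<bullet> v1) (f (act A h2 w)))"
          unfolding sw_map_prod using A.coact_closed[OF a(1)] by (intro sw_cong) (auto simp: act)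
        finally show "sw (coact V v) (\<lambda>v1 w. F (h1 \<bullet> v1) (act (Fx V) h2 w)) = \<dots>" .
      qed
      also have "\<dots> = D h (\<lambda>h1 h2. sw (coact A (act A h1 a)) (\<lambda>u1 w. F (u1 \<bullet> h2) (f w)))"
      proof (rule A.act_coact_sum[unfolded twist_hopf_simps, OF a(1), of "\<lambda>p w. F p (f w)"])
        show "bilinear_on UNIV (vcarrier A) sH (vscale A) (*) (\<lambda>p w. F p (f w))"
          unfolding bilinear_on_def by (intro conjI ballI lin f)
      qed
      also have "\<dots> = D h (\<lambda>h1 h2. sw (coact V (act (Fx V) h1 v)) (\<lambda>u1 w. F (u1 \<bullet> h2) w))"
      proof (rule sw_eqI)
        fix h1 h2
        have "bil sH (vscale V) (*) (\<lambda>u1 w. F (u1 \<bullet> h2) w)" by (intro bilI lin)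
        from tensor_eqD[OF coact[OF A.act_closed[OF a(1)]] this]
        show "sw (coact A (act A h1 a)) (\<lambda>u1 w. F (u1 \<bullet> h2) (f w))
            = sw (coact V (act (Fx V) h1 v)) (\<lambda>u1 w. F (u1 \<bullet> h2) w)"
          by (simp add: sw_map_prod a act)
      qed
      finally show "D h (\<lambda>h1 h2. sw (coact V v) (\<lambda>v1 w. F (h1 \<bullet> v1) (act (Fx V) h2 w)))
          = D h (\<lambda>h1 h2. sw (coact V (act (Fx V) h1 v)) (\<lambda>u1 w. F (u1 \<bullet> h2) w))" .
    qed
  qed (use V.vector_space_V V.subspace_V V.coact_closed V.coact_linear V.coact_coassoc V.coact_counit in auto)
  then show ?thesis
    using A fV f act coact by (auto simp: crossed_morphism_def)
qed

text \<open>A surjective morphism of crossed modules over \<open>H\<close> is also one between the twists.\<close>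

lemma twist_morphism:
  assumes f: "crossed_morphism H A V f" and FA: "crossed_module Hx (Fx A)" and surj: "f ` vcarrier A = vcarrier V"
  shows "crossed_morphism Hx (Fx A) (Fx V) f"
proof -
  interpret A: crossed_module H A using f by (simp add: crossed_morphism_def)
  interpret V: crossed_module H V using f by (simp add: crossed_morphism_def)
  have fV: "f a \<in> vcarrier V" if "a \<in> vcarrier A" for a using surj that by auto
  have flin: "linear_on (vcarrier A) A.sV V.sV f" using f by (simp add: crossed_morphism_def)
  have fact: "f (act A h a) = act V h (f a)" if "a \<in> vcarrier A" for h a
    using f that by (simp add: crossed_morphism_def)
  have fcoact: "tensor_eq sH V.sV (coact V (f a)) [(p, f w). (p, w) \<leftarrow> coact A a]" if "a \<in> vcarrier A" for a
    using f that by (simp add: crossed_morphism_def)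
  show ?thesis
  proof (rule crossed_transfer[OF FA V.crossed_module_axioms], unfold twist_crossed_simps)
    fix h a assume a: "a \<in> vcarrier A"
    show "f (act (Fx A) h a) = act (Fx V) h (f a)"
    proof (rule eq_by_functionals[OF V.vector_space_V])
      fix \<phi> :: "_ \<Rightarrow> 'k" assume \<phi>: "lin V.sV (*) \<phi>"
      note [lin] = lin_compose[OF \<phi>]
      \<comment> \<open>\<open>f\<close> is linear on the carrier only, so \<open>\<phi> \<circ> f\<close> becomes a functional after a projection.\<close>
      obtain P where P: "lin A.sV A.sV P" "\<And>x. P x \<in> vcarrier A" "\<And>x. x \<in> vcarrier A \<Longrightarrow> P x = x"
        using subspace_projection[OF A.vector_space_V A.subspace_V] by blast
      have \<phi>fP: "lin A.sV (*) (\<lambda>x. \<phi> (f (P x)))"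
        using \<phi> flin P by (simp add: linear_on_def)
      interpret FA: crossed_module Hx "Fx A" by fact
      have inner: "sw (coact V (f y)) (\<lambda>q u. r * \<chi>' q c * \<phi> u)
          = sw (coact A y) (\<lambda>q u. r * \<chi>' q c * \<phi> (f (P u)))" if y: "y \<in> vcarrier A" for y r c
      proof -
        have "bil sH V.sV (*) (\<lambda>q u. r * \<chi>' q c * \<phi> u)" by (intro bilI lin)
        from tensor_eqD[OF fcoact[OF y] this]
        have "sw (coact V (f y)) (\<lambda>q u. r * \<chi>' q c * \<phi> u) = sw (coact A y) (\<lambda>q u. r * \<chi>' q c * \<phi> (f u))"
          by (simp add: sw_map_prod)
        also have "\<dots> = sw (coact A y) (\<lambda>q u. r * \<chi>' q c * \<phi> (f (P u)))"
          using A.coact_closed[OF y] by (intro sw_cong) (auto simp: P(3))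
        finally show ?thesis .
      qed
      have outer: "sw (coact V (f a)) (\<lambda>p w. sw (coact V (act V b w)) (\<lambda>q u. \<chi> x p * \<chi>' q c * \<phi> u))
          = sw (coact A a) (\<lambda>p w. sw (coact A (act A b w)) (\<lambda>q u. \<chi> x p * \<chi>' q c * \<phi> (f (P u))))" for x b c
      proof -
        have "sw (coact V (f a)) (\<lambda>p w. sw (coact V (act V b w)) (\<lambda>q u. \<chi> x p * \<chi>' q c * \<phi> u))
            = sw [(p, f w). (p, w) \<leftarrow> coact A a] (\<lambda>p w. sw (coact V (act V b w)) (\<lambda>q u. \<chi> x p * \<chi>' q c * \<phi> u))"
        proof (rule tensor_eqD_on[OF fcoact[OF a] V.vector_space_V V.subspace_V])
          show "set (coact V (f a)) \<subseteq> UNIV \<times> vcarrier V" by (rule V.coact_closed[OF fV[OF a]])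
          show "set [(p, f w). (p, w) \<leftarrow> coact A a] \<subseteq> UNIV \<times> vcarrier V"
            using A.coact_closed[OF a] fV by auto
          have "linear_on (vcarrier V) V.sV (*) (\<lambda>v. sw (coact V v) (\<lambda>q u. \<chi> x p * \<chi>' q c * \<phi> u))" for p
            by (rule V.coact_lin_on) (use \<phi> \<chi>'_bil in \<open>auto simp: bilinear_on_def linear_on_def algebra_simps\<close>)
          then have "linear_on (vcarrier V) V.sV (*) (\<lambda>w. sw (coact V (act V b w)) (\<lambda>q u. \<chi> x p * \<chi>' q c * \<phi> u))" for p
            using V.act_lin_on(2)[of b] V.act_closed by (simp add: linear_on_def)
          then show "bilinear_on UNIV (vcarrier V) sH V.sV (*)
              (\<lambda>p w. sw (coact V (act V b w)) (\<lambda>q u. \<chi> x p * \<chi>' q c * \<phi> u))"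
            unfolding bilinear_on_def by (intro conjI ballI lin)
        qed
        also have "\<dots> = sw (coact A a) (\<lambda>p w. sw (coact A (act A b w)) (\<lambda>q u. \<chi> x p * \<chi>' q c * \<phi> (f (P u))))"
          unfolding sw_map_prod using A.coact_closed[OF a]
          by (intro sw_cong) (auto simp: fact[symmetric] inner A.act_closed)
        finally show ?thesis .
      qed
      have "\<phi> (f (act (Fx A) h a)) = \<phi> (f (P (act (Fx A) h a)))"
        using FA.act_closed[of a h] a by (simp add: P(3))
      also have "\<dots> = \<phi> (act (Fx V) h (f a))"
        unfolding twist_act_functional[OF \<phi>fP] twist_act_functional[OF \<phi>] outer ..
      finally show "\<phi> (f (act (Fx A) h a)) = \<phi> (act (Fx V) h (f a))" .
    qed
  qed (use surj flin fcoact in auto)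
qed

section \<open>The comparison isomorphism\<close>

lemma regular_simps [simp]:
  "vcarrier (regular_crossed K') = UNIV" "vscale (regular_crossed K') = scale K'" "act (regular_crossed K') = mult K'"
  by (simp_all add: regular_crossed_def)

lemma ker_simps [simp]:
  "vcarrier (ker_counit_crossed K') = {h. counit K' h = 0}" "vscale (ker_counit_crossed K') = scale K'"
  "act (ker_counit_crossed K') = mult K'"
  by (simp_all add: ker_counit_crossed_def restrict_crossed_def)

lemma alpha_inv_morphism: "crossed_morphism Hx (regular_crossed Hx) (Fx (regular_crossed H)) \<alpha>i"
proof (rule crossed_transfer)
  show "crossed_module Hx (regular_crossed Hx)"
    by (rule hopf_algebra.crossed_module_regular[OF hopf_algebra_twist])
  show "crossed_module H (regular_crossed H)" by (rule crossed_module_regular)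
  show "\<alpha>i ` vcarrier (regular_crossed Hx) = vcarrier (regular_crossed H)"
    using alpha_inv_alpha by (auto intro: rangeI simp: image_iff) metis
qed (simp_all add: alpha_inv_lin alpha_inv_act coact_alpha_inv)

text \<open>The coaction of the augmentation ideal uses other representatives than that of \<open>H\<close>, but this does
  not affect the twisted action.\<close>

lemma twist_act_ker:
  assumes "v \<in> K" shows "act (Fx (ker_counit_crossed H)) h v = act (Fx (regular_crossed H)) h v"
proof (rule eq_by_functionals[OF vector_space_H])
  fix \<phi> assume \<phi>: "lin1 \<phi>"
  note [lin] = lin_compose[OF \<phi>]
  let ?ker = "coact (ker_counit_crossed H)"
  have ker: "sw (?ker w) F = ad w F" if "w \<in> K" "bil2 F" for w F
    by (rule tensor_eqD[OF ker_coact_eq[OF that(1)] that(2)])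
  have "sw (?ker v) (\<lambda>p w. sw (?ker (b \<cdot> w)) (\<lambda>q u. \<chi> x p * \<chi>' q c * \<phi> u))
      = ad v (\<lambda>p w. ad (b \<cdot> w) (\<lambda>q u. \<chi> x p * \<chi>' q c * \<phi> u))" for x b c
  proof -
    have "sw (?ker v) (\<lambda>p w. sw (?ker (b \<cdot> w)) (\<lambda>q u. \<chi> x p * \<chi>' q c * \<phi> u))
        = sw (?ker v) (\<lambda>p w. ad (b \<cdot> w) (\<lambda>q u. \<chi> x p * \<chi>' q c * \<phi> u))"
      using ker_coact_closed[OF assms]
      by (intro sw_cong ker bilI lin) (auto simp: counit_mult)
    also have "\<dots> = ad v (\<lambda>p w. ad (b \<cdot> w) (\<lambda>q u. \<chi> x p * \<chi>' q c * \<phi> u))"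
      by (intro ker assms bilI lin)
    finally show ?thesis .
  qed
  then show "\<phi> (act (Fx (ker_counit_crossed H)) h v) = \<phi> (act (Fx (regular_crossed H)) h v)"
    using twist_act_functional[of "ker_counit_crossed H" \<phi> h v] twist_act_functional[of "regular_crossed H" \<phi> h v] \<phi>
    by simp
qed

lemma alpha_inv_morphism_ker:
  "crossed_morphism Hx (ker_counit_crossed Hx) (Fx (ker_counit_crossed H)) \<alpha>i"
proof (rule crossed_transfer)
  interpret T: hopf_algebra Hx by (rule hopf_algebra_twist)
  show "crossed_module Hx (ker_counit_crossed Hx)" by (rule T.crossed_module_ker)
  show "crossed_module H (ker_counit_crossed H)" by (rule crossed_module_ker)
  have "\<exists>h\<in>K. v = \<alpha>i h" if "v \<in> K" for v
    using that by (intro bexI[of _ "\<alpha> v"]) (auto simp: alpha_inv_alpha counit_alpha)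
  then show "\<alpha>i ` vcarrier (ker_counit_crossed Hx) = vcarrier (ker_counit_crossed H)"
    by (auto simp: counit_alpha_inv image_iff)
  show "linear_on (vcarrier (ker_counit_crossed Hx)) (vscale (ker_counit_crossed Hx))
      (vscale (ker_counit_crossed H)) \<alpha>i"
    using alpha_inv_lin by (simp add: linear_on_def)
  fix h a assume "a \<in> vcarrier (ker_counit_crossed Hx)"
  then have a: "a \<in> K" by simp
  then have ia: "\<alpha>i a \<in> K" by (simp add: counit_alpha_inv)
  show "\<alpha>i (act (ker_counit_crossed Hx) h a) = act (Fx (ker_counit_crossed H)) h (\<alpha>i a)"
    by (simp add: twist_act_ker[OF ia] alpha_inv_act)
  show "tensor_eq sH (vscale (ker_counit_crossed H)) (coact (ker_counit_crossed H) (\<alpha>i a))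
      [(p, \<alpha>i w). (p, w) \<leftarrow> coact (ker_counit_crossed Hx) a]"
    unfolding ker_simps
  proof (rule tensor_eqI)
    fix F assume F: "bil2 F"
    note [lin] = bil_lin[OF F]
    have b: "bil2 (\<lambda>p w. F p (\<alpha>i w))" by (intro bilI lin)
    have "sw (coact (ker_counit_crossed H) (\<alpha>i a)) F = ad (\<alpha>i a) F"
      by (rule tensor_eqD[OF ker_coact_eq[OF ia] F])
    also have "\<dots> = T.ad a (\<lambda>p w. F p (\<alpha>i w))"
      using tensor_eqD[OF coact_alpha_inv F] by (simp add: sw_map_prod)
    also have "\<dots> = sw (coact (ker_counit_crossed Hx) a) (\<lambda>p w. F p (\<alpha>i w))"
      using tensor_eqD[OF T.ker_coact_eq, of a] a b by simp
    finally show "sw (coact (ker_counit_crossed H) (\<alpha>i a)) F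
        = sw [(p, \<alpha>i w). (p, w) \<leftarrow> coact (ker_counit_crossed Hx) a] F" by (simp add: sw_map_prod)
  qed
qed

theorem alpha_isomorphism:
  "crossed_isomorphism Hx (Fx (regular_crossed H)) (regular_crossed Hx) \<alpha> \<alpha>i"
  by (rule crossed_isomorphismI[OF alpha_inv_morphism])
    (simp_all add: alpha_lin alpha_alpha_inv alpha_inv_alpha)

theorem alpha_isomorphism_ker:
  "crossed_isomorphism Hx (Fx (ker_counit_crossed H)) (ker_counit_crossed Hx) \<alpha> \<alpha>i"
  by (rule crossed_isomorphismI[OF alpha_inv_morphism_ker])
    (simp_all add: alpha_lin alpha_alpha_inv alpha_inv_alpha counit_alpha)

end

section \<open>The projection of the twisted calculus\<close>

text \<open>A calculus with its projection \<open>\<pi>\<close> onto the crossed module \<open>V\<close> of right-invariant forms.\<close>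

locale projection_twist = calculus_twist H \<chi> \<chi>' \<Omega>
  for H :: "('k::field, 'h::ab_group_add) hopf" (structure) and \<chi> \<chi>'
    and \<Omega> :: "('k, 'h, 'w::ab_group_add) calculus" +
  fixes V :: "('k, 'h, 'w) crossed" and \<pi> :: "'h \<Rightarrow> 'w"
  assumes corresponds: "corresponds_to H \<Omega> V \<pi>"
begin

abbreviation "C \<equiv> vcarrier V"

lemma carrier: "C = right_invariant H \<Omega>" and vscale_V: "vscale V = sW"
  and coact_lc: "v \<in> C \<Longrightarrow> tensor_eq sH sW (coact V v) (lc v)"
  and \<pi>_morphism: "crossed_morphism H (ker_counit_crossed H) V \<pi>"
  and \<pi>_surj: "\<pi> ` K = C"
  and generates: "\<exists>xs. set xs \<subseteq> C \<times> UNIV \<and> \<omega> = (\<Sum>(v, g)\<leftarrow>xs. ract \<Omega> v g)"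
  and free: "set xs \<subseteq> C \<times> UNIV \<Longrightarrow> set ys \<subseteq> C \<times> UNIV \<Longrightarrow>
        (\<Sum>(v, g)\<leftarrow>xs. ract \<Omega> v g) = (\<Sum>(v, g)\<leftarrow>ys. ract \<Omega> v g) \<Longrightarrow> tensor_eq sW sH xs ys"
  and lact_ract_form: "v \<in> C \<Longrightarrow> lact \<Omega> h (ract \<Omega> v g) = D h (\<lambda>h1 h2. ract \<Omega> (act V h1 v) (h2 \<cdot> g))"
  and diff_form: "d h = D h (\<lambda>h1 h2. ract \<Omega> (\<pi> (h1 - sH (\<epsilon> h1) \<one>)) h2)"
  using corresponds unfolding corresponds_to_def sw_def by blast+

sublocale V: crossed_module H V
  using \<pi>_morphism by (simp add: crossed_morphism_def)

lemma C_subspace: "module.subspace sW C" using V.subspace_V by (simp add: vscale_V)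

lemma sw_coact: "v \<in> C \<Longrightarrow> bil sH sW ((*) :: 'k \<Rightarrow> 'k \<Rightarrow> 'k) F \<Longrightarrow> sw (coact V v) F = sw (lc v) F"
  by (rule tensor_eqD[OF coact_lc])

lemma coact_C: "v \<in> C \<Longrightarrow> (p, w) \<in> set (coact V v) \<Longrightarrow> w \<in> C"
  using V.coact_closed by fastforce

lemma sw_rc: 
  assumes "v \<in> C" "bil sH sW ((*) :: 'k \<Rightarrow> 'k \<Rightarrow> 'k) F" shows "sw (rc v) F = F \<one> v"
proof -
  have "tensor_eq sW sH (rcoact \<Omega> v) [(v, \<one>)]"
    using assms(1) by (simp add: carrier right_invariant_def)
  moreover have "bil sW sH (*) (\<lambda>a b. F b a)" by (intro bilI lin bil_lin[OF assms(2)])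
  ultimately have "sw (rcoact \<Omega> v) (\<lambda>a b. F b a) = F \<one> v" by (auto dest: tensor_eqD)
  then show ?thesis by (simp add: sw_swapl)
qed

lemma co\<Omega>: "comodule sH \<Delta> sW lc" "comodule sH \<Delta>r sW rc"
  using bicomodule_\<Omega> by (auto simp: bicomodule_def)

lemma ract_functional:
  assumes "lin sW ((*) :: 'k \<Rightarrow> 'k \<Rightarrow> 'k) \<phi>" shows "bil sW sH (*) (\<lambda>\<omega> g. \<phi> (ract \<Omega> \<omega> g))"
  by (intro bilI lin_compose[OF assms] bilD1[OF ract_bilinear] bilD2[OF ract_bilinear])

lemma lact_functional:
  assumes "lin sW ((*) :: 'k \<Rightarrow> 'k \<Rightarrow> 'k) \<phi>" shows "bil sH sW (*) (\<lambda>g \<omega>. \<phi> (lact \<Omega> g \<omega>))"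
  by (intro bilI lin_compose[OF assms] bilD1[OF lact_bilinear] bilD2[OF lact_bilinear])

lemma projection_morphism: "crossed_morphism Hx (Fx (ker_counit_crossed H)) (Fx V) \<pi>"
proof (rule twist_morphism[OF \<pi>_morphism])
  show "crossed_module Hx (Fx (ker_counit_crossed H))"
    using alpha_inv_morphism_ker by (simp add: crossed_morphism_def)
  show "\<pi> ` vcarrier (ker_counit_crossed H) = C" by (simp add: \<pi>_surj)
qed

text \<open>\<open>v \<bullet> g = \<chi>(v\<^bsub>(1)\<^esub> \<otimes> g\<^bsub>(1)\<^esub>) v\<^bsub>(\<infinity>)\<^esub> g\<^bsub>(2)\<^esub>\<close> for right-invariant \<open>v\<close>: the right coaction gives \<open>\<chi>\<inverse>(1 \<otimes> g\<^bsub>(3)\<^esub>)\<close>.\<close>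

lemma twist_ract:
  assumes \<phi>: "lin sW (*) \<phi>" and v: "v \<in> C"
  shows "\<phi> (ract \<Omega>x v g) = cact2 lc \<Delta> \<chi> (\<lambda>\<omega> g. \<phi> (ract \<Omega> \<omega> g)) v g"
proof -
  let ?R = "\<lambda>\<omega> g. \<phi> (ract \<Omega> \<omega> g)"
  have R: "bil sW sH (*) ?R" by (rule ract_functional[OF \<phi>])
  let ?B = "cact2 rc \<Delta>r \<chi>' ?R"
  have coHr: "comodule sH \<Delta>r sH \<Delta>r" using bicomodule_H by (simp add: bicomodule_def)
  have B: "bil sW sH (*) ?B" by (rule cact2_bil[OF co\<Omega>(2) coHr \<chi>'_bil R])
  have BR: "?B w g = ?R w g" if w: "w \<in> C" for w g
  proof -
    have "?B w g = cact1 \<Delta>r (\<chi>' \<one>) (?R w) g"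
      unfolding cact2_def
      by (rule sw_rc[OF w]; unfold cact1_def; intro bilI lin bil_lin[OF R])
    also have "\<dots> = ?R w g"
      unfolding cact1_def \<chi>'_unit_left sw_swapl mult.commute[of "\<epsilon> _"]
      by (rule comult_counit_right[OF bilD2[OF R]])
    finally show ?thesis .
  qed
  note [lin] = bil_lin[OF B] bil_lin[OF R]
  have b: "bil sH sW (*) (\<lambda>a \<xi>. cact1 \<Delta> (\<chi> a) (?B \<xi>) g)" "bil sH sW (*) (\<lambda>a \<xi>. cact1 \<Delta> (\<chi> a) (?R \<xi>) g)"
    unfolding cact1_def by (intro bilI lin)+
  have "\<phi> (ract \<Omega>x v g) = cact2 lc \<Delta> \<chi> ?B v g"
    using twistedD[OF twisted_ract \<phi>] by (simp add: fun_eq_iff)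
  also have "\<dots> = sw (coact V v) (\<lambda>a \<xi>. cact1 \<Delta> (\<chi> a) (?B \<xi>) g)"
    unfolding cact2_def[of lc] by (rule sw_coact[OF v b(1), symmetric])
  also have "\<dots> = sw (coact V v) (\<lambda>a \<xi>. cact1 \<Delta> (\<chi> a) (?R \<xi>) g)"
    by (rule sw_cong) (simp add: cact1_def BR[OF coact_C[OF v]])
  also have "\<dots> = cact2 lc \<Delta> \<chi> ?R v g"
    unfolding cact2_def[of lc] by (rule sw_coact[OF v b(2)])
  finally show ?thesis .
qed

lemma cact2_lc_cancel:
  assumes "bil sW sH (*) \<beta>"
  shows "cact2 lc \<Delta> \<chi>' (cact2 lc \<Delta> \<chi> \<beta>) = \<beta>" "cact2 lc \<Delta> \<chi> (cact2 lc \<Delta> \<chi>' \<beta>) = \<beta>"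
proof -
  have e: "cact2 lc \<Delta> eps2 \<beta> = \<beta>"
    by (rule cact2_counit(1)[OF bicomodule_\<Omega> bicomodule_H assms])
  show "cact2 lc \<Delta> \<chi>' (cact2 lc \<Delta> \<chi> \<beta>) = \<beta>" "cact2 lc \<Delta> \<chi> (cact2 lc \<Delta> \<chi>' \<beta>) = \<beta>"
    by (simp_all only: cact2_assoc[OF co\<Omega>(1) comodule_H _ _ assms] \<chi>_bil \<chi>'_bil \<chi>_\<chi>' \<chi>'_\<chi> e)
qed

text \<open>A representative of \<open>f(v\<^bsub>(1)\<^esub> \<otimes> g\<^bsub>(1)\<^esub>) v\<^bsub>(\<infinity>)\<^esub> \<otimes> g\<^bsub>(2)\<^esub>\<close> in \<open>V \<otimes> H\<close>.  For \<open>f = \<chi>\<close> and \<open>f = \<chi>\<inverse>\<close> these are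
  inverse maps, which identify \<open>V \<otimes> H\<close> for the twisted right action with \<open>V \<otimes> H\<close> for the original one.\<close>

definition shift :: "('h \<Rightarrow> 'h \<Rightarrow> 'k) \<Rightarrow> 'w \<Rightarrow> 'h \<Rightarrow> ('w \<times> 'h) list" where
  "shift f v g = [(sW (f p c) w, g'). (p, w) \<leftarrow> coact V v, (c, g') \<leftarrow> \<Delta> g]"

lemma shift_C: "v \<in> C \<Longrightarrow> set (shift f v g) \<subseteq> C \<times> UNIV"
proof -
  interpret W: vector_space sW by (rule vector_space_\<Omega>)
  show "v \<in> C \<Longrightarrow> set (shift f v g) \<subseteq> C \<times> UNIV"
    using coact_C W.subspace_scale[OF C_subspace] by (auto simp: shift_def)
qed

lemma sw_shift:
  assumes "v \<in> C" "bil sW sH (*) \<beta>" "bil2 f"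
  shows "sw (shift f v g) \<beta> = cact2 lc \<Delta> f \<beta> v g"
proof -
  note [lin] = bil_lin[OF assms(2)] bil_lin[OF assms(3)]
  have "sw (shift f v g) \<beta> = sw (coact V v) (\<lambda>p w. cact1 \<Delta> (f p) (\<beta> w) g)"
    unfolding shift_def sw_compr cact1_def by (simp add: lin_scale[OF bilD1[OF assms(2)]])
  also have "\<dots> = cact2 lc \<Delta> f \<beta> v g"
    unfolding cact2_def by (rule sw_coact[OF assms(1)]) (unfold cact1_def, intro bilI lin)
  finally show ?thesis .
qed

lemma sum_concat_shift:
  "(\<Sum>(v, g)\<leftarrow>concat (map (\<lambda>(v, g). shift f v g) xs). m v g) = sw xs (\<lambda>v g. sw (shift f v g) m)"
  unfolding sw_def[symmetric] by (rule sw_concat)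

lemma shift_list_C: "set xs \<subseteq> C \<times> UNIV \<Longrightarrow> set (concat (map (\<lambda>(v, g). shift f v g) xs)) \<subseteq> C \<times> UNIV"
proof (rule subsetI)
  fix q assume xs: "set xs \<subseteq> C \<times> UNIV" and "q \<in> set (concat (map (\<lambda>(v, g). shift f v g) xs))"
  then obtain v g where "(v, g) \<in> set xs" "q \<in> set (shift f v g)" by auto
  with xs shift_C[of v f g] show "q \<in> C \<times> UNIV" by blast
qed

lemma ract_eq_shift:
  assumes v: "v \<in> C"
  shows "sw (shift \<chi>' v g) (ract \<Omega>x) = ract \<Omega> v g" "sw (shift \<chi> v g) (ract \<Omega>) = ract \<Omega>x v g"
proof -
  show "sw (shift \<chi>' v g) (ract \<Omega>x) = ract \<Omega> v g"
  proof (rule eq_by_functionals[OF vector_space_\<Omega>])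
    fix \<phi> :: "'w \<Rightarrow> 'k" assume \<phi>: "lin sW (*) \<phi>"
    note R = ract_functional[OF \<phi>]
    have "\<phi> (sw (shift \<chi>' v g) (ract \<Omega>x)) = sw (shift \<chi>' v g) (cact2 lc \<Delta> \<chi> (\<lambda>\<omega> g. \<phi> (ract \<Omega> \<omega> g)))"
      unfolding lin_sw[OF \<phi>] using shift_C[OF v, of \<chi>' g]
      by (intro sw_cong twist_ract[OF \<phi>]) auto
    also have "\<dots> = \<phi> (ract \<Omega> v g)"
      by (simp only: sw_shift[OF v cact2_bil[OF co\<Omega>(1) comodule_H \<chi>_bil R] \<chi>'_bil] cact2_lc_cancel[OF R])
    finally show "\<phi> (sw (shift \<chi>' v g) (ract \<Omega>x)) = \<phi> (ract \<Omega> v g)" .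
  qed
  show "sw (shift \<chi> v g) (ract \<Omega>) = ract \<Omega>x v g"
  proof (rule eq_by_functionals[OF vector_space_\<Omega>])
    fix \<phi> :: "'w \<Rightarrow> 'k" assume \<phi>: "lin sW (*) \<phi>"
    show "\<phi> (sw (shift \<chi> v g) (ract \<Omega>)) = \<phi> (ract \<Omega>x v g)"
      unfolding lin_sw[OF \<phi>] twist_ract[OF \<phi> v] by (rule sw_shift[OF v ract_functional[OF \<phi>] \<chi>_bil])
  qed
qed

lemma twist_generates: "\<exists>xs. set xs \<subseteq> C \<times> UNIV \<and> \<omega> = (\<Sum>(v, g)\<leftarrow>xs. ract \<Omega>x v g)"
proof -
  obtain xs where xs: "set xs \<subseteq> C \<times> UNIV" "\<omega> = (\<Sum>(v, g)\<leftarrow>xs. ract \<Omega> v g)" using generates by blast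
  have "(\<Sum>(v, g)\<leftarrow>concat (map (\<lambda>(v, g). shift \<chi>' v g) xs). ract \<Omega>x v g) = sw xs (ract \<Omega>)"
    unfolding sum_concat_shift using xs(1) by (intro sw_cong ract_eq_shift) auto
  then have "(\<Sum>(v, g)\<leftarrow>concat (map (\<lambda>(v, g). shift \<chi>' v g) xs). ract \<Omega>x v g) = \<omega>"
    unfolding xs(2) sw_def .
  then show ?thesis using shift_list_C[OF xs(1), of \<chi>'] by blast
qed

lemma twist_free:
  assumes xs: "set xs \<subseteq> C \<times> UNIV" and ys: "set ys \<subseteq> C \<times> UNIV"
    and eq: "(\<Sum>(v, g)\<leftarrow>xs. ract \<Omega>x v g) = (\<Sum>(v, g)\<leftarrow>ys. ract \<Omega>x v g)"
  shows "tensor_eq sW sH xs ys"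
proof -
  let ?S = "\<lambda>zs. concat (map (\<lambda>(v, g). shift \<chi> v g) zs)"
  have S: "(\<Sum>(v, g)\<leftarrow>?S zs. ract \<Omega> v g) = (\<Sum>(v, g)\<leftarrow>zs. ract \<Omega>x v g)" if "set zs \<subseteq> C \<times> UNIV" for zs
    unfolding sum_concat_shift sw_def[of zs, symmetric] using that by (intro sw_cong ract_eq_shift) auto
  have t: "tensor_eq sW sH (?S xs) (?S ys)"
    by (rule free) (simp_all only: shift_list_C xs ys S eq)
  show ?thesis
  proof (rule tensor_eqI)
    fix \<beta> :: "'w \<Rightarrow> 'h \<Rightarrow> 'k" assume \<beta>: "bil sW sH (*) \<beta>"
    let ?\<beta>' = "cact2 lc \<Delta> \<chi>' \<beta>"
    have \<beta>': "bil sW sH (*) ?\<beta>'" by (rule cact2_bil[OF co\<Omega>(1) comodule_H \<chi>'_bil \<beta>])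
    have "sw (?S zs) ?\<beta>' = sw zs \<beta>" if "set zs \<subseteq> C \<times> UNIV" for zs
      unfolding sw_concat using that
      by (intro sw_cong) (auto simp: sw_shift[OF _ \<beta>' \<chi>_bil] cact2_lc_cancel[OF \<beta>])
    with tensor_eqD[OF t \<beta>'] xs ys show "sw xs \<beta> = sw ys \<beta>" by simp
  qed
qed

text \<open>\<open>h \<bullet> v = (h\<^bsub>(1)\<^esub> \<triangleright>\<^sup>\<chi> v) \<bullet> h\<^bsub>(2)\<^esub>\<close> in the twisted calculus.\<close>

lemma twist_lact_invariant:
  assumes v: "v \<in> C"
  shows "lact \<Omega>x h v = D h (\<lambda>h1 h2. ract \<Omega>x (act (Fx V) h1 v) h2)"
proof (rule eq_by_functionals[OF vector_space_\<Omega>])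
  fix \<phi> :: "'w \<Rightarrow> 'k" assume \<phi>: "lin sW (*) \<phi>"
  let ?R = "\<lambda>\<omega> g. \<phi> (ract \<Omega> \<omega> g)" and ?L = "\<lambda>g \<omega>. \<phi> (lact \<Omega> g \<omega>)"
  have R: "bil sW sH (*) ?R" and L: "bil sH sW (*) ?L"
    by (rule ract_functional[OF \<phi>] lact_functional[OF \<phi>])+
  have coHr: "comodule sH \<Delta>r sH \<Delta>r" using bicomodule_H by (simp add: bicomodule_def)
  let ?B = "cact2 \<Delta>r rc \<chi>' ?L" and ?Q = "cact2 lc \<Delta> \<chi> ?R"
  have B: "bil sH sW (*) ?B" by (rule cact2_bil[OF coHr co\<Omega>(2) \<chi>'_bil L])
  have Q: "bil sW sH (*) ?Q" by (rule cact2_bil[OF co\<Omega>(1) comodule_H \<chi>_bil R])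
  note [lin] = bil_lin[OF R] bil_lin[OF L] bil_lin[OF B] bil_lin[OF Q]
  have BL: "?B g w = D g (\<lambda>b c. ?R (act V b w) c)" if w: "w \<in> C" for g w
  proof -
    have "?B g w = sw (\<Delta>r g) (\<lambda>a \<xi>. \<chi>' a \<one> * ?L \<xi> w)"
      unfolding cact2_def cact1_def
      by (rule sw_eqI, rule sw_rc[OF w]; intro bilI lin)
    also have "\<dots> = ?L g w"
      unfolding \<chi>'_unit_right sw_swapl mult.commute[of "\<epsilon> _"]
      by (rule comult_counit_right[OF bilD1[OF L]])
    also have "\<dots> = \<phi> (lact \<Omega> g (ract \<Omega> w \<one>))" by (simp add: ract_unit)
    also have "\<dots> = D g (\<lambda>b c. ?R (act V b w) c)"
      unfolding lact_ract_form[OF w] lin_sw[OF \<phi>] by (simp add: unit_right)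
    finally show ?thesis .
  qed
  have "\<phi> (lact \<Omega>x h v) = cact2 \<Delta> lc \<chi> ?B h v"
    using twistedD[OF twisted_lact \<phi>] by (simp add: fun_eq_iff)
  also have "\<dots> = D h (\<lambda>x y. sw (coact V v) (\<lambda>p w. \<chi> x p * ?B y w))"
    unfolding cact2_def[of \<Delta>] cact1_def by (rule sw_eqI, rule sw_coact[OF v, symmetric]; intro bilI lin)
  also have "\<dots> = D h (\<lambda>x y. sw (coact V v) (\<lambda>p w. \<chi> x p * D y (\<lambda>b c. ?R (act V b w) c)))"
    by (rule sw_eqI, rule sw_cong) (simp add: BL[OF coact_C[OF v]])
  also have "\<dots> = sw (coact V v) (\<lambda>p w. D h (\<lambda>x y. \<chi> x p * D y (\<lambda>b c. ?R (act V b w) c)))"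
    by (rule sw_swap)
  also have "\<dots> = sw (coact V v) (\<lambda>p w. D h (\<lambda>h1 h2. D h1 (\<lambda>x y. D y (\<lambda>b c.
      sw (coact V (act V b w)) (\<lambda>q u. \<chi> x p * \<chi>' q c * ?Q u h2)))))"
  proof (rule sw_cong)
    fix p w assume "(p, w) \<in> set (coact V v)"
    then have w: "w \<in> C" by (rule coact_C[OF v])
    have [lin]: "linear_on A s sH g \<Longrightarrow> linear_on A s sW (\<lambda>x. act V (g x) w)" for A s and g :: "'z::ab_group_add \<Rightarrow> 'h"
      using V.act_lin_on(1)[OF w] unfolding vscale_V by (rule lin_compose)
    note [lin] = comodule_lin[OF co\<Omega>(1)]
    have "D h (\<lambda>h1 h2. D h1 (\<lambda>x y. D y (\<lambda>b c. sw (coact V (act V b w)) (\<lambda>q u. \<chi> x p * \<chi>' q c * ?Q u h2))))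
        = D h (\<lambda>h1 h2. D h1 (\<lambda>x y. D y (\<lambda>b c. sw (lc (act V b w)) (\<lambda>q u. \<chi> x p * \<chi>' q c * ?Q u h2))))"
      by (rule sw_eqI, rule sw_eqI, rule sw_eqI, rule sw_coact[OF V.act_closed[OF w]]; intro bilI lin)
    also have "\<dots> = D h (\<lambda>x z. D z (\<lambda>y h2. D y (\<lambda>b c. sw (lc (act V b w)) (\<lambda>q u. \<chi> x p * \<chi>' q c * ?Q u h2))))"
      by (rule comult_assoc; intro lin)
    also have "\<dots> = D h (\<lambda>x z. D z (\<lambda>b k. D k (\<lambda>c h2. sw (lc (act V b w)) (\<lambda>q u. \<chi> x p * \<chi>' q c * ?Q u h2))))"
      by (rule sw_eqI, rule comult_assoc; intro lin)
    also have "\<dots> = D h (\<lambda>x z. D z (\<lambda>b k. sw (lc (act V b w)) (\<lambda>q u. D k (\<lambda>c h2. \<chi> x p * \<chi>' q c * ?Q u h2))))"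
      by (rule sw_eqI, rule sw_eqI, rule sw_swap)
    also have "\<dots> = D h (\<lambda>x z. \<chi> x p * D z (\<lambda>b k. cact2 lc \<Delta> \<chi>' ?Q (act V b w) k))"
      by (simp only: cact2_def[of lc \<Delta> \<chi>'] cact1_def[of \<Delta> "\<chi>' _"] sw_mult_left mult.assoc)
    also have "\<dots> = D h (\<lambda>x y. \<chi> x p * D y (\<lambda>b c. ?R (act V b w) c))"
      unfolding cact2_lc_cancel(1)[OF R] ..
    finally show "D h (\<lambda>x y. \<chi> x p * D y (\<lambda>b c. ?R (act V b w) c)) = D h (\<lambda>h1 h2. D h1 (\<lambda>x y. D y (\<lambda>b c.
      sw (coact V (act V b w)) (\<lambda>q u. \<chi> x p * \<chi>' q c * ?Q u h2))))" by simp
  qed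
  also have "\<dots> = D h (\<lambda>h1 h2. D h1 (\<lambda>x y. D y (\<lambda>b c. sw (coact V v) (\<lambda>p w.
      sw (coact V (act V b w)) (\<lambda>q u. \<chi> x p * \<chi>' q c * ?Q u h2)))))"
    by (rule sw_swap3[symmetric])
  also have "\<dots> = D h (\<lambda>h1 h2. ?Q (act (Fx V) h1 v) h2)"
  proof (rule sw_eqI)
    fix h1 h2
    have "lin (vscale V) (*) (\<lambda>u. ?Q u h2)" unfolding vscale_V by (rule bilD1[OF Q])
    from twist_act_functional[OF this, of h1 v]
    show "D h1 (\<lambda>x y. D y (\<lambda>b c. sw (coact V v) (\<lambda>p w.
      sw (coact V (act V b w)) (\<lambda>q u. \<chi> x p * \<chi>' q c * ?Q u h2)))) = ?Q (act (Fx V) h1 v) h2" by simp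
  qed
  also have "\<dots> = D h (\<lambda>h1 h2. \<phi> (ract \<Omega>x (act (Fx V) h1 v) h2))"
  proof (rule sw_eqI)
    interpret T: crossed_module Hx "Fx V"
      using projection_morphism by (simp add: crossed_morphism_def)
    fix h1 h2
    have "act (Fx V) h1 v \<in> C" using T.act_closed[of v h1] v by simp
    from twist_ract[OF \<phi> this] show "?Q (act (Fx V) h1 v) h2 = \<phi> (ract \<Omega>x (act (Fx V) h1 v) h2)" by simp
  qed
  finally show "\<phi> (lact \<Omega>x h v) = \<phi> (D h (\<lambda>h1 h2. ract \<Omega>x (act (Fx V) h1 v) h2))"
    by (simp add: lin_sw[OF \<phi>])
qed

text \<open>The Maurer-Cartan form, which is \<open>\<pi>\<close> made total by the projection \<open>h \<mapsto> h - \<epsilon>(h) 1\<close> onto \<open>ker \<epsilon>\<close>.\<close>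

definition mc :: "'h \<Rightarrow> 'w" where "mc h = \<pi> (h - sH (\<epsilon> h) \<one>)"

lemma mc_arg: "h - sH (\<epsilon> h) \<one> \<in> K"
  by (simp add: lin_diff[OF counit_linear] lin_scale[OF counit_linear] counit_unit)

lemma mc_K: assumes "h \<in> K" shows "mc h = \<pi> h"
proof -
  interpret vector_space sH by (rule vector_space_H)
  show ?thesis using assms by (simp add: mc_def)
qed

lemma \<pi>_lin: "linear_on K sH sW \<pi>"
  using \<pi>_morphism by (simp add: crossed_morphism_def vscale_V)

lemma mc_C: "mc h \<in> C"
  using \<pi>_surj mc_arg unfolding mc_def by blast

lemma mc_lin: "lin sH sW mc"
proof (rule linI)
  interpret vector_space sH by (rule vector_space_H)
  fix x y c
  have eq: "(x + y) - sH (\<epsilon> (x + y)) \<one> = (x - sH (\<epsilon> x) \<one>) + (y - sH (\<epsilon> y) \<one>)"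
    by (simp add: lin_add[OF counit_linear] scale_left_distrib)
  then show "mc (x + y) = mc x + mc y"
    using \<pi>_lin mc_arg[of x] mc_arg[of y] unfolding mc_def eq linear_on_def by blast
  have eq: "sH c x - sH (\<epsilon> (sH c x)) \<one> = sH c (x - sH (\<epsilon> x) \<one>)"
    by (simp add: lin_scale[OF counit_linear] scale_right_diff_distrib)
  then show "mc (sH c x) = sW c (mc x)"
    using \<pi>_lin mc_arg[of x] unfolding mc_def eq linear_on_def by blast
qed

lemma mc_unit: "mc \<one> = 0"
proof -
  interpret vector_space sH by (rule vector_space_H)
  have "mc \<one> = \<pi> 0" by (simp add: mc_def counit_unit)
  also have "\<dots> = mc 0" by (rule mc_K[symmetric]) (simp add: lin_zero[OF counit_linear])
  finally show ?thesis by (simp add: lin_zero[OF mc_lin])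
qed

text \<open>The colinearity of \<open>\<pi>\<close> extends to all of \<open>H\<close>, since \<open>mc 1 = 0\<close>.\<close>

lemma lc_mc:
  assumes F: "bil sH sW ((*) :: 'k \<Rightarrow> 'k \<Rightarrow> 'k) F"
  shows "sw (lc (mc h)) F = ad h (\<lambda>p z. F p (mc z))"
proof -
  note [lin] = bil_lin[OF F] lin_compose[OF mc_lin]
  have b: "bil2 (\<lambda>p z. F p (mc z))" by (intro bilI lin)
  let ?a = "h - sH (\<epsilon> h) \<one>"
  note a = mc_arg[of h]
  have "sw (lc (mc h)) F = sw (coact V (\<pi> ?a)) F"
    using sw_coact[OF mc_C F, of h] by (simp add: mc_def)
  also have "\<dots> = sw [(p, \<pi> w). (p, w) \<leftarrow> coact (ker_counit_crossed H) ?a] F"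
    using \<pi>_morphism a F by (intro tensor_eqD[of sH sW]) (auto simp: crossed_morphism_def vscale_V)
  also have "\<dots> = sw (coact (ker_counit_crossed H) ?a) (\<lambda>p w. F p (mc w))"
    unfolding sw_map_prod using ker_coact_closed[OF a] by (intro sw_cong) (auto simp: mc_K)
  also have "\<dots> = ad ?a (\<lambda>p w. F p (mc w))"
    by (rule tensor_eqD[OF ker_coact_eq[OF a] b])
  also have "\<dots> = ad h (\<lambda>p w. F p (mc w)) - \<epsilon> h * ad \<one> (\<lambda>p w. F p (mc w))"
  proof -
    have "lin1 (\<lambda>x. ad x (\<lambda>p w. F p (mc w)))" by (intro lin)
    from lin_diff[OF this] lin_scale[OF this] show ?thesis by simp
  qed
  also have "ad \<one> (\<lambda>p w. F p (mc w)) = F \<one> (mc \<one>)" by (rule ad_unit; intro lin)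
  also have "\<dots> = 0" by (simp add: mc_unit lin_zero[OF bilD2[OF F]])
  finally show ?thesis by simp
qed

lemma twist_diff_form: "d h = D h (\<lambda>h1 h2. ract \<Omega>x ((\<pi> \<circ> \<alpha>i) (h1 - sH (\<epsilon> h1) \<one>)) h2)"
proof (rule eq_by_functionals[OF vector_space_\<Omega>])
  fix \<phi> :: "'w \<Rightarrow> 'k" assume \<phi>: "lin sW (*) \<phi>"
  let ?R = "\<lambda>\<omega> g. \<phi> (ract \<Omega> \<omega> g)"
  have R: "bil sW sH (*) ?R" by (rule ract_functional[OF \<phi>])
  let ?M = "\<lambda>z b. ?R (mc z) b" and ?Q = "cact2 lc \<Delta> \<chi> ?R"
  have Q: "bil sW sH (*) ?Q" by (rule cact2_bil[OF co\<Omega>(1) comodule_H \<chi>_bil R])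
  note [lin] = bil_lin[OF R] bil_lin[OF Q] lin_compose[OF mc_lin]
  have M: "bil2 ?M" by (intro bilI lin)
  have mci: "(\<pi> \<circ> \<alpha>i) (x - sH (\<epsilon> x) \<one>) = mc (\<alpha>i x)" for x
    by (simp add: mc_def lin_diff[OF alpha_inv_lin] lin_scale[OF alpha_inv_lin] alpha_inv_unit counit_alpha_inv)
  have QM: "?Q (mc z) b = cact2 la \<Delta> \<chi> ?M z b" for z b
    unfolding cact2_def by (rule lc_mc) (unfold cact1_def, intro bilI lin)
  have "\<phi> (D h (\<lambda>h1 h2. ract \<Omega>x ((\<pi> \<circ> \<alpha>i) (h1 - sH (\<epsilon> h1) \<one>)) h2))
      = D h (\<lambda>a b. ?Q (mc (\<alpha>i a)) b)"
    unfolding lin_sw[OF \<phi>] mci twist_ract[OF \<phi> mc_C] ..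
  also have "\<dots> = D h (cact2 la \<Delta> \<chi>' (cact2 la \<Delta> \<chi> ?M))"
    unfolding QM by (rule comult_alpha_inv) (rule cact2_bil[OF comodule_ad comodule_H \<chi>_bil M])
  also have "cact2 la \<Delta> \<chi>' (cact2 la \<Delta> \<chi> ?M) = ?M"
    by (simp only: cact2_assoc[OF comodule_ad comodule_H \<chi>'_bil \<chi>_bil M] \<chi>'_\<chi> ad_counit2[OF M])
  also have "D h ?M = \<phi> (d h)"
    unfolding diff_form[of h] lin_sw[OF \<phi>] mc_def ..
  finally show "\<phi> (d h) = \<phi> (D h (\<lambda>h1 h2. ract \<Omega>x ((\<pi> \<circ> \<alpha>i) (h1 - sH (\<epsilon> h1) \<one>)) h2))" by simp
qed

theorem corresponds_to_twist: "corresponds_to Hx \<Omega>x (Fx V) (\<pi> \<circ> \<alpha>i)"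
  unfolding corresponds_to_def twist_hopf_simps twist_calculus_simps twist_crossed_simps
proof (intro conjI allI ballI impI)
  interpret T: bicovariant_calculus Hx \<Omega>x by (rule bicovariant_calculus_twist)
  show "bicovariant_calculus Hx \<Omega>x" by (rule bicovariant_calculus_twist)
  show "C = right_invariant Hx \<Omega>x" by (simp add: carrier right_invariant_def)
  show "vscale V = sW" by (rule vscale_V)
  show "tensor_eq sH sW (coact V v) (lc v)" if "v \<in> C" for v by (rule coact_lc[OF that])
  show "crossed_morphism Hx (ker_counit_crossed Hx) (Fx V) (\<pi> \<circ> \<alpha>i)"
    by (rule crossed_morphism_compose[OF alpha_inv_morphism_ker projection_morphism])
  have "\<alpha>i ` K = K"
  proof (intro subset_antisym subsetI)
    fix v assume "v \<in> K"
    then have "\<alpha>i (\<alpha> v) \<in> \<alpha>i ` K" by (intro imageI) (simp add: counit_alpha)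
    then show "v \<in> \<alpha>i ` K" by (simp only: alpha_inv_alpha)
  qed (auto simp: counit_alpha_inv)
  then show "(\<pi> \<circ> \<alpha>i) ` K = C" by (simp only: image_comp[symmetric] \<pi>_surj)
  show "\<exists>xs. set xs \<subseteq> C \<times> UNIV \<and> \<omega> = (\<Sum>(v, g)\<leftarrow>xs. ract \<Omega>x v g)" for \<omega> by (rule twist_generates)
  show "tensor_eq sW sH xs ys"
    if "set xs \<subseteq> C \<times> UNIV \<and> set ys \<subseteq> C \<times> UNIV \<and>
        (\<Sum>(v, g)\<leftarrow>xs. ract \<Omega>x v g) = (\<Sum>(v, g)\<leftarrow>ys. ract \<Omega>x v g)" for xs ys
    using that by (intro twist_free) auto
  show "lact \<Omega>x h (ract \<Omega>x v g) = (\<Sum>(h1, h2)\<leftarrow>\<Delta> h. ract \<Omega>x (act (Fx V) h1 v) (h2 \<bullet> g))"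
    if v: "v \<in> C" for h g v
  proof -
    have "lact \<Omega>x h (ract \<Omega>x v g) = ract \<Omega>x (D h (\<lambda>h1 h2. ract \<Omega>x (act (Fx V) h1 v) h2)) g"
      by (simp only: T.lact_ract[symmetric] twist_lact_invariant[OF v])
    also have "\<dots> = D h (\<lambda>h1 h2. ract \<Omega>x (ract \<Omega>x (act (Fx V) h1 v) h2) g)"
      by (rule lin_sw[OF bilD1[OF T.ract_bilinear]])
    finally show ?thesis by (simp add: T.ract_mult sw_def)
  qed
  show "d h = (\<Sum>(h1, h2)\<leftarrow>\<Delta> h. ract \<Omega>x ((\<pi> \<circ> \<alpha>i) (h1 - sH (\<epsilon> h1) \<one>)) h2)" for h
    using twist_diff_form[of h] by (simp add: sw_def)
qed

end

theorem proposition3p5: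
  fixes H :: "('k::field, 'h::ab_group_add) hopf"
    and \<chi> :: "'h \<Rightarrow> 'h \<Rightarrow> 'k"
    and \<Omega> :: "('k, 'h, 'w::ab_group_add) calculus"
    and V :: "('k, 'h, 'w) crossed"
    and \<pi> :: "'h \<Rightarrow> 'w"
  assumes "hopf_algebra H"
    and "unital_2_cocycle H \<chi>"
    and "bicovariant_calculus H \<Omega>"
    and "corresponds_to H \<Omega> V \<pi>"
  shows "crossed_isomorphism (twist_hopf H \<chi>)
           (twist_crossed H \<chi> (regular_crossed H)) (regular_crossed (twist_hopf H \<chi>))
           (twist_alpha H \<chi>) (twist_alpha_inv H \<chi>)
       \<and> crossed_isomorphism (twist_hopf H \<chi>)
           (twist_crossed H \<chi> (ker_counit_crossed H)) (ker_counit_crossed (twist_hopf H \<chi>))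
           (twist_alpha H \<chi>) (twist_alpha_inv H \<chi>)
       \<and> corresponds_to (twist_hopf H \<chi>) (twist_calculus H \<chi> \<Omega>) (twist_crossed H \<chi> V)
           (\<pi> \<circ> twist_alpha_inv H \<chi>)"
proof -
  interpret hopf_algebra H by fact
  obtain \<chi>' where \<chi>': "is_conv_inverse2 H \<chi> \<chi>'"
    using assms(2) by (auto simp: unital_2_cocycle_def)
  interpret projection_twist H \<chi> \<chi>' \<Omega> V \<pi>
  proof (intro projection_twist.intro calculus_twist.intro cocycle_twist.intro assms
      cocycle_twist_axioms.intro projection_twist_axioms.intro)
    show "conv2 \<chi> \<chi>' = eps2" "conv2 \<chi>' \<chi> = eps2" "bil2 \<chi>'"
      using \<chi>' by (simp_all add: is_conv_inverse2_def fun_eq_iff cact2_def cact1_def sw_def)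
    show "bil2 \<chi>" and "\<And>h. \<chi> \<one>\<^bsub>H\<^esub> h = \<epsilon> h"
      using assms(2) by (simp_all add: unital_2_cocycle_def)
    show "D g (\<lambda>g1 g2. D f (\<lambda>f1 f2. \<chi> g1 f1 * \<chi> h (g2 \<cdot>\<^bsub>H\<^esub> f2)))
        = D h (\<lambda>h1 h2. D g (\<lambda>g1 g2. \<chi> h1 g1 * \<chi> (h2 \<cdot>\<^bsub>H\<^esub> g2) f))" for g f h
      using assms(2) unfolding unital_2_cocycle_def sw_def by blast
  qed
  show ?thesis
    by (intro conjI alpha_isomorphism alpha_isomorphism_ker corresponds_to_twist)
qed

end
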